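(* For all $m,k\in\mathbb{C}$ and all $a\in\mathbb{Z}_{>0}$, the following two identities hold in the contragradient Verma module $V(m,k-m)^*$, where $v$ is the generating vector of the Verma module $V(m,k-m)$: $$\frac{f}{T^{a-1}}(v)^* = (m+(a-1)(k+2))\left(\frac{f}{T^{a-1}}v\right)^* + \sum_{\ell=1}^{a-1}\left[\frac{h}{T^\ell}\left(\frac{f}{T^{a-1-\ell}}v\right)^* + 2\,\frac{e}{T^\ell}\sum_{\substack{i+j=a-1-\ell\\ i\geq j\geq 0}}\left(\frac{f}{T^i}\frac{f}{T^j}v\right)^*\right],$$ $$\frac{e}{T^{a}}(v)^* = (a(k+2)-m-2)\left(\frac{e}{T^{a}}v\right)^* + \sum_{\ell=0}^{a-2}\left[-\frac{h}{T^{\ell+1}}\left(\frac{e}{T^{a-\ell-1}}v\right)^* + 2\,\frac{f}{T^\ell}\sum_{\substack{i+j=a-\ell\\ i\geq j\geq 1}}\left(\frac{e}{T^i}\frac{e}{T^j}v\right)^*\right].$$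
   Context: Lie algebra. $\mathfrak{sl}_2$ is the Lie algebra of complex traceless $2\times2$ matrices with standard generators $e,f,h$: $[e,f]=h$, $[h,e]=2e$, $[h,f]=-2f$. The affine Lie algebra is $\widehat{\mathfrak{sl}_2}=\mathfrak{sl}_2[T,T^{-1}]\oplus\mathbb{C}c$ with $c$ central and $[xT^i,yT^j]=[x,y]T^{i+j}+i\,\mathrm{tr}(xy)\,\delta_{i+j,0}\,c$. Write $\frac{x}{T^i}=xT^{-i}$ for $x\in\mathfrak{sl}_2$. Chevalley generators: $e_1=e$, $f_1=f$, $h_1=h$, $e_2=fT$, $f_2=eT^{-1}$, $h_2=c-h$. Verma module. Fix $k\in\mathbb{C}$; the central element $c$ acts on all modules by multiplication by $k$. For $m\in\mathbb{C}$, $V=V(m,k-m)$ is the $\widehat{\mathfrak{sl}_2}$-Verma module generated by a vector $v$ subject to $e_1v=e_2v=0$, $h_1v=mv$, $h_2v=(k-m)v$. It is graded by $\mathbb{Z}_{\ge0}^2$: the vector $f_{i_1}\cdots f_{i_p}v$ with $i_j\in\{1,2\}$ has degree $(p_1,p_2)$, where $p_i$ is the number of $i$'s among $i_1,\dots,i_p$. Let $V_\gamma$ be the homogeneous component of degree $\gamma$ (finite-dimensional). Contragradient Verma module. $V^*=\bigoplus_\gamma V_\gamma^*$ (graded dual), with $\widehat{\mathfrak{sl}_2}$-action determined by $\langle f_i\phi,x\rangle=\langle\phi,e_ix\rangle$, $\langle e_i\phi,x\rangle=\langle\phi,f_ix\rangle$ for $\phi\in V^*$, $x\in V$, $i=1,2$.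 Bases. For $\gamma=(p_1,p_2)$ with $p_1>p_2$, fix in $V_\gamma$ the PBW basis consisting of the vectors $$\frac{f}{T^{i_1}}\cdots\frac{f}{T^{i_r}}\,\frac{h}{T^{j_1}}\cdots\frac{h}{T^{j_s}}\,\frac{e}{T^{l_1}}\cdots\frac{e}{T^{l_q}}\,v,$$ and for $p_1<p_2$ the PBW basis consisting of the vectors $$\frac{e}{T^{l_1}}\cdots\frac{e}{T^{l_q}}\,\frac{h}{T^{j_1}}\cdots\frac{h}{T^{j_s}}\,\frac{f}{T^{i_1}}\cdots\frac{f}{T^{i_r}}\,v,$$ in both cases with $0\le i_r\le\dots\le i_1$, $1\le j_s\le\dots\le j_1$, $1\le l_q\le\dots\le l_1$, $\sum i_u+\sum j_u+\sum l_u+r-q=p_1$, $\sum i_u+\sum j_u+\sum l_u=p_2$ (any of $r,s,q$ may be $0$). In degree $(0,0)$ the basis is $\{v\}$. For a basis vector $w$ of $V_\gamma$, $(w)^*\in V_\gamma^*$ denotes the corresponding element of the dual basis. Empty sums are zero. *)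

theory Defs
  imports "HOL-Analysis.Analysis" "HOL-Library.Poly_Mapping"
begin

section \<open>The affine Lie algebra\<close>

typedef sl2 = "{A :: complex^2^2. trace A = 0}"
  morphisms mat_of Abs_sl2
  by (rule exI[of _ 0]) (simp add: trace_def)

setup_lifting type_definition_sl2

instantiation sl2 :: ab_group_add
begin
lift_definition zero_sl2 :: sl2 is 0 by (simp add: trace_def)
lift_definition plus_sl2 :: "sl2 \<Rightarrow> sl2 \<Rightarrow> sl2" is "(+)" by (simp add: trace_add)
lift_definition minus_sl2 :: "sl2 \<Rightarrow> sl2 \<Rightarrow> sl2" is "(-)" by (simp add: trace_sub)
lift_definition uminus_sl2 :: "sl2 \<Rightarrow> sl2" is uminus by (simp add: trace_def sum_negf)
instance by standard (transfer, simp)+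
end

lift_definition sl2_scale :: "complex \<Rightarrow> sl2 \<Rightarrow> sl2" is "\<lambda>c A. \<chi> i j. c * A $ i $ j"
  by (simp add: trace_def flip: sum_distrib_left)

lift_definition sl2_bracket :: "sl2 \<Rightarrow> sl2 \<Rightarrow> sl2" is "\<lambda>A B. A ** B - B ** A"
  by (metis trace_mul_sym trace_sub right_minus_eq)

lift_definition sl2_transpose :: "sl2 \<Rightarrow> sl2" is transpose
  by (simp add: trace_def transpose_def)

lift_definition sl2_e :: sl2 is "vector [vector [0, 1], vector [0, 0]]"
  by (simp add: trace_def sum_2)
lift_definition sl2_f :: sl2 is "vector [vector [0, 0], vector [1, 0]]"
  by (simp add: trace_def sum_2)
lift_definition sl2_h :: sl2 is "vector [vector [1, 0], vector [0, -1]]"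
  by (simp add: trace_def sum_2)

definition sl2_form :: "sl2 \<Rightarrow> sl2 \<Rightarrow> complex" where
  "sl2_form x y = trace (mat_of x ** mat_of y)"

text \<open>A pair \<open>(p, z)\<close> stands for \<open>(\<Sum>i. p\<^sub>i T\<^sup>i) + z c\<close>.\<close>

type_synonym affine_sl2 = "(int \<Rightarrow>\<^sub>0 sl2) \<times> complex"

definition loop :: "sl2 \<Rightarrow> int \<Rightarrow> affine_sl2" where
  "loop x i = (Poly_Mapping.single i x, 0)"

definition overT :: "sl2 \<Rightarrow> nat \<Rightarrow> affine_sl2" where
  "overT x i = loop x (- int i)"

definition affine_c :: affine_sl2 where
  "affine_c = (0, 1)"

definition affine_scale :: "complex \<Rightarrow> affine_sl2 \<Rightarrow> affine_sl2" where
  "affine_scale a X = (Poly_Mapping.map (sl2_scale a) (fst X), a * snd X)"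

definition affine_bracket :: "affine_sl2 \<Rightarrow> affine_sl2 \<Rightarrow> affine_sl2" where
  "affine_bracket X Y =
    (\<Sum>i\<in>Poly_Mapping.keys (fst X). \<Sum>j\<in>Poly_Mapping.keys (fst Y).
      (Poly_Mapping.single (i + j)
         (sl2_bracket (Poly_Mapping.lookup (fst X) i) (Poly_Mapping.lookup (fst Y) j)),
       if i + j = 0
       then of_int i * sl2_form (Poly_Mapping.lookup (fst X) i) (Poly_Mapping.lookup (fst Y) j)
       else 0))"

datatype node = N1 | N2

fun chev_e :: "node \<Rightarrow> affine_sl2" where
  "chev_e N1 = loop sl2_e 0"
| "chev_e N2 = loop sl2_f 1"

fun chev_f :: "node \<Rightarrow> affine_sl2" where
  "chev_f N1 = loop sl2_f 0"
| "chev_f N2 = loop sl2_e (-1)"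

fun chev_h :: "node \<Rightarrow> affine_sl2" where
  "chev_h N1 = loop sl2_h 0"
| "chev_h N2 = affine_c - loop sl2_h 0"

text \<open>The anti-involution \<open>x T\<^sup>i \<mapsto> x\<^sup>t T\<^sup>-\<^sup>i\<close>, \<open>c \<mapsto> c\<close>, which exchanges \<open>e\<^sub>i\<close> and \<open>f\<^sub>i\<close>.\<close>

definition affine_transpose :: "affine_sl2 \<Rightarrow> affine_sl2" where
  "affine_transpose X =
    (\<Sum>i\<in>Poly_Mapping.keys (fst X).
       Poly_Mapping.single (- i) (sl2_transpose (Poly_Mapping.lookup (fst X) i)), snd X)"


section \<open>Verma modules\<close>

locale affine_module = vector_space scl
  for scl :: "complex \<Rightarrow> 'v::ab_group_add \<Rightarrow> 'v" +
  fixes act :: "affine_sl2 \<Rightarrow> 'v \<Rightarrow> 'v"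
  assumes act_linear: "Vector_Spaces.linear scl scl (act X)"
    and act_add: "act (X + Y) x = act X x + act Y x"
    and act_scale: "act (affine_scale a X) x = scl a (act X x)"
    and act_bracket: "act (affine_bracket X Y) x = act X (act Y x) - act Y (act X x)"

text \<open>
  The free vector space on words in the elements of the affine algebra is the underlying space of
  its free associative algebra. The relators below span the sum of the two-sided ideal defining
  the universal enveloping algebra and of the left ideal generated by the highest weight
  relations, so that the Verma module is the quotient by their span.
\<close>

type_synonym word_space = "affine_sl2 list \<Rightarrow>\<^sub>0 complex"

abbreviation word :: "affine_sl2 list \<Rightarrow> word_space" where
  "word w \<equiv> Poly_Mapping.single w 1"

definition word_scale :: "complex \<Rightarrow> word_space \<Rightarrow> word_space" where
  "word_scale a p = Poly_Mapping.map ((*) a) p"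

fun highest_weight :: "complex \<Rightarrow> complex \<Rightarrow> node \<Rightarrow> complex" where
  "highest_weight m k N1 = m"
| "highest_weight m k N2 = k - m"

inductive_set verma_relators :: "complex \<Rightarrow> complex \<Rightarrow> word_space set" for m k where
  "word (u @ (X + Y) # w) - word (u @ X # w) - word (u @ Y # w) \<in> verma_relators m k"
| "word (u @ affine_scale a X # w) - word_scale a (word (u @ X # w)) \<in> verma_relators m k"
| "word (u @ X # Y # w) - word (u @ Y # X # w) - word (u @ affine_bracket X Y # w)
     \<in> verma_relators m k"
| "word (u @ [chev_e i]) \<in> verma_relators m k"
| "word (u @ [chev_h i]) - word_scale (highest_weight m k i) (word u) \<in> verma_relators m k"

definition word_eval ::
  "(complex \<Rightarrow> 'v::ab_group_add \<Rightarrow> 'v) \<Rightarrow> (affine_sl2 \<Rightarrow> 'v \<Rightarrow> 'v) \<Rightarrow> 'v \<Rightarrow> word_space \<Rightarrow> 'v"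
  where "word_eval scl act v p =
    (\<Sum>w\<in>Poly_Mapping.keys p. scl (Poly_Mapping.lookup p w) (foldr act w v))"

text \<open>
  \<open>verma_module scl act m k v\<close>: the module is \<open>V(m, k - m)\<close> with generating vector \<open>v\<close>,
  that is, it is generated by \<open>v\<close> subject to the highest weight relations and to nothing else.
  (Its isomorphism type is thereby fixed; \<open>c = h\<^sub>1 + h\<^sub>2\<close> acts by \<open>k\<close>.)
\<close>

locale verma_module = affine_module scl act
  for scl :: "complex \<Rightarrow> 'v::ab_group_add \<Rightarrow> 'v" and act +
  fixes m k :: complex and v :: 'v
  assumes generated: "\<exists>p. word_eval scl act v p = x"
    and presented: "word_eval scl act v p = 0 \<longleftrightarrow> p \<in> module.span word_scale (verma_relators m k)"

text \<open>The homogeneous component \<open>V\<^sub>\<gamma>\<close>.\<close>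

definition component ::
  "(complex \<Rightarrow> 'v::ab_group_add \<Rightarrow> 'v) \<Rightarrow> (affine_sl2 \<Rightarrow> 'v \<Rightarrow> 'v) \<Rightarrow> 'v \<Rightarrow> nat \<times> nat \<Rightarrow> 'v set"
  where "component scl act v \<gamma> =
    module.span scl {foldr act (map chev_f is) v |is.
                         count_list is N1 = fst \<gamma> \<and> count_list is N2 = snd \<gamma>}"


section \<open>The contragradient module\<close>

text \<open>
  \<open>V\<^sub>\<gamma>\<^sup>*\<close> is regarded as the space of linear functionals on \<open>V\<close> vanishing on all other components;
  as the components are finite-dimensional, their direct sum is the following space.
\<close>

definition graded_dual ::
  "(complex \<Rightarrow> 'v::ab_group_add \<Rightarrow> 'v) \<Rightarrow> (affine_sl2 \<Rightarrow> 'v \<Rightarrow> 'v) \<Rightarrow> 'v \<Rightarrow> ('v \<Rightarrow> complex) set"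
  where "graded_dual scl act v =
    {\<phi>. Vector_Spaces.linear scl (*) \<phi> \<and>
         finite {\<gamma>. \<exists>x\<in>component scl act v \<gamma>. \<phi> x \<noteq> 0}}"

text \<open>
  The lemmas \<open>contra_chev\<close>, \<open>contra_graded_dual\<close>, \<open>contra_bracket\<close> and \<open>contra_unique\<close> below
  say that this is the unique action of the affine algebra on the graded dual with
  \<open>\<langle>f\<^sub>i \<phi>, x\<rangle> = \<langle>\<phi>, e\<^sub>i x\<rangle>\<close> and \<open>\<langle>e\<^sub>i \<phi>, x\<rangle> = \<langle>\<phi>, f\<^sub>i x\<rangle>\<close>.
\<close>

definition contra ::
  "(affine_sl2 \<Rightarrow> 'v \<Rightarrow> 'v) \<Rightarrow> affine_sl2 \<Rightarrow> ('v \<Rightarrow> complex) \<Rightarrow> ('v \<Rightarrow> complex)"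
  where "contra act X \<phi> = (\<lambda>x. \<phi> (act (affine_transpose X) x))"


section \<open>PBW bases and dual bases\<close>

text \<open>Triples of the exponents of the \<open>f/T\<^sup>i\<close>, \<open>h/T\<^sup>j\<close> and \<open>e/T\<^sup>l\<close>.\<close>

definition pbw_indices :: "nat \<times> nat \<Rightarrow> (nat list \<times> nat list \<times> nat list) set" where
  "pbw_indices \<gamma> =
    {(is, js, ls).
       sorted_wrt (\<ge>) is \<and> sorted_wrt (\<ge>) js \<and> sorted_wrt (\<ge>) ls \<and>
       (\<forall>j\<in>set js. 1 \<le> j) \<and> (\<forall>l\<in>set ls. 1 \<le> l) \<and>
       sum_list is + sum_list js + sum_list ls + length is = fst \<gamma> + length ls \<and>
       sum_list is + sum_list js + sum_list ls = snd \<gamma>}"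

text \<open>
  In degree \<open>(0, 0)\<close> the only index is \<open>([], [], [])\<close>, so the basis is \<open>{v}\<close>. No basis is chosen
  in the other degrees \<open>(p, p)\<close>.
\<close>

definition pbw_basis :: "(affine_sl2 \<Rightarrow> 'v \<Rightarrow> 'v) \<Rightarrow> 'v \<Rightarrow> nat \<times> nat \<Rightarrow> 'v set" where
  "pbw_basis act v \<gamma> =
    (let F = map (overT sl2_f); H = map (overT sl2_h); E = map (overT sl2_e) in
     if fst \<gamma> > snd \<gamma> \<or> \<gamma> = (0, 0)
       then {foldr act (F is @ H js @ E ls) v |is js ls. (is, js, ls) \<in> pbw_indices \<gamma>}
     else if fst \<gamma> < snd \<gamma>
       then {foldr act (E ls @ H js @ F is) v |is js ls. (is, js, ls) \<in> pbw_indices \<gamma>}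
     else {})"

text \<open>\<open>(w)\<^sup>*\<close>, as a functional on \<open>V\<close>: the element of \<open>V\<^sub>\<gamma>\<^sup>*\<close> dual to the member \<open>w\<close> of the
  basis of \<open>V\<^sub>\<gamma>\<close>.\<close>

definition dual_vector ::
  "(complex \<Rightarrow> 'v::ab_group_add \<Rightarrow> 'v) \<Rightarrow> (affine_sl2 \<Rightarrow> 'v \<Rightarrow> 'v) \<Rightarrow> 'v \<Rightarrow> 'v \<Rightarrow> ('v \<Rightarrow> complex)"
  where "dual_vector scl act v w =
    (THE \<phi>. Vector_Spaces.linear scl (*) \<phi> \<and>
       (\<exists>\<gamma>. w \<in> pbw_basis act v \<gamma> \<and>
            (\<forall>b\<in>pbw_basis act v \<gamma>. \<phi> b = (if b = w then 1 else 0)) \<and>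
            (\<forall>\<delta>. \<delta> \<noteq> \<gamma> \<longrightarrow> (\<forall>x\<in>component scl act v \<delta>. \<phi> x = 0))))"


section \<open>Consistency of the definitions\<close>

subsection \<open>The Lie bracket and the anti-involution\<close>

lemma sl2_bracket_zero [simp]: "sl2_bracket 0 y = 0" "sl2_bracket x 0 = 0"
  by (transfer, simp)+

lemma matrix_add_rdistrib: "(A + B) ** C = A ** C + B ** C" for C :: "complex^2^2"
  by (simp add: vec_eq_iff matrix_matrix_mult_def sum.distrib distrib_right)

lemma sl2_bracket_add:
  "sl2_bracket (x + x') y = sl2_bracket x y + sl2_bracket x' y"
  "sl2_bracket x (y + y') = sl2_bracket x y + sl2_bracket x y'"
  by (transfer, simp add: matrix_add_ldistrib matrix_add_rdistrib)+

lemma sl2_form_zero [simp]: "sl2_form 0 y = 0" "sl2_form x 0 = 0"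
  by (simp_all add: sl2_form_def zero_sl2.rep_eq trace_def)

lemma sl2_form_add:
  "sl2_form (x + x') y = sl2_form x y + sl2_form x' y"
  "sl2_form x (y + y') = sl2_form x y + sl2_form x y'"
  by (simp_all add: sl2_form_def plus_sl2.rep_eq matrix_add_ldistrib matrix_add_rdistrib trace_add)

lemma sl2_brackets:
  "sl2_bracket sl2_e sl2_f = sl2_h"
  "sl2_bracket sl2_h sl2_e = sl2_scale 2 sl2_e"
  "sl2_bracket sl2_h sl2_f = sl2_scale (-2) sl2_f"
  by (transfer, simp add: vec_eq_iff forall_2 matrix_matrix_mult_def sum_2)+

lemma sl2_transpose_zero [simp]: "sl2_transpose 0 = 0"
  by transfer (simp add: transpose_def vec_eq_iff)

lemma sl2_transpose_add: "sl2_transpose (x + y) = sl2_transpose x + sl2_transpose y"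
  by transfer (simp add: transpose_def vec_eq_iff)

lemma sl2_transpose_gens:
  "sl2_transpose sl2_e = sl2_f" "sl2_transpose sl2_f = sl2_e" "sl2_transpose sl2_h = sl2_h"
  by (transfer, simp add: vec_eq_iff forall_2 transpose_def)+

lemma sl2_transpose_bracket:
  "sl2_transpose (sl2_bracket x y) = sl2_bracket (sl2_transpose y) (sl2_transpose x)"
proof -
  have *: "transpose (A - B) = transpose A - transpose B" for A B :: "complex^2^2"
    by (simp add: transpose_def vec_eq_iff)
  show ?thesis
    by transfer (simp add: * matrix_transpose_mul)
qed

lemma sl2_form_transpose: "sl2_form (sl2_transpose y) (sl2_transpose x) = sl2_form x y"
  by (simp add: sl2_form_def sl2_transpose.rep_eq trace_def transpose_def
      matrix_matrix_mult_def sum_2 algebra_simps)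

lemma sl2_decomp:
  "\<exists>a b c. x = sl2_scale a sl2_e + sl2_scale b sl2_f + sl2_scale c sl2_h"
proof (transfer, goal_cases)
  case (1 A)
  then have "A$2$2 = - (A$1$1)"
    by (simp add: trace_def sum_2 add_eq_0_iff)
  then show ?case
    by (intro exI[of _ "A$1$2"] exI[of _ "A$2$1"] exI[of _ "A$1$1"])
       (simp add: vec_eq_iff forall_2)
qed

lemma sl2_scale_zero [simp]: "sl2_scale a 0 = 0" and sl2_scale_zero_left [simp]: "sl2_scale 0 x = 0"
  by (transfer, simp add: vec_eq_iff)+

lemma sl2_scale_add: "sl2_scale a (x + y) = sl2_scale a x + sl2_scale a y"
  by transfer (simp add: vec_eq_iff distrib_left)

lemma sl2_scale_one [simp]: "sl2_scale 1 x = x"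
  by transfer (simp add: vec_eq_iff)

lemma sl2_scale_scale [simp]: "sl2_scale a (sl2_scale b x) = sl2_scale (a * b) x"
  by transfer (simp add: vec_eq_iff)

lemma affine_scale_loop: "affine_scale a (loop x i) = loop (sl2_scale a x) i"
  by (auto simp: affine_scale_def loop_def poly_mapping_eq_iff fun_eq_iff lookup_single when_def
      Poly_Mapping.map.rep_eq)

lemma loop_add: "loop (x + y) i = loop x i + loop y i"
  by (simp add: loop_def single_add)

lemma affine_scale_c: "affine_scale a (0, z) = (0, a * z)"
  by (auto simp: affine_scale_def poly_mapping_eq_iff fun_eq_iff Poly_Mapping.map.rep_eq)

lemma affine_sum_loop:
  "X = (\<Sum>i\<in>Poly_Mapping.keys (fst X). loop (Poly_Mapping.lookup (fst X) i) i) + (0, snd X)"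
proof (rule prod_eqI)
  have "fst X = (\<Sum>i\<in>Poly_Mapping.keys (fst X). Poly_Mapping.single i (Poly_Mapping.lookup (fst X) i))"
    by (rule poly_mapping_eqI)
       (simp add: lookup_sum lookup_single when_def in_keys_iff)
  then show "fst X = fst ((\<Sum>i\<in>Poly_Mapping.keys (fst X). loop (Poly_Mapping.lookup (fst X) i) i) + (0, snd X))"
    by (simp add: fst_sum loop_def)
qed (simp add: snd_sum loop_def)

lemma affine_induct [case_names loop central add]:
  assumes "\<And>x i. P (loop x i)" "\<And>z. P (0, z)" "\<And>X Y. P X \<Longrightarrow> P Y \<Longrightarrow> P (X + Y)"
  shows "P X"
proof -
  have "P (\<Sum>i\<in>K. loop (g i) i)" if "finite K" for K g
    using that
  proof (induction K)
    case empty
    show ?case using assms(2)[of 0] by (simp add: zero_prod_def)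
  qed (simp add: assms)
  then have "P ((\<Sum>i\<in>Poly_Mapping.keys (fst X). loop (Poly_Mapping.lookup (fst X) i) i) + (0, snd X))"
    by (intro assms) simp
  then show ?thesis
    by (simp only: affine_sum_loop[symmetric])
qed

lemma affine_bracket_superset:
  assumes "finite I" "Poly_Mapping.keys (fst X) \<subseteq> I" "finite J" "Poly_Mapping.keys (fst Y) \<subseteq> J"
  shows "affine_bracket X Y =
    (\<Sum>i\<in>I. \<Sum>j\<in>J.
      (Poly_Mapping.single (i + j)
         (sl2_bracket (Poly_Mapping.lookup (fst X) i) (Poly_Mapping.lookup (fst Y) j)),
       if i + j = 0
       then of_int i * sl2_form (Poly_Mapping.lookup (fst X) i) (Poly_Mapping.lookup (fst Y) j)
       else 0))"
  unfolding affine_bracket_def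
  by (intro sum.mono_neutral_cong_left sum.neutral ballI assms)
     (auto simp: in_keys_iff zero_prod_def)

lemma affine_bracket_add:
  "affine_bracket (X + X') Y = affine_bracket X Y + affine_bracket X' Y" (is ?l)
  "affine_bracket Y (X + X') = affine_bracket Y X + affine_bracket Y X'" (is ?r)
proof -
  define K where "K = Poly_Mapping.keys (fst X) \<union> Poly_Mapping.keys (fst X')"
  have K: "finite K" "Poly_Mapping.keys (fst X) \<subseteq> K" "Poly_Mapping.keys (fst X') \<subseteq> K"
    "Poly_Mapping.keys (fst (X + X')) \<subseteq> K"
    using Poly_Mapping.keys_add[of "fst X" "fst X'"] by (auto simp: K_def)
  note [simp] = affine_bracket_superset[OF K(1) _ finite_keys order.refl]
    affine_bracket_superset[OF finite_keys order.refl K(1)]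
  show ?l ?r
    using K
    by (auto simp: lookup_add sl2_bracket_add sl2_form_add single_add distrib_left
        simp flip: sum.distrib intro!: sum.cong)
qed

lemma affine_bracket_loop:
  "affine_bracket (loop x i) (loop y j) =
     loop (sl2_bracket x y) (i + j) + (0, if i + j = 0 then of_int i * sl2_form x y else 0)"
  using affine_bracket_superset[of "{i}" "loop x i" "{j}" "loop y j"]
  by (simp add: loop_def)

lemma affine_bracket_central [simp]: "affine_bracket (0, z) Y = 0" "affine_bracket X (0, z) = 0"
  by (simp_all add: affine_bracket_def)

lemma affine_transpose_superset:
  assumes "finite I" "Poly_Mapping.keys (fst X) \<subseteq> I"
  shows "affine_transpose X =
    (\<Sum>i\<in>I. Poly_Mapping.single (- i) (sl2_transpose (Poly_Mapping.lookup (fst X) i)), snd X)"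
  unfolding affine_transpose_def
  by (intro arg_cong2[of _ _ _ _ Pair] sum.mono_neutral_cong_left refl assms)
     (auto simp: in_keys_iff)

lemma affine_transpose_add: "affine_transpose (X + Y) = affine_transpose X + affine_transpose Y"
proof -
  define K where "K = Poly_Mapping.keys (fst X) \<union> Poly_Mapping.keys (fst Y)"
  have K: "finite K" "Poly_Mapping.keys (fst X) \<subseteq> K" "Poly_Mapping.keys (fst Y) \<subseteq> K"
    "Poly_Mapping.keys (fst (X + Y)) \<subseteq> K"
    using Poly_Mapping.keys_add[of "fst X" "fst Y"] by (auto simp: K_def)
  show ?thesis
    using K by (simp add: affine_transpose_superset[OF K(1)] lookup_add sl2_transpose_add single_add
        sum.distrib)
qed

lemma affine_transpose_loop [simp]: "affine_transpose (loop x i) = loop (sl2_transpose x) (- i)"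
  using affine_transpose_superset[of "{i}" "loop x i"] by (simp add: loop_def)

lemma affine_transpose_central [simp]: "affine_transpose (0, z) = (0, z)"
  by (simp add: affine_transpose_def)

lemma affine_transpose_zero [simp]: "affine_transpose 0 = 0"
  by (simp add: affine_transpose_def zero_prod_def)

lemma affine_transpose_scale:
  "affine_transpose (affine_scale a X) = affine_scale a (affine_transpose X)"
proof -
  have add: "affine_scale a (X + Y) = affine_scale a X + affine_scale a Y" for X Y
  proof (rule prod_eqI)
    have "Poly_Mapping.lookup (Poly_Mapping.map (sl2_scale a) p) i =
        sl2_scale a (Poly_Mapping.lookup p i)" for p :: "int \<Rightarrow>\<^sub>0 sl2" and i
      by (simp add: Poly_Mapping.map.rep_eq when_def)
    then show "fst (affine_scale a (X + Y)) = fst (affine_scale a X + affine_scale a Y)"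
      by (intro poly_mapping_eqI) (simp add: affine_scale_def lookup_add sl2_scale_add)
  qed (simp add: affine_scale_def distrib_left)
  have "sl2_transpose (sl2_scale a x) = sl2_scale a (sl2_transpose x)" for x
    by transfer (simp add: transpose_def)
  then show ?thesis
    by (induction X rule: affine_induct)
       (simp_all add: affine_scale_loop affine_scale_c add affine_transpose_add)
qed

lemma affine_transpose_bracket:
  "affine_transpose (affine_bracket X Y) = affine_bracket (affine_transpose Y) (affine_transpose X)"
proof (induction X rule: affine_induct)
  case (loop x i)
  show ?case
  proof (induction Y rule: affine_induct)
    case (loop y j)
    show ?case
      by (auto simp: affine_bracket_loop affine_transpose_add sl2_transpose_bracket
          sl2_form_transpose add.commute add_eq_0_iff)
  qed (simp_all add: affine_bracket_add affine_transpose_add)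
qed (simp_all add: affine_bracket_add affine_transpose_add)

lemma affine_transpose_chev [simp]:
  "affine_transpose (chev_e i) = chev_f i" "affine_transpose (chev_f i) = chev_e i"
  by (cases i; simp add: sl2_transpose_gens)+

lemma chev_induct [case_names e f add scale bracket]:
  assumes e: "\<And>i. P (chev_e i)" and f: "\<And>i. P (chev_f i)"
    and add: "\<And>X Y. P X \<Longrightarrow> P Y \<Longrightarrow> P (X + Y)"
    and scale: "\<And>a X. P X \<Longrightarrow> P (affine_scale a X)"
    and bracket: "\<And>X Y. P X \<Longrightarrow> P Y \<Longrightarrow> P (affine_bracket X Y)"
  shows "P X"
proof -
  have form: "sl2_form sl2_e sl2_f = 1" "sl2_form sl2_f sl2_e = 1"
    "sl2_form sl2_h sl2_e = 0" "sl2_form sl2_h sl2_f = 0"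
    by (simp_all add: sl2_form_def sl2_e.rep_eq sl2_f.rep_eq sl2_h.rep_eq trace_def
        matrix_matrix_mult_def sum_2)
  have fe: "sl2_bracket sl2_f sl2_e = sl2_scale (-1) sl2_h"
    by transfer (simp add: vec_eq_iff forall_2 matrix_matrix_mult_def sum_2)
  have zero: "P 0"
    using scale[OF e[of N1], of 0] by (simp add: affine_scale_loop) (simp add: loop_def zero_prod_def)
  have loop: "P (loop (sl2_scale a x) i)" if "P (loop x i)" for a x i
    using scale[OF that, of a] by (simp add: affine_scale_loop)
  have loop': "P (loop x i)" if "P (loop (sl2_scale a x) i)" "a \<noteq> 0" for a x i
    using loop[OF that(1), of "inverse a"] that(2) by simp
  have E0: "P (loop sl2_e 0)" and F1: "P (loop sl2_f 1)" and F0: "P (loop sl2_f 0)"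
    and E1: "P (loop sl2_e (-1))"
    using e[of N1] e[of N2] f[of N1] f[of N2] by simp_all
  have H0: "P (loop sl2_h 0)"
    using bracket[OF E0 F0] by (simp add: affine_bracket_loop sl2_brackets flip: zero_prod_def)
  have H1: "P (loop sl2_h 1)"
    using bracket[OF E0 F1] by (simp add: affine_bracket_loop sl2_brackets flip: zero_prod_def)
  have H1': "P (loop sl2_h (-1))"
    using bracket[OF E1 F0] by (simp add: affine_bracket_loop sl2_brackets flip: zero_prod_def)
  have E: "P (loop sl2_e n)" for n
  proof (induction n rule: int_induct[where k = 0])
    case (step1 i)
    then have "P (loop (sl2_scale 2 sl2_e) (1 + i))"
      using bracket[OF H1 step1(2)]
      by (simp add: affine_bracket_loop sl2_brackets form flip: zero_prod_def)
    then show ?case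
      using loop' by (simp add: add.commute)
  next
    case (step2 i)
    then have "P (loop (sl2_scale 2 sl2_e) (-1 + i))"
      using bracket[OF H1' step2(2)]
      by (simp add: affine_bracket_loop sl2_brackets form flip: zero_prod_def)
    then show ?case
      using loop' by simp
  qed (fact E0)
  have F: "P (loop sl2_f n)" for n
  proof (induction n rule: int_induct[where k = 0])
    case (step1 i)
    then have "P (loop (sl2_scale (-2) sl2_f) (1 + i))"
      using bracket[OF H1 step1(2)]
      by (simp add: affine_bracket_loop sl2_brackets form flip: zero_prod_def)
    then show ?case
      using loop'[of "-2"] by (simp add: add.commute)
  next
    case (step2 i)
    then have "P (loop (sl2_scale (-2) sl2_f) (-1 + i))"
      using bracket[OF H1' step2(2)]
      by (simp add: affine_bracket_loop sl2_brackets form flip: zero_prod_def)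
    then show ?case
      using loop'[of "-2"] by simp
  qed (fact F0)
  have H: "P (loop sl2_h n)" for n
  proof (cases "n = 0")
    case False
    then show ?thesis
      using bracket[OF E[of n] F[of 0]]
      by (simp add: affine_bracket_loop sl2_brackets flip: zero_prod_def)
  qed (use H0 in simp)
  have C: "P (0, z)" for z
  proof -
    have "P (affine_bracket (loop sl2_e 1) (loop sl2_f (-1)) + affine_scale (-1) (loop sl2_h 0))"
      by (intro add scale bracket E F H)
    also have "affine_bracket (loop sl2_e 1) (loop sl2_f (-1)) + affine_scale (-1) (loop sl2_h 0) = (0, 1)"
    proof -
      have "sl2_h + sl2_scale (-1) sl2_h = 0"
        by transfer (simp add: vec_eq_iff)
      then show ?thesis
        by (simp add: affine_bracket_loop sl2_brackets form affine_scale_loop)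
           (simp add: loop_def zero_prod_def flip: single_add)
    qed
    finally show ?thesis
      using scale[of "(0, 1)" z] by (simp add: affine_scale_c)
  qed
  show ?thesis
  proof (induction X rule: affine_induct)
    case (loop x i)
    obtain a b c where "x = sl2_scale a sl2_e + sl2_scale b sl2_f + sl2_scale c sl2_h"
      using sl2_decomp by blast
    then show ?case
      by (simp add: loop_add) (intro add \<open>\<And>a x i. P (loop x i) \<Longrightarrow> P (loop (sl2_scale a x) i)\<close> E F H)
  qed (simp_all add: C add)
qed

subsection \<open>The contragradient action\<close>

lemma contra_chev:
  "contra act (chev_f i) \<phi> x = \<phi> (act (chev_e i) x)"
  "contra act (chev_e i) \<phi> x = \<phi> (act (chev_f i) x)"
  by (simp_all add: contra_def)

context verma_module
begin

lemma act_simps: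
  "act X (x + y) = act X x + act X y" "act X (x - y) = act X x - act X y" "act X 0 = 0"
  "act X (scl a x) = scl a (act X x)"
proof -
  interpret l: Vector_Spaces.linear scl scl "act X"
    by (rule act_linear)
  show "act X (x + y) = act X x + act X y" "act X (x - y) = act X x - act X y" "act X 0 = 0"
    "act X (scl a x) = scl a (act X x)"
    by (simp_all add: l.add l.diff l.zero l.scale)
qed

lemma graded_dual_linear:
  assumes "\<phi> \<in> graded_dual scl act v"
  shows "\<phi> (x + y) = \<phi> x + \<phi> y" "\<phi> (x - y) = \<phi> x - \<phi> y" "\<phi> (scl a x) = a * \<phi> x"
proof -
  interpret l: Vector_Spaces.linear scl "(*)" \<phi>
    using assms by (simp add: graded_dual_def)
  show "\<phi> (x + y) = \<phi> x + \<phi> y" "\<phi> (x - y) = \<phi> x - \<phi> y" "\<phi> (scl a x) = a * \<phi> x"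
    by (simp_all add: l.add l.diff l.scale)
qed

lemma contra_add:
  "\<phi> \<in> graded_dual scl act v \<Longrightarrow> contra act (X + Y) \<phi> x = contra act X \<phi> x + contra act Y \<phi> x"
  by (simp add: contra_def affine_transpose_add act_add graded_dual_linear)

lemma contra_scale:
  "\<phi> \<in> graded_dual scl act v \<Longrightarrow> contra act (affine_scale a X) \<phi> x = a * contra act X \<phi> x"
  by (simp add: contra_def affine_transpose_scale act_scale graded_dual_linear)

lemma contra_bracket:
  "\<phi> \<in> graded_dual scl act v \<Longrightarrow>
    contra act (affine_bracket X Y) \<phi> x =
      contra act X (contra act Y \<phi>) x - contra act Y (contra act X \<phi>) x"
  by (simp add: contra_def affine_transpose_bracket act_bracket graded_dual_linear)

lemma word_eval_superset:
  assumes "finite W" "Poly_Mapping.keys p \<subseteq> W"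
  shows "word_eval scl act v p = (\<Sum>w\<in>W. scl (Poly_Mapping.lookup p w) (foldr act w v))"
  unfolding word_eval_def
  by (intro sum.mono_neutral_left assms ballI) (auto simp: in_keys_iff)

lemma word_eval_word [simp]: "word_eval scl act v (word w) = foldr act w v"
  using word_eval_superset[of "{w}" "word w"] by simp

lemma word_eval_diff: "word_eval scl act v (p - q) = word_eval scl act v p - word_eval scl act v q"
proof -
  define W where "W = Poly_Mapping.keys p \<union> Poly_Mapping.keys q"
  have W: "finite W" "Poly_Mapping.keys p \<subseteq> W" "Poly_Mapping.keys q \<subseteq> W"
    "Poly_Mapping.keys (p - q) \<subseteq> W"
    using keys_diff[of p q] by (auto simp: W_def)
  show ?thesis
    using W by (simp add: word_eval_superset[OF W(1)] lookup_minus scale_left_diff_distrib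
        sum_subtractf)
qed

lemma word_eval_scale: "word_eval scl act v (word_scale a p) = scl a (word_eval scl act v p)"
proof -
  have *: "Poly_Mapping.lookup (word_scale a p) w = a * Poly_Mapping.lookup p w" for w
    by (simp add: word_scale_def Poly_Mapping.map.rep_eq when_def)
  have "Poly_Mapping.keys (word_scale a p) \<subseteq> Poly_Mapping.keys p"
    by (auto simp: in_keys_iff *)
  then show ?thesis
    by (simp add: word_eval_superset[OF finite_keys, of "word_scale a p" p] * scale_sum_right
        word_eval_def[of _ _ _ p])
qed

lemma vector_space_word_scale: "vector_space word_scale"
proof -
  have "Poly_Mapping.lookup (word_scale a p) w = a * Poly_Mapping.lookup p w" for a p w
    by (simp add: word_scale_def Poly_Mapping.map.rep_eq when_def)
  then show ?thesis
    by unfold_locales (auto intro!: poly_mapping_eqI simp: lookup_add algebra_simps)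
qed

lemma highest_weight_vector:
  "act (chev_e i) v = 0" "act (chev_h i) v = scl (highest_weight m k i) v"
proof -
  interpret W: vector_space word_scale by (rule vector_space_word_scale)
  have "word_eval scl act v p = 0" if "p \<in> verma_relators m k" for p
    using that presented by (simp add: W.span_base)
  from this[OF verma_relators.intros(4)[of "[]" i]] this[OF verma_relators.intros(5)[of "[]" i]]
  show "act (chev_e i) v = 0" "act (chev_h i) v = scl (highest_weight m k i) v"
    by (simp_all add: word_eval_diff word_eval_scale)
qed

lemma bracket_ef:
  "affine_bracket (chev_e i) (chev_f j) = (if i = j then chev_h i else 0)"
proof -
  have [simp]: "sl2_form sl2_f sl2_e = 1"
    by (simp add: sl2_form_def sl2_e.rep_eq sl2_f.rep_eq trace_def matrix_matrix_mult_def sum_2)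
  have [simp]: "sl2_bracket sl2_f sl2_e = - sl2_h" "sl2_bracket x x = 0" for x
    by (transfer, simp add: vec_eq_iff forall_2 matrix_matrix_mult_def sum_2)+
  show ?thesis
    by (cases i; cases j)
       (simp_all add: affine_bracket_loop sl2_brackets, simp_all add: loop_def affine_c_def
         zero_prod_def single_uminus)
qed

fun cartan :: "node \<Rightarrow> node \<Rightarrow> complex" where
  "cartan i j = (if i = j then 2 else -2)"

lemma bracket_hf: "affine_bracket (chev_h i) (chev_f j) = affine_scale (- cartan i j) (chev_f j)"
proof -
  have [simp]: "sl2_form sl2_h sl2_e = 0" "sl2_form sl2_h sl2_f = 0"
    by (simp_all add: sl2_form_def sl2_e.rep_eq sl2_f.rep_eq sl2_h.rep_eq trace_def
        matrix_matrix_mult_def sum_2)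
  have h2: "affine_c - loop sl2_h 0 = (0, 1) + loop (- sl2_h) 0"
    by (simp add: loop_def affine_c_def single_uminus)
  have [simp]: "sl2_bracket (- x) y = - sl2_bracket x y" for x y
    using sl2_bracket_add(1)[of x "-x" y] by (simp add: eq_neg_iff_add_eq_0 add.commute)
  have [simp]: "sl2_form (- x) y = - sl2_form x y" for x y
    using sl2_form_add(1)[of x "-x" y] by (simp add: eq_neg_iff_add_eq_0 add.commute)
  have [simp]: "- sl2_scale a x = sl2_scale (- a) x" for a x
    by (transfer, simp add: vec_eq_iff)
  show ?thesis
    by (cases i; cases j)
       (simp_all add: h2 affine_bracket_add affine_bracket_loop sl2_brackets affine_scale_loop
         flip: zero_prod_def)
qed

definition f_word :: "node list \<Rightarrow> 'v" where
  "f_word w = foldr act (map chev_f w) v"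

lemma f_word_simps [simp]: "f_word [] = v" "f_word (i # w) = act (chev_f i) (f_word w)"
  by (simp_all add: f_word_def)

definition shifted :: "node \<Rightarrow> nat \<times> nat \<Rightarrow> 'v set" where
  "shifted i \<gamma> =
    span {f_word w |w. count_list (i # w) N1 = fst \<gamma> \<and> count_list (i # w) N2 = snd \<gamma>}"

lemma act_span:
  assumes "x \<in> span S" "\<And>y. y \<in> S \<Longrightarrow> act X y \<in> span S'"
  shows "act X x \<in> span S'"
  using assms(1)
  by (induction rule: span_induct_alt)
     (auto simp: act_simps intro: span_add span_scale span_zero assms(2))

lemma act_h_word: "\<exists>a. act (chev_h i) (f_word w) = scl a (f_word w)"
proof (induction w)
  case (Cons j w)
  then obtain a where a: "act (chev_h i) (f_word w) = scl a (f_word w)" by blast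
  have "act (chev_h i) (f_word (j # w)) =
      act (affine_bracket (chev_h i) (chev_f j)) (f_word w) + act (chev_f j) (act (chev_h i) (f_word w))"
    by (simp add: act_bracket)
  also have "\<dots> = scl (- cartan i j + a) (f_word (j # w))"
    by (simp only: bracket_hf act_scale a act_simps scale_left_distrib f_word_simps)
  finally show ?case by blast
qed (auto simp: highest_weight_vector)

lemma act_e_word:
  "act (chev_e i) (f_word w) \<in> shifted i (count_list w N1, count_list w N2)"
proof (induction w)
  case Nil
  show ?case by (simp add: highest_weight_vector shifted_def span_zero)
next
  case (Cons j w)
  let ?\<gamma> = "(count_list (j # w) N1, count_list (j # w) N2)"
  have "act (chev_f j) (act (chev_e i) (f_word w)) \<in> shifted i ?\<gamma>"
    using Cons unfolding shifted_def
  proof (rule act_span, goal_cases)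
    case (1 y)
    then obtain u where u: "y = f_word u" "count_list (i # u) N1 = count_list w N1"
      "count_list (i # u) N2 = count_list w N2"
      by auto
    show ?case
      by (intro span_base CollectI exI[of _ "j # u"] conjI) (use u in \<open>auto split: if_splits\<close>)
  qed
  moreover have "act (affine_bracket (chev_e i) (chev_f j)) (f_word w) \<in> shifted i ?\<gamma>"
  proof (cases "i = j")
    case True
    obtain a where a: "act (chev_h i) (f_word w) = scl a (f_word w)"
      using act_h_word by blast
    have "f_word w \<in> shifted j ?\<gamma>"
      unfolding shifted_def fst_conv snd_conv by (rule span_base) blast
    then have "scl a (f_word w) \<in> shifted j ?\<gamma>"
      unfolding shifted_def by (rule span_scale)
    then show ?thesis
      using a by (simp only: bracket_ef True refl if_True)
  next
    case False
    have "act 0 x = 0" for x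
      using act_add[of 0 0 x] by simp
    with False show ?thesis by (simp add: bracket_ef shifted_def span_zero)
  qed
  ultimately have "act (affine_bracket (chev_e i) (chev_f j)) (f_word w) +
      act (chev_f j) (act (chev_e i) (f_word w)) \<in> shifted i ?\<gamma>"
    unfolding shifted_def by (rule span_add[rotated])
  then show ?case by (simp add: act_bracket)
qed

lemma component_altdef:
  "component scl act v \<gamma> =
    span {f_word w |w. count_list w N1 = fst \<gamma> \<and> count_list w N2 = snd \<gamma>}"
  by (simp add: component_def f_word_def)

definition raise :: "node \<Rightarrow> nat \<times> nat \<Rightarrow> nat \<times> nat" where
  "raise i \<gamma> = (if i = N1 then (Suc (fst \<gamma>), snd \<gamma>) else (fst \<gamma>, Suc (snd \<gamma>)))"

lemma act_f_component:
  assumes "x \<in> component scl act v \<gamma>"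
  shows "act (chev_f i) x \<in> component scl act v (raise i \<gamma>)"
  using assms unfolding component_altdef
proof (rule act_span, goal_cases)
  case (1 y)
  then obtain w where w: "y = f_word w" "count_list w N1 = fst \<gamma>" "count_list w N2 = snd \<gamma>"
    by auto
  show ?case
    by (intro span_base CollectI exI[of _ "i # w"] conjI; cases i) (simp_all add: w raise_def)
qed

lemma act_e_component:
  assumes "x \<in> component scl act v \<gamma>"
  shows "act (chev_e i) x = 0 \<or>
    (\<exists>\<delta>. \<gamma> = raise i \<delta> \<and> act (chev_e i) x \<in> component scl act v \<delta>)"
proof -
  have *: "act (chev_e i) x \<in> shifted i \<gamma>"
    using assms unfolding component_altdef shifted_def
  proof (rule act_span, goal_cases)
    case (1 y)
    then obtain w where "y = f_word w" "\<gamma> = (count_list w N1, count_list w N2)"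
      by (auto simp: prod_eq_iff)
    then show ?case
      using act_e_word[of i w] by (simp only: shifted_def)
  qed
  show ?thesis
  proof (cases "\<exists>\<delta>. \<gamma> = raise i \<delta>")
    case True
    then obtain \<delta> where \<delta>: "\<gamma> = raise i \<delta>" by blast
    have "shifted i \<gamma> = component scl act v \<delta>"
      unfolding shifted_def component_altdef \<delta> by (cases i) (simp_all add: raise_def)
    with * \<delta> show ?thesis by blast
  next
    case False
    have "\<not> (count_list (i # w) N1 = fst \<gamma> \<and> count_list (i # w) N2 = snd \<gamma>)" for w
    proof
      assume "count_list (i # w) N1 = fst \<gamma> \<and> count_list (i # w) N2 = snd \<gamma>"
      then have "\<gamma> = raise i (count_list w N1, count_list w N2)"
        by (cases i; cases \<gamma>) (simp_all add: raise_def)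
      with False show False by blast
    qed
    then have "shifted i \<gamma> = {0}"
      by (simp only: shifted_def) simp
    with * show ?thesis by simp
  qed
qed

lemma inj_raise: "inj (raise i)"
  by (cases i) (auto simp: raise_def inj_def prod_eq_iff)

lemma linear_contra:
  assumes "Vector_Spaces.linear scl (*) \<phi>"
  shows "Vector_Spaces.linear scl (*) (contra act X \<phi>)"
  using Vector_Spaces.linear_compose[OF act_linear assms]
  by (simp add: contra_def comp_def)

theorem contra_graded_dual:
  assumes "\<phi> \<in> graded_dual scl act v"
  shows "contra act X \<phi> \<in> graded_dual scl act v"
proof -
  define supp where "supp \<phi> = {\<gamma>. \<exists>x\<in>component scl act v \<gamma>. \<phi> x \<noteq> 0}" for \<phi> :: "'v \<Rightarrow> complex"
  have mem: "\<phi> \<in> graded_dual scl act v \<longleftrightarrow> Vector_Spaces.linear scl (*) \<phi> \<and> finite (supp \<phi>)" for \<phi>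
    by (simp add: graded_dual_def supp_def)
  have "\<forall>\<phi>\<in>graded_dual scl act v. finite (supp (contra act X \<phi>))"
  proof (induction X rule: chev_induct)
    case (e i)
    show ?case
    proof
      fix \<phi> assume \<phi>: "\<phi> \<in> graded_dual scl act v"
      have "supp (contra act (chev_e i) \<phi>) \<subseteq> raise i -` supp \<phi>"
        using act_f_component by (fastforce simp: supp_def contra_chev)
      moreover have "finite (raise i -` supp \<phi>)"
        using \<phi> inj_raise by (auto simp: mem intro: finite_vimageI)
      ultimately show "finite (supp (contra act (chev_e i) \<phi>))" by (rule finite_subset)
    qed
  next
    case (f i)
    show ?case
    proof
      fix \<phi> assume \<phi>: "\<phi> \<in> graded_dual scl act v"
      have "\<phi> 0 = 0" using graded_dual_linear(2)[OF \<phi>, of 0 0] by simp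
      have "supp (contra act (chev_f i) \<phi>) \<subseteq> raise i ` supp \<phi>"
      proof
        fix \<gamma> assume "\<gamma> \<in> supp (contra act (chev_f i) \<phi>)"
        then obtain x where x: "x \<in> component scl act v \<gamma>" "\<phi> (act (chev_e i) x) \<noteq> 0"
          by (auto simp: supp_def contra_chev)
        then have "act (chev_e i) x \<noteq> 0" using \<open>\<phi> 0 = 0\<close> by auto
        with x act_e_component[OF x(1), of i] show "\<gamma> \<in> raise i ` supp \<phi>"
          by (auto simp: supp_def)
      qed
      moreover have "finite (raise i ` supp \<phi>)"
        using \<phi> by (simp add: mem)
      ultimately show "finite (supp (contra act (chev_f i) \<phi>))" by (rule finite_subset)
    qed
  next
    case (add X Y)
    show ?case
    proof
      fix \<phi> assume \<phi>: "\<phi> \<in> graded_dual scl act v"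
      have "supp (contra act (X + Y) \<phi>) \<subseteq> supp (contra act X \<phi>) \<union> supp (contra act Y \<phi>)"
        by (auto simp: supp_def contra_add[OF \<phi>])
      then show "finite (supp (contra act (X + Y) \<phi>))"
        using add \<phi> by (meson finite_UnI finite_subset)
    qed
  next
    case (scale a X)
    show ?case
    proof
      fix \<phi> assume \<phi>: "\<phi> \<in> graded_dual scl act v"
      have "supp (contra act (affine_scale a X) \<phi>) \<subseteq> supp (contra act X \<phi>)"
        by (auto simp: supp_def contra_scale[OF \<phi>])
      then show "finite (supp (contra act (affine_scale a X) \<phi>))"
        using scale \<phi> by (meson finite_subset)
    qed
  next
    case (bracket X Y)
    show ?case
    proof
      fix \<phi> assume \<phi>: "\<phi> \<in> graded_dual scl act v"
      have "supp (contra act (affine_bracket X Y) \<phi>) \<subseteq>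
          supp (contra act X (contra act Y \<phi>)) \<union> supp (contra act Y (contra act X \<phi>))"
        by (auto simp: supp_def contra_bracket[OF \<phi>])
      moreover have "contra act X \<phi> \<in> graded_dual scl act v" "contra act Y \<phi> \<in> graded_dual scl act v"
        using bracket \<phi> linear_contra by (auto simp: mem)
      ultimately show "finite (supp (contra act (affine_bracket X Y) \<phi>))"
        using bracket by (meson finite_UnI finite_subset)
    qed
  qed
  then show ?thesis
    using assms linear_contra by (auto simp: mem)
qed

theorem contra_unique:
  assumes add: "\<And>X Y \<phi> x. \<phi> \<in> graded_dual scl act v \<Longrightarrow> \<sigma> (X + Y) \<phi> x = \<sigma> X \<phi> x + \<sigma> Y \<phi> x"
    and scale: "\<And>X a \<phi> x. \<phi> \<in> graded_dual scl act v \<Longrightarrow> \<sigma> (affine_scale a X) \<phi> x = a * \<sigma> X \<phi> x"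
    and bracket: "\<And>X Y \<phi> x. \<phi> \<in> graded_dual scl act v \<Longrightarrow>
      \<sigma> (affine_bracket X Y) \<phi> x = \<sigma> X (\<sigma> Y \<phi>) x - \<sigma> Y (\<sigma> X \<phi>) x"
    and chev: "\<And>i \<phi> x. \<phi> \<in> graded_dual scl act v \<Longrightarrow> \<sigma> (chev_f i) \<phi> x = \<phi> (act (chev_e i) x)"
      "\<And>i \<phi> x. \<phi> \<in> graded_dual scl act v \<Longrightarrow> \<sigma> (chev_e i) \<phi> x = \<phi> (act (chev_f i) x)"
    and "\<phi> \<in> graded_dual scl act v"
  shows "\<sigma> X \<phi> = contra act X \<phi>"
proof -
  have "\<forall>\<phi>\<in>graded_dual scl act v. \<sigma> X \<phi> = contra act X \<phi>"
  proof (induction X rule: chev_induct)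
    case (bracket X Y)
    show ?case
    proof
      fix \<phi> assume \<phi>: "\<phi> \<in> graded_dual scl act v"
      have "\<sigma> X \<phi> = contra act X \<phi>" "\<sigma> Y \<phi> = contra act Y \<phi>"
        "\<sigma> X (contra act Y \<phi>) = contra act X (contra act Y \<phi>)"
        "\<sigma> Y (contra act X \<phi>) = contra act Y (contra act X \<phi>)"
        using bracket \<phi> contra_graded_dual[OF \<phi>] by blast+
      then show "\<sigma> (affine_bracket X Y) \<phi> = contra act (affine_bracket X Y) \<phi>"
        using \<phi> by (intro ext) (simp add: contra_bracket assms(3))
    qed
  qed (intro ballI ext; simp add: chev contra_chev assms(1,2) contra_add contra_scale)+
  then show ?thesis
    using \<open>\<phi> \<in> graded_dual scl act v\<close> by (rule bspec)
qed

end

subsection \<open>The basis in degree zero\<close>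

lemma pbw_basis_zero: "pbw_basis act v (0, 0) = {v}"
proof -
  have "(is, js, ls) \<in> pbw_indices (0, 0) \<longleftrightarrow> is = [] \<and> js = [] \<and> ls = []" for "is" js ls
    by (cases "is"; cases js; cases ls) (auto simp: pbw_indices_def)
  then show ?thesis by (simp add: pbw_basis_def)
qed

end

theory Submission
  imports Defs "HOL-Computational_Algebra.Polynomial"
begin

text \<open>
  The Verma module is free over the enveloping algebra of the lower triangular part \<open>n\<close>, so an
  \<open>n\<close>-module with a chosen vector provides functionals on it. Evaluating \<open>T\<close> at 1 and taking the
  \<open>sl\<^sub>2\<close> Verma module of highest weight 0 yields functionals \<open>\<psi>\<^bsub>d,n\<^esub>\<close> with
  \<open>\<psi>\<^bsub>d,n\<^esub>(f/T\<^sup>i x) = \<psi>\<^bsub>d-1,n-i\<^esub>(x)\<close>, \<open>\<psi>\<^bsub>d,n\<^esub>(h/T\<^sup>i x) = -2d \<psi>\<^bsub>d,n-i\<^esub>(x)\<close> and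
  \<open>\<psi>\<^bsub>d,n\<^esub>(e/T\<^sup>i x) = -d(d+1) \<psi>\<^bsub>d+1,n-i\<^esub>(x)\<close>. They vanish on every PBW vector
  containing an \<open>h\<close> or an \<open>e\<close>, and are 1 on products of \<open>d\<close> factors \<open>f/T\<^sup>i\<close> with exponents adding up to \<open>n\<close>; hence
  \<open>\<psi>\<^bsub>0,0\<^esub>\<close>, \<open>\<psi>\<^bsub>1,n\<^esub>\<close> and \<open>\<psi>\<^bsub>2,n\<^esub>\<close> are \<open>(v)\<^sup>*\<close>, \<open>(f/T\<^sup>n v)\<^sup>*\<close> and the sum of the \<open>(f/T\<^sup>i f/T\<^sup>j v)\<^sup>*\<close>.
  The first identity is the case \<open>d = 1\<close> of
  \<open>\<Sum>\<^bsub>l\<ge>0\<^esub> \<psi>\<^bsub>d-1,n-l\<^esub>(eT\<^sup>l x) - d \<Sum>\<^bsub>l\<ge>1\<^esub> \<psi>\<^bsub>d,n-l\<^esub>(hT\<^sup>l x) - d(d+1) \<Sum>\<^bsub>l\<ge>1\<^esub> \<psi>\<^bsub>d+1,n-l\<^esub>(fT\<^sup>l x)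
    = (dm - d(d-1) + n(k+2)) \<psi>\<^bsub>d,n\<^esub>(x)\<close>,
  which follows by induction on \<open>x\<close>. The second identity is the first one seen through the
  diagram automorphism exchanging the two Chevalley nodes.
\<close>

section \<open>Functionals on an induced module\<close>

text \<open>The left side of the general identity is \<psi> at (d, n) applied to \<Omega> x, where
  \<Omega> is the sum of f/T^l eT^l over l \<ge> 0 and of h/T^l hT^l / 2 + e/T^l fT^l over l \<ge>
  1. In Sugawara form, \<Omega> + h/2 + h^2/4 is (k + 2) times the degree operator up to a constant.
  In degree (n + d, n), where h has weight m - 2d, \<Omega> is therefore the scalar dm - d(d - 1) +
  n(k + 2); the 2 in k + 2 is the dual Coxeter number. The induction checks this scalar directly on
  the functionals. The module is known only by generators and relators, and a dual vector only by a
  definite description. So each dual vector is identified in two halves: a functional with the right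
  values is exhibited, by extending one from words in n to all words and checking that it kills
  every relator; and PBW vectors are shown to span, so that no other functional has these values.
  Since \<psi> sees only the total exponent of a product of f's, a second evaluation point is needed
  to reach the single vectors dual to f/T^i f/T^j v.\<close>

text \<open>
  The projection \<open>pr\<close> has a subalgebra \<open>n\<close> as its range and a complementary subalgebra \<open>b\<close> as
  its kernel, and \<open>lam\<close> restricts to a character of \<open>b\<close>.
\<close>

locale split_lie = vector_space sc
  for sc :: "complex \<Rightarrow> 'g::ab_group_add \<Rightarrow> 'g" +
  fixes br :: "'g \<Rightarrow> 'g \<Rightarrow> 'g" and pr :: "'g \<Rightarrow> 'g" and lam :: "'g \<Rightarrow> complex"
  assumes br_add: "br (X + X') Y = br X Y + br X' Y" "br Y (X + X') = br Y X + br Y X'"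
    and br_scale: "br (sc a X) Y = sc a (br X Y)" "br Y (sc a X) = sc a (br Y X)"
    and br_anti: "br X Y = - br Y X"
    and jacobi: "br (br X Y) Z = br X (br Y Z) - br Y (br X Z)"
    and pr_add: "pr (X + Y) = pr X + pr Y"
    and pr_scale: "pr (sc a X) = sc a (pr X)"
    and pr_pr [simp]: "pr (pr X) = pr X"
    and pr_br: "pr (br (pr X) (pr Y)) = br (pr X) (pr Y)"
    and pr_br_compl: "pr (br (X - pr X) (Y - pr Y)) = 0"
    and lam_add: "lam (X + Y) = lam X + lam Y"
    and lam_scale: "lam (sc a X) = a * lam X"
    and lam_pr [simp]: "lam (pr X) = 0"
    and lam_br_compl: "lam (br (X - pr X) (Y - pr Y)) = 0"
begin

definition sub_word :: "'g list \<Rightarrow> bool" where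
  "sub_word w \<longleftrightarrow> (\<forall>X\<in>set w. pr X = X)"

lemma sub_word_simps [simp]: "sub_word []" "sub_word (X # w) \<longleftrightarrow> pr X = X \<and> sub_word w"
    "sub_word (u @ w) \<longleftrightarrow> sub_word u \<and> sub_word w"
  by (auto simp: sub_word_def)

text \<open>
  On words in \<open>n\<close>, such functions are the linear functionals on the enveloping algebra of \<open>n\<close>.
  Nothing is required of words with letters outside \<open>n\<close>.
\<close>

definition env_functional :: "('g list \<Rightarrow> complex) \<Rightarrow> bool" where
  "env_functional \<phi> \<longleftrightarrow> (\<forall>u w X Y a. sub_word u \<longrightarrow> sub_word w \<longrightarrow> pr X = X \<longrightarrow> pr Y = Y \<longrightarrow>
     \<phi> (u @ (X + Y) # w) = \<phi> (u @ X # w) + \<phi> (u @ Y # w) \<and>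
     \<phi> (u @ sc a X # w) = a * \<phi> (u @ X # w) \<and>
     \<phi> (u @ X # Y # w) = \<phi> (u @ Y # X # w) + \<phi> (u @ br X Y # w))"

lemma env_functional_rules:
  assumes "env_functional \<phi>" "sub_word u" "sub_word w" "pr X = X" "pr Y = Y"
  shows "\<phi> (u @ (X + Y) # w) = \<phi> (u @ X # w) + \<phi> (u @ Y # w)"
    "\<phi> (u @ sc a X # w) = a * \<phi> (u @ X # w)"
    "\<phi> (u @ X # Y # w) = \<phi> (u @ Y # X # w) + \<phi> (u @ br X Y # w)"
  using assms unfolding env_functional_def by blast+

lemma env_functional_hd:
  assumes "env_functional \<phi>" "sub_word w" "pr X = X" "pr Y = Y"
  shows "\<phi> ((X + Y) # w) = \<phi> (X # w) + \<phi> (Y # w)" "\<phi> (sc a X # w) = a * \<phi> (X # w)"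
    "\<phi> (X # Y # w) = \<phi> (Y # X # w) + \<phi> (br X Y # w)"
  using env_functional_rules[OF assms(1), of "[]" w X Y] assms by auto

lemma env_functional_Cons: "env_functional \<phi> \<Longrightarrow> pr y = y \<Longrightarrow> env_functional (\<lambda>w. \<phi> (y # w))"
  unfolding env_functional_def by (metis append_Cons sub_word_simps(2))

text \<open>
  On the induced module, \<open>Z y w = y Z w + [Z, y] w\<close> for \<open>Z\<close> in \<open>b\<close> and \<open>y\<close> in \<open>n\<close>. This determines
  the transpose action \<open>right_act\<close> of the whole Lie algebra on functionals by recursion on words
  in \<open>n\<close>, with no need for a basis of the enveloping algebra.
\<close>

fun defect :: "('g list \<Rightarrow> complex) \<Rightarrow> 'g \<Rightarrow> 'g list \<Rightarrow> complex" where
  "defect \<phi> Z [] = lam Z * \<phi> []"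
| "defect \<phi> Z (y # w) = defect (\<lambda>u. \<phi> (y # u)) Z w +
     (\<phi> (pr (br Z y) # w) + defect \<phi> (br Z y - pr (br Z y)) w)"

definition right_act :: "('g list \<Rightarrow> complex) \<Rightarrow> 'g \<Rightarrow> 'g list \<Rightarrow> complex" where
  "right_act \<phi> X w = \<phi> (pr X # w) + defect \<phi> (X - pr X) w"

lemma defect_Cons: "defect \<phi> Z (y # w) = defect (\<lambda>u. \<phi> (y # u)) Z w + right_act \<phi> (br Z y) w"
  by (simp add: right_act_def)

declare defect.simps(2) [simp del]

lemma pr_zero [simp]: "pr 0 = 0"
  using pr_scale[of 0 0] by simp

lemma br_uminus: "br (- X) Y = - br X Y" "br Y (- X) = - br Y X" for X Y
  using br_scale(1)[of "-1" X Y] br_scale(2)[of Y "-1" X] by simp_all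

lemma br_diff: "br (X - X') Y = br X Y - br X' Y" "br Y (X - X') = br Y X - br Y X'"
  using br_add(1)[of X "- X'" Y] br_add(2)[of Y X "- X'"] by (simp_all add: br_uminus)

lemma pr_br_mem: "pr X = X \<Longrightarrow> pr Y = Y \<Longrightarrow> pr (br X Y) = br X Y"
  using pr_br[of X Y] by simp

lemma defect_linear:
  assumes "env_functional \<phi>" "sub_word w"
  shows "defect \<phi> (Z + Z') w = defect \<phi> Z w + defect \<phi> Z' w"
    "defect \<phi> (sc a Z) w = a * defect \<phi> Z w"
  using assms
proof (induction w arbitrary: \<phi> Z Z')
  case Nil
  case 1 show ?case by (simp add: lam_add algebra_simps)
  case 2 show ?case by (simp add: lam_scale)
next
  case (Cons y w)
  have *: "env_functional (\<lambda>u. \<phi> (y # u))" if "env_functional \<phi>" "sub_word (y # w)" for \<phi>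
    using that by (simp add: env_functional_Cons)
  case 1
  then show ?case
    using Cons(1)[of "\<lambda>u. \<phi> (y # u)" Z Z'] Cons(1)[of \<phi> "br Z y - pr (br Z y)" "br Z' y
        - pr (br Z' y)"]
      *[OF 1] 1 env_functional_hd(1)[of \<phi> w "pr (br Z y)" "pr (br Z' y)"]
    by (simp add: defect.simps br_add pr_add algebra_simps)
  case 2
  then show ?case
    using Cons(2)[of "\<lambda>u. \<phi> (y # u)" Z] Cons(2)[of \<phi> "br Z y - pr (br Z y)"]
      *[OF 2] 2 env_functional_hd(2)[of \<phi> w "pr (br Z y)" "pr (br Z y)"]
    by (simp add: defect.simps br_scale pr_scale algebra_simps scale_right_diff_distrib)
qed

lemma right_act_linear:
  assumes "env_functional \<phi>" "sub_word w"
  shows "right_act \<phi> (X + Y) w = right_act \<phi> X w + right_act \<phi> Y w" "right_act \<phi> (sc a X) w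
      = a * right_act \<phi> X w"
    "right_act \<phi> (X - Y) w = right_act \<phi> X w - right_act \<phi> Y w" "right_act \<phi> (- X) w =
        - right_act \<phi> X w"
proof -
  show add: "right_act \<phi> (X + Y) w = right_act \<phi> X w + right_act \<phi> Y w" for X Y
    using defect_linear(1)[OF assms, of "X - pr X" "Y - pr Y"] env_functional_hd(1)[OF assms, of
        "pr X" "pr Y"]
    by (simp add: right_act_def pr_add algebra_simps)
  show scale: "right_act \<phi> (sc a X) w = a * right_act \<phi> X w" for a X
    using defect_linear(2)[OF assms, of a "X - pr X"] env_functional_hd(2)[OF assms, of "pr X"
        "pr X" a]
    by (simp add: right_act_def pr_scale algebra_simps scale_right_diff_distrib)
  show neg: "right_act \<phi> (- X) w = - right_act \<phi> X w" for X
    using scale[of "-1" X] by simp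
  show "right_act \<phi> (X - Y) w = right_act \<phi> X w - right_act \<phi> Y w"
    using add[of X "-Y"] neg[of Y] by simp
qed

lemma right_act_mem:
  assumes "env_functional \<phi>" "sub_word w" "pr X = X"
  shows "right_act \<phi> X w = \<phi> (X # w)"
  using assms defect_linear(2)[OF assms(1,2), of 0 0] by (simp add: right_act_def)

text \<open>By definition the recursion moves a letter of b past Y. The component of A in n obeys
  the same rule because \<open>env_functional\<close> imposes the commutator relation, so the
  formula is uniform in A.\<close>

lemma right_act_Cons:
  assumes "env_functional \<phi>" "sub_word w" "pr Y = Y"
  shows "right_act \<phi> A (Y # w) = right_act (\<lambda>u. \<phi> (Y # u)) A w + right_act \<phi> (br A Y) w"
proof -
  have "\<phi> (pr A # Y # w) = \<phi> (Y # pr A # w) + right_act \<phi> (br (pr A) Y) w"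
    using assms env_functional_hd(3)[of \<phi> w "pr A" Y] by (simp add: right_act_mem pr_br_mem)
  moreover have "br A Y = br (pr A) Y + br (A - pr A) Y"
    by (simp add: br_diff)
  then have "right_act \<phi> (br A Y) w = right_act \<phi> (br (pr A) Y) w + right_act \<phi> (br (A - pr A) Y) w"
    by (simp flip: right_act_linear(1)[OF assms(1,2)])
  ultimately show ?thesis
    by (simp add: right_act_def[of _ A] defect_Cons)
qed

text \<open>The recursion evaluates functionals on words in n only, since every letter it creates
  has passed through \<open>pr\<close>. Functionals on the enveloping algebra of n can be compared
  on such words alone.\<close>

lemma defect_cong:
  assumes "\<And>u. sub_word u \<Longrightarrow> \<phi> u = \<phi>' u" "sub_word w"
  shows "defect \<phi> Z w = defect \<phi>' Z w"
  using assms
proof (induction w arbitrary: \<phi> \<phi>' Z)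
  case Nil
  then show ?case using Nil(1)[OF sub_word_simps(1)] by (simp only: defect.simps)
next
  case (Cons y w)
  have "defect (\<lambda>u. \<phi> (y # u)) Z w = defect (\<lambda>u. \<phi>' (y # u)) Z w"
    using Cons.prems by (intro Cons(1)) auto
  moreover have "defect \<phi> (br Z y - pr (br Z y)) w = defect \<phi>' (br Z y - pr (br Z y)) w"
    using Cons.prems by (intro Cons(1)) auto
  moreover have "\<phi> (pr (br Z y) # w) = \<phi>' (pr (br Z y) # w)"
    using Cons.prems by (intro Cons(2)) simp
  ultimately show ?case
    by (simp only: defect.simps)
qed

lemma right_act_cong:
  assumes "\<And>u. sub_word u \<Longrightarrow> \<phi> u = \<phi>' u" "sub_word w"
  shows "right_act \<phi> X w = right_act \<phi>' X w"
proof -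
  have "\<phi> (pr X # w) = \<phi>' (pr X # w)"
    using assms(2) by (intro assms(1)) simp
  then show ?thesis
    by (simp only: right_act_def defect_cong[OF assms])
qed

lemma defect_functional_linear:
  "defect (\<lambda>u. \<phi> u + \<phi>' u) Z w = defect \<phi> Z w + defect \<phi>' Z w"
  "defect (\<lambda>u. a * \<phi> u) Z w = a * defect \<phi> Z w"
  by (induction w arbitrary: \<phi> \<phi>' Z) (simp_all add: defect.simps algebra_simps)

lemma right_act_functional_linear:
  "right_act (\<lambda>u. \<phi> u + \<phi>' u) X w = right_act \<phi> X w + right_act \<phi>' X w"
  "right_act (\<lambda>u. a * \<phi> u) X w = a * right_act \<phi> X w"
  by (simp_all add: right_act_def defect_functional_linear algebra_simps)

lemma env_functional_defect:
  assumes "env_functional \<phi>"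
  shows "env_functional (defect \<phi> Z)"
  unfolding env_functional_def
proof (intro allI impI)
  fix u w X Y a
  assume "sub_word u" "sub_word w" "pr X = X" "pr Y = Y"
  then show "defect \<phi> Z (u @ (X + Y) # w) = defect \<phi> Z (u @ X # w) + defect \<phi> Z (u @ Y # w) \<and>
    defect \<phi> Z (u @ sc a X # w) = a * defect \<phi> Z (u @ X # w) \<and>
    defect \<phi> Z (u @ X # Y # w) = defect \<phi> Z (u @ Y # X # w) + defect \<phi> Z (u @ br X Y # w)"
    using assms
  proof (induction u arbitrary: \<phi> Z)
    case Nil
    note g = \<open>env_functional \<phi>\<close> and w = \<open>sub_word w\<close> and X = \<open>pr X = X\<close> and Y = \<open>pr Y = Y\<close>
    have "defect (\<lambda>u. \<phi> ((X + Y) # u)) Z w = defect (\<lambda>u. \<phi> (X # u) + \<phi> (Y # u)) Z w"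
      using g w X Y by (intro defect_cong env_functional_hd)
    then have add: "defect \<phi> Z ((X + Y) # w) = defect \<phi> Z (X # w) + defect \<phi> Z (Y # w)"
      using g w by (simp add: defect_Cons defect_functional_linear br_add right_act_linear)
    have "defect (\<lambda>u. \<phi> (sc a X # u)) Z w = defect (\<lambda>u. a * \<phi> (X # u)) Z w"
      using g w X by (intro defect_cong env_functional_hd(2)[where Y = X])
    then have scale: "defect \<phi> Z (sc a X # w) = a * defect \<phi> Z (X # w)"
      using g w by (simp add: defect_Cons defect_functional_linear br_scale right_act_linear
          algebra_simps)
    \<comment> \<open>Z has moved past both letters. Exchanging X and Y swaps the two middle terms,
      so the commutator shows only in the first term and, through the Jacobi identity, in the
      last.\<close>
    have expand: "defect \<phi> Z (X # Y # w) = defect (\<lambda>u. \<phi> (X # Y # u)) Z w +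
        right_act (\<lambda>u. \<phi> (X # u)) (br Z Y) w + right_act (\<lambda>u. \<phi> (Y # u)) (br Z X) w +
        right_act \<phi> (br (br Z X) Y) w" if "pr X = X" "pr Y = Y" for X Y
      using g w that by (simp add: defect_Cons right_act_Cons)
    have "defect (\<lambda>u. \<phi> (X # Y # u)) Z w =
        defect (\<lambda>u. \<phi> (Y # X # u) + \<phi> (br X Y # u)) Z w"
      using g w X Y by (intro defect_cong env_functional_hd)
    moreover have "right_act \<phi> (br (br Z X) Y) w - right_act \<phi> (br (br Z Y) X) w
        = right_act \<phi> (br Z (br X Y)) w"
    proof -
      have "br (br Z X) Y - br (br Z Y) X = br Z (br X Y)"
        using jacobi[of Z X Y] br_anti[of X "br Z Y"] by (simp add: algebra_simps)
      then show ?thesis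
        by (simp flip: right_act_linear(3)[OF g w])
    qed
    ultimately have "defect \<phi> Z (X # Y # w) = defect \<phi> Z (Y # X # w) + defect \<phi> Z (br X Y # w)"
      unfolding expand[OF X Y] expand[OF Y X]
      by (simp add: defect_Cons defect_functional_linear algebra_simps)
    with add scale show ?case by simp
  next
    case (Cons x u)
    have x: "pr x = x" "sub_word u" using Cons by auto
    note IH1 = Cons(1)[OF x(2) \<open>sub_word w\<close> \<open>pr X = X\<close> \<open>pr Y
        = Y\<close> env_functional_Cons[OF \<open>env_functional \<phi>\<close> x(1)], of Z]
    note IH2 = Cons(1)[OF x(2) \<open>sub_word w\<close> \<open>pr X = X\<close> \<open>pr Y = Y\<close> \<open>env_functional \<phi>\<close>,
        of "br Z x - pr (br Z x)"]
    note gr = env_functional_rules[OF \<open>env_functional \<phi>\<close>, of "pr (br Z x) # u",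
        OF _ \<open>sub_word w\<close> \<open>pr X = X\<close> \<open>pr Y = Y\<close>]
    show ?case
      using IH1 IH2 gr x by (simp add: defect.simps algebra_simps)
  qed
qed

lemma env_functional_linear:
  assumes "env_functional \<phi>" "env_functional \<phi>'"
  shows "env_functional (\<lambda>u. \<phi> u + \<phi>' u)" "env_functional (\<lambda>u. a * \<phi> u)"
proof -
  note g1 = env_functional_rules[OF assms(1)] and g2 = env_functional_rules[OF assms(2)]
  show "env_functional (\<lambda>u. \<phi> u + \<phi>' u)"
    unfolding env_functional_def
  proof (intro allI impI conjI, goal_cases)
    case (1 u w X Y a)
    then show ?case using g1(1)[of u w X Y] g2(1)[of u w X Y] by simp
  next
    case (2 u w X Y a)
    then show ?case using g1(2)[of u w X Y a] g2(2)[of u w X Y a] by (simp add: distrib_left)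
  next
    case (3 u w X Y a)
    then show ?case using g1(3)[of u w X Y] g2(3)[of u w X Y] by simp
  qed
  show "env_functional (\<lambda>u. a * \<phi> u)"
    unfolding env_functional_def
  proof (intro allI impI conjI, goal_cases)
    case (1 u w X Y b)
    then show ?case using g1(1)[of u w X Y] by (simp add: distrib_left)
  next
    case (2 u w X Y b)
    then show ?case using g1(2)[of u w X Y b] by simp
  next
    case (3 u w X Y b)
    then show ?case using g1(3)[of u w X Y] by (simp add: distrib_left)
  qed
qed

lemma env_functional_right_act: "env_functional \<phi> \<Longrightarrow> env_functional (right_act \<phi> X)"
  unfolding right_act_def[abs_def]
  by (intro env_functional_linear env_functional_Cons env_functional_defect) simp_all

lemma right_act_Nil: "right_act \<phi> X [] = \<phi> [pr X] + lam X * \<phi> []"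
  using lam_add[of "X - pr X" "pr X"] by (simp add: right_act_def)

lemma env_functional_zero: "env_functional \<phi> \<Longrightarrow> sub_word w \<Longrightarrow> \<phi> (0 # w) = 0"
  using env_functional_hd(2)[of \<phi> w 0 0 0] by simp

text \<open>\<open>right_act \<phi> X\<close> is meant as w \<mapsto> \<phi> (X w), so that the left
  side is \<phi> (X Y w): a right action. The induction moves X and Y past one letter at a time; at
  the empty word b has to act through a character.\<close>

lemma right_act_bracket:
  assumes "env_functional \<phi>" "sub_word w"
  shows "right_act (right_act \<phi> X) Y w = right_act (right_act \<phi> Y) X w + right_act \<phi> (br X Y) w"
  using assms
proof (induction w arbitrary: \<phi> X Y)
  case Nil
  then have g: "env_functional \<phi>" by simp
  note lin = right_act_linear[OF g sub_word_simps(1)]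
  have rr: "right_act (right_act \<phi> X) Y [] = \<phi> [pr Y, pr X] + lam X * \<phi> [pr Y]
      + right_act \<phi> (br X (pr Y)) [] +
      lam Y * (\<phi> [pr X] + lam X * \<phi> [])" for X Y
    using right_act_Cons[OF g sub_word_simps(1), of "pr Y" X]
    by (simp add: right_act_Nil[of "right_act \<phi> X"]) (simp add: right_act_Nil)
  have "right_act \<phi> (br (X - pr X) (Y - pr Y)) [] = 0"
    using env_functional_zero[OF g sub_word_simps(1)]
        by (simp add: right_act_Nil pr_br_compl lam_br_compl)
  \<comment> \<open>Both arguments are split along n and b. The bracket of the two b-components lies
    in b and has \<open>lam\<close> equal to 0, so it kills the vacuum; the other brackets match the
    terms of \<open>rr\<close>.\<close>
  moreover have "br X Y = br X (pr Y) - br Y (pr X) + br (pr Y) (pr X) + br (X - pr X) (Y - pr Y)"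
    using br_anti[of Y "pr X"] br_anti[of "pr Y" "pr X"] by (simp add: br_diff)
  then have "right_act \<phi> (br X Y) [] =
      right_act \<phi> (br X (pr Y) - br Y (pr X) + br (pr Y) (pr X) + br (X - pr X) (Y - pr Y)) []"
    by (rule arg_cong)
  ultimately have e1: "right_act \<phi> (br X Y) [] =
      right_act \<phi> (br X (pr Y)) [] - right_act \<phi> (br Y (pr X)) []
          + right_act \<phi> (br (pr Y) (pr X)) []"
    by (simp only: lin) simp
  have e2: "right_act \<phi> (br (pr Y) (pr X)) [] = \<phi> [br (pr Y) (pr X)]"
    using g by (simp add: right_act_mem pr_br)
  have e3: "\<phi> [pr Y, pr X] = \<phi> [pr X, pr Y] + \<phi> [br (pr Y) (pr X)]"
    by (rule env_functional_hd(3)[OF g sub_word_simps(1) pr_pr pr_pr])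
  show ?case
    unfolding rr[of X Y] rr[of Y X] e1 e2 unfolding e3 by (simp add: algebra_simps)
next
  case (Cons y w)
  from Cons.prems have g: "env_functional \<phi>" and w: "sub_word w" and y: "pr y = y" by simp_all
  define \<phi>y where "\<phi>y = (\<lambda>u. \<phi> (y # u))"
  have gy: "env_functional \<phi>y" unfolding \<phi>y_def by (rule env_functional_Cons[OF g y])
  have rr: "right_act (right_act \<phi> X) Y (y # w) =
      right_act (right_act \<phi>y X) Y w + right_act (right_act \<phi> (br X y)) Y w
          + right_act (right_act \<phi> X) (br Y y) w" for X Y
  proof -
    have "right_act (\<lambda>u. right_act \<phi> X (y # u)) Y w = right_act (\<lambda>u. right_act \<phi>y X u
        + right_act \<phi> (br X y) u) Y w"
      using g w y by (intro right_act_cong) (simp_all add: right_act_Cons \<phi>y_def)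
    then show ?thesis
      using right_act_Cons[OF env_functional_right_act[OF g] w y, of X Y]
          by (simp add: right_act_functional_linear)
  qed
  have "br (br X y) Y + br X (br Y y) = br (br X Y) y"
    using jacobi[of X Y y] br_anti[of Y "br X y"] by (simp add: algebra_simps)
  then have "right_act \<phi> (br (br X Y) y) w = right_act \<phi> (br (br X y) Y) w
      + right_act \<phi> (br X (br Y y)) w"
    by (simp flip: right_act_linear(1)[OF g w])
  moreover have "right_act \<phi> (br X Y) (y # w) = right_act \<phi>y (br X Y) w
      + right_act \<phi> (br (br X Y) y) w"
    using right_act_Cons[OF g w y] by (simp add: \<phi>y_def)
  ultimately show ?case
    unfolding rr[of X Y] rr[of Y X] Cons(1)[OF gy w, of X Y] Cons(1)[OF g w, of "br X y" Y]
      Cons(1)[OF g w, of X "br Y y"]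
    by simp
qed

end

section \<open>The affine algebra and its lower triangular part\<close>

definition coord_e :: "sl2 \<Rightarrow> complex" where "coord_e x = mat_of x $ 1 $ 2"
definition coord_f :: "sl2 \<Rightarrow> complex" where "coord_f x = mat_of x $ 2 $ 1"
definition coord_h :: "sl2 \<Rightarrow> complex" where "coord_h x = mat_of x $ 1 $ 1"

lemmas coord_defs = coord_e_def coord_f_def coord_h_def

lemma mat_of_22: "mat_of x $ 2 $ 2 = - coord_h x"
  using mat_of[of x] by (simp add: trace_def sum_2 coord_h_def add_eq_0_iff)

lemma coord_zero [simp]: "coord_e 0 = 0" "coord_f 0 = 0" "coord_h 0 = 0"
  by (simp_all add: coord_defs zero_sl2.rep_eq)

lemma coord_add:
  "coord_e (x + y) = coord_e x + coord_e y" "coord_f (x + y) = coord_f x + coord_f y"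
  "coord_h (x + y) = coord_h x + coord_h y"
  by (simp_all add: coord_defs plus_sl2.rep_eq)

lemma coord_diff:
  "coord_e (x - y) = coord_e x - coord_e y" "coord_f (x - y) = coord_f x - coord_f y"
  "coord_h (x - y) = coord_h x - coord_h y"
  by (simp_all add: coord_defs minus_sl2.rep_eq)

lemma coord_uminus:
  "coord_e (- x) = - coord_e x" "coord_f (- x) = - coord_f x" "coord_h (- x) = - coord_h x"
  by (simp_all add: coord_defs uminus_sl2.rep_eq)

lemma coord_scale:
  "coord_e (sl2_scale a x) = a * coord_e x" "coord_f (sl2_scale a x) = a * coord_f x"
  "coord_h (sl2_scale a x) = a * coord_h x"
  by (simp_all add: coord_defs sl2_scale.rep_eq)

lemma coord_gens [simp]:
  "coord_e sl2_e = 1" "coord_f sl2_e = 0" "coord_h sl2_e = 0"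
  "coord_e sl2_f = 0" "coord_f sl2_f = 1" "coord_h sl2_f = 0"
  "coord_e sl2_h = 0" "coord_f sl2_h = 0" "coord_h sl2_h = 1"
  by (simp_all add: coord_defs sl2_e.rep_eq sl2_f.rep_eq sl2_h.rep_eq)

lemma coord_bracket:
  "coord_e (sl2_bracket x y) = 2 * (coord_h x * coord_e y - coord_e x * coord_h y)"
  "coord_f (sl2_bracket x y) = 2 * (coord_f x * coord_h y - coord_h x * coord_f y)"
  "coord_h (sl2_bracket x y) = coord_e x * coord_f y - coord_f x * coord_e y"
  using mat_of_22[of x] mat_of_22[of y]
  by (simp_all add: coord_defs sl2_bracket.rep_eq matrix_matrix_mult_def sum_2 algebra_simps)

lemma sl2_form_coord:
  "sl2_form x y = 2 * coord_h x * coord_h y + coord_e x * coord_f y + coord_f x * coord_e y"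
  using mat_of_22[of x] mat_of_22[of y]
  by (simp add: sl2_form_def coord_defs trace_def matrix_matrix_mult_def sum_2 algebra_simps)

lemma sl2_eqI: "coord_e x = coord_e y \<Longrightarrow> coord_f x = coord_f y \<Longrightarrow> coord_h x = coord_h y \<Longrightarrow> x = y"
  using mat_of_22[of x] mat_of_22[of y]
  by (simp add: coord_defs vec_eq_iff forall_2 flip: mat_of_inject)

lemma sl2_eq_iff: "x = y \<longleftrightarrow> coord_e x = coord_e y \<and> coord_f x = coord_f y \<and> coord_h x = coord_h y"
  using sl2_eqI by blast

lemmas sl2_coord = coord_add coord_diff coord_uminus coord_scale coord_bracket

lemma lookup_affine_scale:
  "Poly_Mapping.lookup (fst (affine_scale a X)) i = sl2_scale a (Poly_Mapping.lookup (fst X) i)"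
  by (simp add: affine_scale_def Poly_Mapping.map.rep_eq when_def)

lemma snd_affine_scale [simp]: "snd (affine_scale a X) = a * snd X"
  by (simp add: affine_scale_def)

lemma affine_eqI:
  "(\<And>i. Poly_Mapping.lookup (fst X) i = Poly_Mapping.lookup (fst Y) i) \<Longrightarrow> snd X = snd Y \<Longrightarrow> X = Y"
  for X Y :: affine_sl2
  by (intro prod_eqI poly_mapping_eqI)

section \<open>Vector space and Lie algebra axioms for the affine algebra\<close>

interpretation affine: vector_space affine_scale
  by unfold_locales
     (rule affine_eqI; simp add: lookup_affine_scale lookup_add sl2_eq_iff sl2_coord algebra_simps)+

lemma loop_zero [simp]: "loop 0 i = 0"
  by (simp add: loop_def zero_prod_def)

lemma loop_uminus: "loop (- x) i = - loop x i"
  by (simp add: loop_def single_uminus)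

lemma affine_bracket_zero [simp]: "affine_bracket 0 Y = 0" "affine_bracket X 0 = 0"
  using affine_bracket_central[of 0] by (simp_all add: zero_prod_def)

lemma affine_bracket_anti: "affine_bracket X Y = - affine_bracket Y X"
proof (induction X rule: affine_induct)
  case (loop x i)
  show ?case
  proof (induction Y rule: affine_induct)
    case (loop y j)
    have "sl2_bracket x y = - sl2_bracket y x"
      by (simp add: sl2_eq_iff sl2_coord)
    moreover have "sl2_form y x = sl2_form x y"
      by (simp add: sl2_form_coord)
    moreover have "of_int i = - (of_int j :: complex)" if "i + j = 0"
      using that by (metis add.inverse_inverse eq_neg_iff_add_eq_0 of_int_minus)
    ultimately show ?case
      by (auto simp: affine_bracket_loop loop_uminus add.commute)
  qed (simp_all add: affine_bracket_add)
qed (simp_all add: affine_bracket_add)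

lemma affine_bracket_jacobi:
  "affine_bracket (affine_bracket X Y) Z =
     affine_bracket X (affine_bracket Y Z) - affine_bracket Y (affine_bracket X Z)"
proof (induction X rule: affine_induct)
  case (loop x i)
  show ?case
  proof (induction Y rule: affine_induct)
    case (loop y j)
    show ?case
    proof (induction Z rule: affine_induct)
      case (loop z l)
      have "sl2_bracket y (sl2_bracket x z) + sl2_bracket (sl2_bracket x y) z
          = sl2_bracket x (sl2_bracket y z)"
        by (simp add: sl2_eq_iff sl2_coord algebra_simps)
      \<comment> \<open>The cocycle condition for the central terms: by invariance of the trace form
        the three values of the form agree up to sign, and the degree factors add up.\<close>
      moreover have "(of_int (i + j) :: complex) * sl2_form (sl2_bracket x y) z =
          of_int i * sl2_form x (sl2_bracket y z) - of_int j * sl2_form y (sl2_bracket x z)"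
        by (simp add: sl2_form_coord sl2_coord algebra_simps)
      ultimately show ?case
        by (simp add: affine_bracket_add affine_bracket_loop algebra_simps flip: loop_add)
    qed (simp_all add: affine_bracket_add)
  qed (simp_all add: affine_bracket_add)
qed (simp_all add: affine_bracket_add)

lemma affine_bracket_scale:
  "affine_bracket (affine_scale a X) Y = affine_scale a (affine_bracket X Y)"
  "affine_bracket Y (affine_scale a X) = affine_scale a (affine_bracket Y X)"
proof -
  have *: "affine_bracket (affine_scale a X) Y = affine_scale a (affine_bracket X Y)" for X Y
  proof (induction X rule: affine_induct)
    case (loop x i)
    show ?case
    proof (induction Y rule: affine_induct)
      case (loop y j)
      have "sl2_bracket (sl2_scale a x) y = sl2_scale a (sl2_bracket x y)"
        by (simp add: sl2_eq_iff sl2_coord algebra_simps)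
      moreover have "sl2_form (sl2_scale a x) y = a * sl2_form x y"
        by (simp add: sl2_form_coord sl2_coord algebra_simps)
      ultimately show ?case
        by (simp add: affine_scale_loop affine_bracket_loop affine.scale_right_distrib
            affine_scale_c)
    qed (simp_all add: affine_bracket_add affine.scale_right_distrib)
  qed (simp_all add: affine_bracket_add affine.scale_right_distrib affine_scale_c)
  show "affine_bracket (affine_scale a X) Y = affine_scale a (affine_bracket X Y)"
    by (rule *)
  show "affine_bracket Y (affine_scale a X) = affine_scale a (affine_bracket Y X)"
    using *[of X Y] affine_bracket_anti[of Y X] affine_bracket_anti[of Y "affine_scale a X"] by simp
qed

section \<open>The triangular decomposition and the highest weight character\<close>

definition neg_coeff :: "int \<Rightarrow> sl2 \<Rightarrow> sl2" where
  "neg_coeff i x = (if i < 0 then x else if i = 0 then sl2_scale (coord_f x) sl2_f else 0)"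

definition neg_part :: "affine_sl2 \<Rightarrow> affine_sl2" where
  "neg_part X = (Poly_Mapping.mapp neg_coeff (fst X), 0)"

lemma neg_coeff_zero [simp]: "neg_coeff i 0 = 0"
  by (simp add: neg_coeff_def)

lemma lookup_neg_part:
  "Poly_Mapping.lookup (fst (neg_part X)) i = neg_coeff i (Poly_Mapping.lookup (fst X) i)"
  by (simp add: neg_part_def lookup_mapp when_def in_keys_iff)

lemma snd_neg_part [simp]: "snd (neg_part X) = 0"
  by (simp add: neg_part_def)

lemma neg_part_loop: "neg_part (loop x i) = loop (neg_coeff i x) i"
  by (rule affine_eqI) (simp_all add: lookup_neg_part,
      simp_all add: loop_def lookup_single when_def)

lemma neg_part_central [simp]: "neg_part (0, z) = 0"
  by (rule affine_eqI) (simp_all add: lookup_neg_part)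

lemma neg_part_zero [simp]: "neg_part 0 = 0"
  using neg_part_central[of 0] by (simp add: zero_prod_def)

lemma neg_part_add: "neg_part (X + Y) = neg_part X + neg_part Y"
  by (rule affine_eqI)
     (simp_all add: lookup_neg_part lookup_add neg_coeff_def sl2_eq_iff sl2_coord)

lemma affine_central_zero [simp]: "(0, 0) = (0 :: affine_sl2)"
  by (simp add: zero_prod_def)

text \<open>On b, spanned by e, h, the positive powers of T and c, this is the character by which b
  acts on v; h_2 = c - h then receives k - m.\<close>

definition highest_char :: "complex \<Rightarrow> complex \<Rightarrow> affine_sl2 \<Rightarrow> complex" where
  "highest_char m k X = m * coord_h (Poly_Mapping.lookup (fst X) 0) + k * snd X"

lemma highest_char_simps:
  "highest_char m k (X + Y) = highest_char m k X + highest_char m k Y"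
  "highest_char m k (loop x i) = (if i = 0 then m * coord_h x else 0)"
  "highest_char m k (0, z) = k * z"
  "highest_char m k 0 = 0"
  by (simp_all add: highest_char_def lookup_add coord_add algebra_simps loop_def lookup_single)

lemma neg_part_compl_add:
  "X + Y - (neg_part X + neg_part Y) = (X - neg_part X) + (Y - neg_part Y)"
  by simp

lemma neg_part_compl_loop: "loop x i - neg_part (loop x i) = loop (x - neg_coeff i x) i"
  unfolding neg_part_loop diff_eq_eq by (simp flip: loop_add)

lemma split_lie_affine: "split_lie affine_scale affine_bracket neg_part (highest_char m k)"
proof unfold_locales
  fix X Y :: affine_sl2 and a :: complex
  show "neg_part (affine_scale a X) = affine_scale a (neg_part X)"
    by (rule affine_eqI)
       (simp_all add: lookup_neg_part lookup_affine_scale neg_coeff_def sl2_eq_iff sl2_coord)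
  show "neg_part (neg_part X) = neg_part X"
    by (rule affine_eqI) (simp_all add: lookup_neg_part neg_coeff_def sl2_eq_iff sl2_coord)
  show "neg_part (affine_bracket (neg_part X) (neg_part Y))
      = affine_bracket (neg_part X) (neg_part Y)"
  proof (induction X rule: affine_induct)
    case (loop x i)
    show ?case
    proof (induction Y rule: affine_induct)
      case (loop y j)
      have "neg_coeff (i + j) (sl2_bracket (neg_coeff i x) (neg_coeff j y)) =
          sl2_bracket (neg_coeff i x) (neg_coeff j y)"
        by (auto simp: neg_coeff_def sl2_coord sl2_eq_iff)
      moreover have "(if i + j = 0 then of_int i * sl2_form (neg_coeff i x) (neg_coeff j y) else 0)
          = 0"
        by (auto simp: neg_coeff_def)
      ultimately show ?case
        by (simp only: neg_part_loop affine_bracket_loop neg_part_add neg_part_central) simp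
    qed (simp_all add: affine_bracket_add neg_part_add)
  qed (simp_all add: affine_bracket_add neg_part_add)
  show "neg_part (affine_bracket (X - neg_part X) (Y - neg_part Y)) = 0"
  proof (induction X rule: affine_induct)
    case (loop x i)
    show ?case
    proof (induction Y rule: affine_induct)
      case (loop y j)
      have "neg_coeff (i + j) (sl2_bracket (x - neg_coeff i x) (y - neg_coeff j y)) = 0"
        by (auto simp: neg_coeff_def sl2_coord sl2_eq_iff)
      then show ?case
        unfolding neg_part_compl_loop affine_bracket_loop by (simp add: neg_part_add neg_part_loop)
    qed (simp_all add: affine_bracket_add neg_part_add neg_part_compl_add)
  qed (simp_all add: affine_bracket_add neg_part_add neg_part_compl_add)
  show "highest_char m k (affine_bracket (X - neg_part X) (Y - neg_part Y)) = 0"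
  proof (induction X rule: affine_induct)
    case (loop x i)
    show ?case
    proof (induction Y rule: affine_induct)
      case (loop y j)
      \<comment> \<open>b contains no negative power of T, so a central term could only come from i
        = j = 0, where its factor i is zero.\<close>
      have "i + j = 0 \<Longrightarrow> i \<ge> 0 \<Longrightarrow> j \<ge> 0 \<Longrightarrow> i = 0" by simp
      then show ?case
        unfolding neg_part_compl_loop affine_bracket_loop
        by (auto simp: highest_char_simps neg_coeff_def sl2_coord)
    qed (simp_all add: affine_bracket_add highest_char_simps neg_part_add neg_part_compl_add)
  qed (simp_all add: affine_bracket_add highest_char_simps neg_part_add neg_part_compl_add)
  show "highest_char m k (affine_scale a X) = a * highest_char m k X"
    by (simp add: highest_char_def lookup_affine_scale coord_scale algebra_simps)
  show "highest_char m k (neg_part X) = 0"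
    by (simp add: highest_char_def lookup_neg_part neg_coeff_def coord_scale)
qed (fact affine_bracket_add affine_bracket_scale affine_bracket_anti affine_bracket_jacobi
  neg_part_add highest_char_simps)+

section \<open>Functionals on the Verma module\<close>

context verma_module
begin

sublocale S: split_lie affine_scale affine_bracket neg_part "highest_char m k"
  by (rule split_lie_affine)

text \<open>The value of \<phi> at the word applied to v. A word acts on v from right to left, so on
  functionals its leftmost letter acts first, whence \<open>foldl\<close>.\<close>

definition word_value :: "(affine_sl2 list \<Rightarrow> complex) \<Rightarrow> affine_sl2 list \<Rightarrow> complex" where
  "word_value \<phi> w = foldl S.right_act \<phi> w []"

lemma word_value_simps [simp]:
  "word_value \<phi> [] = \<phi> []" "word_value \<phi> (X # w) = word_value (S.right_act \<phi> X) w"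
  by (simp_all add: word_value_def)

lemma env_functional_foldl: "S.env_functional \<phi> \<Longrightarrow> S.env_functional (foldl S.right_act \<phi> u)"
  by (induction u arbitrary: \<phi>) (simp_all add: S.env_functional_right_act)

lemma word_value_append: "word_value \<phi> (u @ w) = word_value (foldl S.right_act \<phi> u) w"
  by (simp add: word_value_def)

lemma word_value_cong:
  assumes "\<And>u. S.sub_word u \<Longrightarrow> \<phi> u = \<phi>' u"
  shows "word_value \<phi> w = word_value \<phi>' w"
  using assms
proof (induction w arbitrary: \<phi> \<phi>')
  case Nil
  show ?case using Nil[OF S.sub_word_simps(1)] by (simp only: word_value_simps)
next
  case (Cons X w)
  have "word_value (S.right_act \<phi> X) w = word_value (S.right_act \<phi>' X) w"
    by (intro Cons.IH S.right_act_cong Cons.prems)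
  then show ?case by (simp only: word_value_simps)
qed

lemma word_value_linear:
  "word_value (\<lambda>u. \<phi> u + \<phi>' u) w = word_value \<phi> w + word_value \<phi>' w"
  "word_value (\<lambda>u. a * \<phi> u) w = a * word_value \<phi> w"
  by (induction w arbitrary: \<phi> \<phi>') (simp_all add: S.right_act_functional_linear[abs_def])

definition word_sum :: "(affine_sl2 list \<Rightarrow> complex) \<Rightarrow> word_space \<Rightarrow> complex" where
  "word_sum \<phi> p = (\<Sum>w\<in>Poly_Mapping.keys p. Poly_Mapping.lookup p w * word_value \<phi> w)"

lemma word_sum_superset:
  assumes "finite W" "Poly_Mapping.keys p \<subseteq> W"
  shows "word_sum \<phi> p = (\<Sum>w\<in>W. Poly_Mapping.lookup p w * word_value \<phi> w)"
  unfolding word_sum_def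
  by (intro sum.mono_neutral_left assms ballI) (auto simp: in_keys_iff)

lemma word_sum_word [simp]: "word_sum \<phi> (word w) = word_value \<phi> w"
  using word_sum_superset[of "{w}" "word w"] by simp

lemma lookup_word_scale: "Poly_Mapping.lookup (word_scale a p) w = a * Poly_Mapping.lookup p w"
  by (simp add: word_scale_def Poly_Mapping.map.rep_eq when_def)

lemma word_sum_add: "word_sum \<phi> (p + q) = word_sum \<phi> p + word_sum \<phi> q"
proof -
  define W where "W = Poly_Mapping.keys p \<union> Poly_Mapping.keys q"
  have W: "finite W" "Poly_Mapping.keys p \<subseteq> W" "Poly_Mapping.keys q \<subseteq> W"
    "Poly_Mapping.keys (p + q) \<subseteq> W"
    using Poly_Mapping.keys_add[of p q] by (auto simp: W_def)
  show ?thesis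
    using W by (simp add: word_sum_superset[OF W(1)] lookup_add distrib_right sum.distrib)
qed

lemma word_sum_scale: "word_sum \<phi> (word_scale a p) = a * word_sum \<phi> p"
proof -
  have "Poly_Mapping.keys (word_scale a p) \<subseteq> Poly_Mapping.keys p"
    by (auto simp: in_keys_iff lookup_word_scale)
  then show ?thesis
    by (simp add: word_sum_superset[OF finite_keys, of "word_scale a p" p] lookup_word_scale
        word_sum_def[of _ p] sum_distrib_left mult.assoc)
qed

lemma word_sum_diff: "word_sum \<phi> (p - q) = word_sum \<phi> p - word_sum \<phi> q"
  using word_sum_add[of \<phi> "p - q" q] by simp

text \<open>Linearity of \<open>right_act\<close> kills the first two kinds of relators and
  \<open>right_act_bracket\<close> the third. In the last two kinds the final letter lies in b and
  meets the vacuum, where the character is 0 at the e_i and the highest weight at the h_i.\<close>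

lemma word_sum_relator:
  assumes "S.env_functional \<phi>" "p \<in> verma_relators m k"
  shows "word_sum \<phi> p = 0"
  using assms(2)
proof cases
  case (1 u X Y w)
  have "word_value (S.right_act (foldl S.right_act \<phi> u) (X + Y)) w =
      word_value (\<lambda>z. S.right_act (foldl S.right_act \<phi> u) X z
          + S.right_act (foldl S.right_act \<phi> u) Y z) w"
    by (intro word_value_cong S.right_act_linear env_functional_foldl assms)
  then show ?thesis
    by (simp add: 1 word_sum_diff word_value_append word_value_linear)
next
  case (2 u a X w)
  have "word_value (S.right_act (foldl S.right_act \<phi> u) (affine_scale a X)) w =
      word_value (\<lambda>z. a * S.right_act (foldl S.right_act \<phi> u) X z) w"
    by (intro word_value_cong S.right_act_linear env_functional_foldl assms)
  then show ?thesis
    by (simp add: 2 word_sum_diff word_sum_scale word_value_append word_value_linear)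
next
  case (3 u X Y w)
  define \<psi> where "\<psi> = foldl S.right_act \<phi> u"
  have "S.env_functional \<psi>" unfolding \<psi>_def by (intro env_functional_foldl assms)
  then have "word_value (S.right_act (S.right_act \<psi> X) Y) w =
      word_value (\<lambda>z. S.right_act (S.right_act \<psi> Y) X z + S.right_act \<psi> (affine_bracket X Y) z) w"
    by (intro word_value_cong S.right_act_bracket)
  then show ?thesis
    by (simp add: 3 word_sum_diff word_value_append word_value_linear flip: \<psi>_def)
next
  case (4 u i)
  have g: "S.env_functional (foldl S.right_act \<phi> u)" by (intro env_functional_foldl assms)
  have "neg_part (chev_e i) = 0" "highest_char m k (chev_e i) = 0"
    by (cases i; simp add: neg_part_loop neg_coeff_def highest_char_simps)+
  then show ?thesis
    by (simp add: 4 word_value_append S.right_act_Nil S.env_functional_zero[OF g])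
next
  case (5 u i)
  have g: "S.env_functional (foldl S.right_act \<phi> u)" by (intro env_functional_foldl assms)
  have "affine_c - loop sl2_h 0 = (0, 1) + loop (- sl2_h) 0"
    by (simp add: affine_c_def loop_uminus)
  then have "neg_part (chev_h i) = 0" "highest_char m k (chev_h i) = highest_weight m k i"
    by (cases i; simp add: neg_part_loop neg_part_add neg_coeff_def highest_char_simps
        coord_uminus)+
  then show ?thesis
    by (simp add: 5 word_sum_diff word_sum_scale word_value_append S.right_act_Nil
        S.env_functional_zero[OF g])
       (simp add: word_value_def)
qed

lemma word_sum_eq_0:
  assumes "S.env_functional \<phi>" "word_eval scl act v p = 0"
  shows "word_sum \<phi> p = 0"
proof -
  interpret W: vector_space word_scale by (rule vector_space_word_scale)
  have "p \<in> W.span (verma_relators m k)" using assms(2) presented by simp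
  then show ?thesis
    by (induction rule: W.span_induct_alt)
       (simp_all add: word_sum_relator[OF assms(1)] word_sum_add word_sum_scale,
           simp add: word_sum_def)
qed

text \<open>For an \<open>env_functional\<close> the choice of representative is harmless: two of
  them differ by an element of the span of the relators, where \<open>word_sum\<close> is 0.\<close>

definition functional :: "(affine_sl2 list \<Rightarrow> complex) \<Rightarrow> 'v \<Rightarrow> complex" where
  "functional \<phi> x = word_sum \<phi> (SOME p. word_eval scl act v p = x)"

lemma functional_eval:
  assumes "S.env_functional \<phi>"
  shows "functional \<phi> (word_eval scl act v p) = word_sum \<phi> p"
proof -
  define q where "q = (SOME q. word_eval scl act v q = word_eval scl act v p)"
  have "word_eval scl act v q = word_eval scl act v p"
    unfolding q_def by (rule someI) (rule refl)
  then have "word_sum \<phi> (q - p) = 0"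
    by (intro word_sum_eq_0 assms) (simp add: word_eval_diff)
  then show ?thesis
    by (simp add: functional_def word_sum_diff flip: q_def)
qed

lemma word_eval_add: "word_eval scl act v (p + q) = word_eval scl act v p + word_eval scl act v q"
  using word_eval_diff[of "p + q" q] by simp

lemma functional_linear:
  assumes "S.env_functional \<phi>"
  shows "Vector_Spaces.linear scl (*) (functional \<phi>)"
proof -
  interpret C: vector_space "(*) :: complex \<Rightarrow> _"
    by unfold_locales (simp_all add: algebra_simps)
  show ?thesis
  proof unfold_locales
    fix x y :: 'v and a :: complex
    obtain p q where pq: "x = word_eval scl act v p" "y = word_eval scl act v q"
      using generated[of x] generated[of y] by auto
    show "functional \<phi> (x + y) = functional \<phi> x + functional \<phi> y"
      by (simp add: pq functional_eval[OF assms] word_sum_add flip: word_eval_add)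
    show "functional \<phi> (scl a x) = a * functional \<phi> x"
      by (simp add: pq functional_eval[OF assms] word_sum_scale flip: word_eval_scale)
  qed
qed

lemma functional_word:
  assumes "S.env_functional \<phi>"
  shows "functional \<phi> (foldr act w v) = word_value \<phi> w"
  using functional_eval[OF assms, of "word w"] by simp

lemma linear_ext:
  assumes "Vector_Spaces.linear scl (*) \<phi>" "Vector_Spaces.linear scl (*) \<phi>'"
    and "\<And>w. \<phi> (foldr act w v) = \<phi>' (foldr act w v)"
  shows "\<phi> x = \<phi>' x"
proof -
  interpret f: Vector_Spaces.linear scl "(*)" \<phi> by fact
  interpret g: Vector_Spaces.linear scl "(*)" \<phi>' by fact
  obtain p where "word_eval scl act v p = x" using generated by blast
  then show ?thesis
    by (auto simp: word_eval_def f.sum g.sum f.scale g.scale assms(3) intro!: sum.cong)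
qed

lemma functional_act:
  assumes "S.env_functional \<phi>"
  shows "functional \<phi> (act X x) = functional (S.right_act \<phi> X) x"
proof (rule linear_ext)
  show "Vector_Spaces.linear scl (*) (\<lambda>x. functional \<phi> (act X x))"
    using Vector_Spaces.linear_compose[OF act_linear functional_linear[OF assms]]
    by (simp add: comp_def)
  show "Vector_Spaces.linear scl (*) (functional (S.right_act \<phi> X))"
    by (intro functional_linear S.env_functional_right_act assms)
  show "functional \<phi> (act X (foldr act w v)) = functional (S.right_act \<phi> X) (foldr act w v)" for w
    using functional_word[OF assms, of "X # w"] by (simp add: functional_word
        S.env_functional_right_act assms)
qed

lemma functional_cong:
  assumes "\<And>w. S.sub_word w \<Longrightarrow> \<phi> w = \<phi>' w"
  shows "functional \<phi> x = functional \<phi>' x"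
  unfolding functional_def word_sum_def by (simp only: word_value_cong[OF assms])

lemma functional_act_neg:
  assumes "S.env_functional \<phi>" "neg_part X = X"
  shows "functional \<phi> (act X x) = functional (\<lambda>w. \<phi> (X # w)) x"
  unfolding functional_act[OF assms(1)]
  by (intro functional_cong S.right_act_mem assms)

lemma functional_functional_linear:
  "functional (\<lambda>u. \<phi> u + \<phi>' u) x = functional \<phi> x + functional \<phi>' x"
  "functional (\<lambda>u. a * \<phi> u) x = a * functional \<phi> x"
  by (simp_all add: functional_def word_sum_def word_value_linear algebra_simps sum.distrib
      sum_distrib_left)

lemma functional_v: "S.env_functional \<phi> \<Longrightarrow> functional \<phi> v = \<phi> []"
  using functional_word[of \<phi> "[]"] by simp

end

section \<open>Two evaluation modules\<close>

type_synonym two_poly = "complex poly poly"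

definition const2 :: "complex \<Rightarrow> two_poly" where "const2 c = [:[:c:]:]"

lemma const2_ring:
  "const2 (a + b) = const2 a + const2 b" "const2 (a - b) = const2 a - const2 b"
  "const2 (a * b) = const2 a * const2 b" "const2 0 = 0" "const2 1 = 1"
  "const2 (of_int z) = of_int z"
  by (simp_all add: const2_def one_pCons of_int_poly)

abbreviation var1 :: two_poly where "var1 \<equiv> [:[:0, 1:]:]"
abbreviation var2 :: two_poly where "var2 \<equiv> [:0, 1:]"

text \<open>The exponent i belongs to the inner variable \<open>var1\<close> and j to the outer
  variable \<open>var2\<close>. The value 0 at negative exponents makes multiplication by a monomial
  an unconditional shift.\<close>

definition coeff2 :: "int \<Rightarrow> int \<Rightarrow> two_poly \<Rightarrow> complex" where
  "coeff2 i j r = (if i \<ge> 0 \<and> j \<ge> 0 then coeff (coeff r (nat j)) (nat i) else 0)"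

lemma coeff2_linear:
  "coeff2 i j (r + r') = coeff2 i j r + coeff2 i j r'"
  "coeff2 i j (r - r') = coeff2 i j r - coeff2 i j r'"
  "coeff2 i j (const2 c * r) = c * coeff2 i j r"
  by (simp_all add: coeff2_def const2_def)

lemma coeff2_var:
  "coeff2 i j (var1 ^ n * r) = coeff2 (i - int n) j r"
  "coeff2 i j (var2 ^ n * r) = coeff2 i (j - int n) r"
proof -
  have "var1 ^ n = [:monom 1 n:]"
    by (induction n) (simp_all add: monom_0 one_pCons monom_Suc)
  then show "coeff2 i j (var1 ^ n * r) = coeff2 (i - int n) j r"
    by (auto simp: coeff2_def coeff_monom_mult nat_diff_distrib nat_le_iff)
  have "var2 ^ n = monom 1 n"
    by (simp add: monom_altdef)
  then show "coeff2 i j (var2 ^ n * r) = coeff2 i (j - int n) r"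
    by (auto simp: coeff2_def coeff_monom_mult nat_diff_distrib nat_le_iff)
qed

lemma coeff2_const: "coeff2 i j (const2 c) = (if i = 0 \<and> j = 0 then c else 0)"
  by (auto simp: coeff2_def const2_def coeff_pCons split: nat.splits)

text \<open>The coordinate c of the loop part with \<open>T\<^sup>i\<close> replaced by t to the
  power s - i, so t stands for 1/T up to the shift s. On n the coordinates used later vanish for i >
  s, so \<open>nat\<close> truncates nothing there.\<close>

definition series :: "(sl2 \<Rightarrow> complex) \<Rightarrow> int \<Rightarrow> two_poly \<Rightarrow> affine_sl2 \<Rightarrow> two_poly" where
  "series c s t X = (\<Sum>i\<in>Poly_Mapping.keys (fst X). const2 (c (Poly_Mapping.lookup (fst X) i)) * t ^
      nat (s - i))"

definition linear_coord :: "(sl2 \<Rightarrow> complex) \<Rightarrow> bool" where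
  "linear_coord c \<longleftrightarrow> (\<forall>x y. c (x + y) = c x + c y) \<and> (\<forall>a x. c (sl2_scale a x) = a * c x)"

lemma linear_coordD:
  assumes "linear_coord c"
  shows "c (x + y) = c x + c y" "c (sl2_scale a x) = a * c x" "c 0 = 0"
  using assms unfolding linear_coord_def by (blast, blast, metis mult_zero_left sl2_scale_zero_left)

lemma series_superset:
  assumes "linear_coord c" "finite I" "Poly_Mapping.keys (fst X) \<subseteq> I"
  shows "series c s t X =
    (\<Sum>i\<in>I. const2 (c (Poly_Mapping.lookup (fst X) i)) * t ^ nat (s - i))"
  unfolding series_def
  by (intro sum.mono_neutral_left assms) (auto simp: in_keys_iff linear_coordD[OF assms(1)]
      const2_ring)

lemma series_add:
  assumes "linear_coord c"
  shows "series c s t (X + Y) = series c s t X + series c s t Y"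
proof -
  define K where "K = Poly_Mapping.keys (fst X) \<union> Poly_Mapping.keys (fst Y)"
  have K: "finite K" "Poly_Mapping.keys (fst X) \<subseteq> K" "Poly_Mapping.keys (fst Y) \<subseteq> K"
    "Poly_Mapping.keys (fst (X + Y)) \<subseteq> K"
    using Poly_Mapping.keys_add[of "fst X" "fst Y"] by (auto simp: K_def)
  show ?thesis
    using K by (simp add: series_superset[OF assms K(1)] lookup_add linear_coordD[OF assms]
        sum.distrib
        const2_ring distrib_right)
qed

lemma series_scale:
  assumes "linear_coord c"
  shows "series c s t (affine_scale a X) = const2 a * series c s t X"
proof -
  have "Poly_Mapping.keys (fst (affine_scale a X)) \<subseteq> Poly_Mapping.keys (fst X)"
    by (auto simp: in_keys_iff lookup_affine_scale)
  then show ?thesis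
    by (simp add: series_superset[OF assms, of "Poly_Mapping.keys (fst X)"
        "affine_scale a X"] lookup_affine_scale
        linear_coordD[OF assms] series_def[where X = X] sum_distrib_left const2_ring mult.assoc)
qed

lemma series_loop:
  assumes "linear_coord c"
  shows "series c s t (loop x i) = const2 (c x) * t ^ nat (s - i)"
  using series_superset[OF assms, of "{i}" "loop x i"] by (simp add: loop_def)

lemma series_central [simp]: "series c s t (0, z) = 0"
  by (simp add: series_def)

lemma series_zero [simp]: "series c s t 0 = 0"
  by (simp add: series_def)

text \<open>The exponents s - i and s' - j add up to (s + s') - (i + j) without truncation as soon
  as both coefficients are nonzero, by \<open>neg\<close>. Evaluation therefore turns the loop
  bracket into the bracket of coordinates; the central term is invisible to
  \<open>series\<close>.\<close>

lemma series_bracket: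
  assumes lin: "linear_coord c" "linear_coord c'" "linear_coord d"
    and d: "\<And>x y. d (sl2_bracket x y) = \<alpha> * (c x * c' y - c' x * c y)"
    and neg: "\<And>i x. c (neg_coeff i x) \<noteq> 0 \<Longrightarrow> i \<le> s" "\<And>i x. c' (neg_coeff i x) \<noteq> 0 \<Longrightarrow> i \<le> s'"
  shows "series d (s + s') t (affine_bracket (neg_part X) (neg_part Y)) =
    const2 \<alpha> * (series c s t (neg_part X) * series c' s' t (neg_part Y) -
              series c' s' t (neg_part X) * series c s t (neg_part Y))"
proof (induction X rule: affine_induct)
  case (loop x i)
  show ?case
  proof (induction Y rule: affine_induct)
    case (loop y j)
    define x' y' where "x' = neg_coeff i x" and "y' = neg_coeff j y"
    have x': "c x' \<noteq> 0 \<Longrightarrow> i \<le> s" "c' x' \<noteq> 0 \<Longrightarrow> i \<le> s'"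
      and y': "c y' \<noteq> 0 \<Longrightarrow> j \<le> s" "c' y' \<noteq> 0 \<Longrightarrow> j \<le> s'"
      using neg by (auto simp: x'_def y'_def)
    have "const2 (c x' * c' y') * t ^ nat (s + s' - (i + j)) =
        const2 (c x') * t ^ nat (s - i) * (const2 (c' y') * t ^ nat (s' - j))"
    proof (cases "c x' = 0 \<or> c' y' = 0")
      case False
      then have "nat (s + s' - (i + j)) = nat (s - i) + nat (s' - j)"
        using x' y' by auto
      then show ?thesis by (simp add: power_add const2_ring)
    qed (auto simp: const2_ring)
    moreover have "const2 (c' x' * c y') * t ^ nat (s + s' - (i + j)) =
        const2 (c' x') * t ^ nat (s' - i) * (const2 (c y') * t ^ nat (s - j))"
    proof (cases "c' x' = 0 \<or> c y' = 0")
      case False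
      then have "nat (s + s' - (i + j)) = nat (s' - i) + nat (s - j)"
        using x' y' by auto
      then show ?thesis by (simp add: power_add const2_ring)
    qed (auto simp: const2_ring)
    moreover have "const2 (\<alpha> * (a - b)) * r = const2 \<alpha> * (const2 a * r - const2 b * r)" for a b r
      by (simp add: const2_ring algebra_simps)
    ultimately show ?case
      by (simp only: neg_part_loop affine_bracket_loop series_add[OF lin(3)] series_central
          series_loop[OF lin(1)] series_loop[OF lin(2)] series_loop[OF lin(3)] d add_0_right
          flip: x'_def y'_def)
  qed (simp_all add: affine_bracket_add neg_part_add series_add[OF lin(1)] series_add[OF lin(2)]
      series_add[OF lin(3)] algebra_simps)
qed (simp_all add: affine_bracket_add neg_part_add series_add[OF lin(1)] series_add[OF lin(2)]
      series_add[OF lin(3)] algebra_simps)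

text \<open>
  The algebra \<open>n\<close> acts on two copies of the \<open>sl\<^sub>2\<close> Verma module with basis \<open>u\<^sub>p\<close> and
  \<open>f u\<^sub>p = u\<^bsub>p+1\<^esub>\<close>, \<open>h u\<^sub>p = -2p u\<^sub>p\<close>, \<open>e u\<^sub>p = -p(p-1) u\<^bsub>p-1\<^esub>\<close>, evaluated at two indeterminate
  values of \<open>T\<^sup>-\<^sup>1\<close>. On the tensor product, \<open>f/T\<^sup>i f/T\<^sup>j\<close> contributes the symmetrised monomial in these two
  values, so that the coefficients separate such vectors, and all \<open>h/T\<^sup>i\<close> and \<open>e/T\<^sup>i\<close> kill the
  vacuum. The shift \<open>s\<close> allows for the exchange of the two Chevalley nodes.
\<close>

locale coordinates =
  fixes ce cf ch :: "sl2 \<Rightarrow> complex" and s :: int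
  assumes lin: "linear_coord ce" "linear_coord cf" "linear_coord ch"
    and coord_br: "ce (sl2_bracket x y) = 2 * (ch x * ce y - ce x * ch y)"
      "cf (sl2_bracket x y) = 2 * (cf x * ch y - ch x * cf y)"
      "ch (sl2_bracket x y) = 1 * (ce x * cf y - cf x * ce y)"
    and coord_neg: "ce (neg_coeff i x) \<noteq> 0 \<Longrightarrow> i \<le> - s" "cf (neg_coeff i x) \<noteq> 0 \<Longrightarrow> i \<le> s"
      "ch (neg_coeff i x) \<noteq> 0 \<Longrightarrow> i \<le> 0"
begin

abbreviation "se \<equiv> series ce (- s)"
abbreviation "sf \<equiv> series cf s"
abbreviation "sh \<equiv> series ch 0"

definition fock_act :: "affine_sl2 \<Rightarrow> (int \<Rightarrow> int \<Rightarrow> two_poly) \<Rightarrow> (int \<Rightarrow> int \<Rightarrow> two_poly)" where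
  "fock_act X g p q =
     sf var1 X * g (p - 1) q + sf var2 X * g p (q - 1) -
     const2 2 * (of_int p * (sh var1 X * g p q) + of_int q * (sh var2 X * g p q)) -
     (of_int ((p + 1) * p) * (se var1 X * g (p + 1) q) + of_int ((q + 1) * q) * (se var2 X * g p (q
         + 1)))"

lemma fock_act_linear:
  "fock_act (X + Y) g p q = fock_act X g p q + fock_act Y g p q"
  "fock_act (affine_scale a X) g p q = const2 a * fock_act X g p q"
  "fock_act X (\<lambda>p q. g p q + g' p q) p q = fock_act X g p q + fock_act X g' p q"
  "fock_act X (\<lambda>p q. const2 a * g p q) p q = const2 a * fock_act X g p q"
  by (simp_all only: fock_act_def series_add[OF lin(1)] series_add[OF lin(2)] series_add[OF lin(3)]
      series_scale[OF lin(1)] series_scale[OF lin(2)] series_scale[OF lin(3)])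
     (simp_all add: algebra_simps)

lemma fock_act_bracket:
  assumes "neg_part X = X" "neg_part Y = Y"
  shows "fock_act X (fock_act Y g) p q =
    fock_act Y (fock_act X g) p q + fock_act (affine_bracket X Y) g p q"
proof -
  have e: "se t (affine_bracket X Y) = const2 2 * (sh t X * se t Y - se t X * sh t Y)" for t
    using series_bracket[OF lin(3) lin(1) lin(1) coord_br(1), of 0 "- s" t X Y] coord_neg assms
    by simp
  have f: "sf t (affine_bracket X Y) = const2 2 * (sf t X * sh t Y - sh t X * sf t Y)" for t
    using series_bracket[OF lin(2) lin(3) lin(2) coord_br(2), of s 0 t X Y] coord_neg assms
    by simp
  have h: "sh t (affine_bracket X Y) = se t X * sf t Y - sf t X * se t Y" for t
    using series_bracket[OF lin(1) lin(2) lin(3) coord_br(3), of "- s" s t X Y] coord_neg assms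
    by (simp add: const2_ring)
  have 2: "const2 2 = 2" using const2_ring(6)[of 2] by simp
  show ?thesis
    unfolding fock_act_def e f h 2
    by (simp add: algebra_simps)
qed

fun fock :: "affine_sl2 list \<Rightarrow> int \<Rightarrow> int \<Rightarrow> two_poly" where
  "fock [] p q = (if p = 0 \<and> q = 0 then 1 else 0)"
| "fock (X # w) p q = fock_act X (fock w) p q"

definition fock_coeff :: "int \<Rightarrow> int \<Rightarrow> int \<Rightarrow> int \<Rightarrow> affine_sl2 list \<Rightarrow> complex" where
  "fock_coeff p q i j w = coeff2 i j (fock w p q)"

text \<open>The prefix u mixes the components, so the identity between the tails is required at all
  p and q at once.\<close>

lemma fock_append_cong:
  assumes "\<And>p q. fock w p q = fock w1 p q + fock w2 p q"
  shows "fock (u @ w) p q = fock (u @ w1) p q + fock (u @ w2) p q"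
proof (induction u arbitrary: p q)
  case (Cons X u)
  have "fock (u @ w) = (\<lambda>p q. fock (u @ w1) p q + fock (u @ w2) p q)"
    by (intro ext Cons)
  then show ?case by (simp add: fock_act_linear)
qed (simp add: assms)

lemma fock_append_scale:
  assumes "\<And>p q. fock w p q = const2 a * fock w1 p q"
  shows "fock (u @ w) p q = const2 a * fock (u @ w1) p q"
proof (induction u arbitrary: p q)
  case (Cons X u)
  have "fock (u @ w) = (\<lambda>p q. const2 a * fock (u @ w1) p q)"
    by (intro ext Cons)
  then show ?case by (simp only: append_Cons fock.simps fock_act_linear)
qed (simp add: assms)

end

context verma_module
begin

text \<open>Matrix coefficients of a representation of n respect the relations of its enveloping
  algebra; here the representation is \<open>fock_act\<close> and the vector is the vacuum.\<close>

lemma env_functional_fock_coeff: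
  assumes "coordinates ce cf ch s"
  shows "S.env_functional (coordinates.fock_coeff ce cf ch s p q i j)"
proof -
  interpret coordinates ce cf ch s by fact
  have add: "fock (u @ (X + Y) # w) p q = fock (u @ X # w) p q + fock (u @ Y # w) p q" for u w X Y
    by (rule fock_append_cong) (simp add: fock_act_linear)
  have scale: "fock (u @ affine_scale a X # w) p q = const2 a * fock (u @ X # w) p q" for u w a X
    by (rule fock_append_scale) (simp only: fock.simps fock_act_linear)
  have comm: "fock (u @ X # Y # w) p q = fock (u @ Y # X # w) p q
      + fock (u @ affine_bracket X Y # w) p q"
    if "neg_part X = X" "neg_part Y = Y" for u w X Y
  proof (rule fock_append_cong)
    have *: "fock (Z # w) = fock_act Z (fock w)" for Z w by (intro ext) simp
    show "fock (X # Y # w) p q = fock (Y # X # w) p q + fock (affine_bracket X Y # w) p q" for p q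
      unfolding * by (rule fock_act_bracket[OF that])
  qed
  show ?thesis
    unfolding S.env_functional_def fock_coeff_def
  proof (intro allI impI conjI)
    fix u w X Y a assume "neg_part X = X" "neg_part Y = Y"
    then show "coeff2 i j (fock (u @ X # Y # w) p q) = coeff2 i j (fock (u @ Y # X # w) p q) +
        coeff2 i j (fock (u @ affine_bracket X Y # w) p q)"
      by (simp only: comm[of X Y] coeff2_linear)
  qed (simp_all only: add scale coeff2_linear)
qed

end

context coordinates
begin

lemma fock_coeff_Nil: "fock_coeff p q i j [] = (if p = 0 \<and> q = 0 \<and> i = 0 \<and> j = 0 then 1 else 0)"
  using coeff2_const[of i j 1] coeff2_const[of i j 0]
  by (auto simp: fock_coeff_def const2_ring)

lemma fock_coeff_loop:
  assumes "neg_part (loop x n) = loop x n"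
  shows "fock_coeff p q i j (loop x n # w) =
    cf x * (fock_coeff (p - 1) q (i - (s - n)) j w + fock_coeff p (q - 1) i (j - (s - n)) w) -
    2 * ch x * (of_int p * fock_coeff p q (i + n) j w + of_int q * fock_coeff p q i (j + n) w) -
    ce x * (of_int ((p + 1) * p) * fock_coeff (p + 1) q (i + (s + n)) j w +
            of_int ((q + 1) * q) * fock_coeff p (q + 1) i (j + (s + n)) w)"
proof -
  have x: "neg_coeff n x = x"
    using arg_cong[OF assms, of "\<lambda>X. Poly_Mapping.lookup (fst X) n"]
    unfolding neg_part_loop by (simp add: loop_def)
  have pos: "ce x \<noteq> 0 \<Longrightarrow> n \<le> - s" "cf x \<noteq> 0 \<Longrightarrow> n \<le> s" "ch x \<noteq> 0 \<Longrightarrow> n \<le> 0"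
    using coord_neg[of n x] by (simp_all add: x)
  \<comment> \<open>Each shift keeps its coordinate as a factor: if the coordinate is nonzero,
    \<open>pos\<close> makes the \<open>nat\<close> exponent exact, and otherwise both sides are
    0.\<close>
  have f: "cf x * coeff2 i j (var1 ^ nat (s - n) * r) = cf x * coeff2 (i - (s - n)) j r"
    "cf x * coeff2 i j (var2 ^ nat (s - n) * r) = cf x * coeff2 i (j - (s - n)) r" for r
    using pos(2) by (cases "cf x = 0"; simp add: coeff2_var)+
  have e': "i - int (nat (- s - n)) = i + (s + n)" "j - int (nat (- s - n)) = j + (s + n)" if
      "ce x \<noteq> 0"
    using pos(1)[OF that] by simp_all
  have e: "ce x * coeff2 i j (var1 ^ nat (- s - n) * r) = ce x * coeff2 (i + (s + n)) j r" for r
    by (cases "ce x = 0") (simp, simp only: coeff2_var e' not_False_eq_True)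
  have e2: "ce x * coeff2 i j (var2 ^ nat (- s - n) * r) = ce x * coeff2 i (j + (s + n)) r" for r
    by (cases "ce x = 0") (simp, simp only: coeff2_var e' not_False_eq_True)
  have h: "ch x * coeff2 i j (var1 ^ nat (0 - n) * r) = ch x * coeff2 (i + n) j r"
    "ch x * coeff2 i j (var2 ^ nat (0 - n) * r) = ch x * coeff2 i (j + n) r" for r
    using pos(3) by (cases "ch x = 0"; simp add: coeff2_var)+
  show ?thesis
    unfolding fock_coeff_def fock.simps fock_act_def series_loop[OF lin(1)] series_loop[OF lin(2)]
      series_loop[OF lin(3)] const2_ring(6)[symmetric] mult.assoc coeff2_linear
    unfolding mult.assoc coeff2_linear f h e e2
    by (simp add: algebra_simps)
qed

end

interpretation standard: coordinates coord_e coord_f coord_h 0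
  by unfold_locales
     (auto simp: linear_coord_def sl2_coord neg_coeff_def split: if_splits)

text \<open>After the exchange of nodes eT^n plays the role of fT^(n+1), whence s = -1: e/T receives
  exponent 0 and f exponent 1. The sign of h keeps the bracket relations.\<close>

interpretation flipped: coordinates coord_f coord_e "\<lambda>x. - coord_h x" "-1"
  by unfold_locales
     (auto simp: linear_coord_def sl2_coord neg_coeff_def algebra_simps split: if_splits)

section \<open>The identity for functionals\<close>

text \<open>
  \<open>P p q i j\<close> stands for the coefficient at \<open>u\<^sub>p \<otimes> u\<^sub>q\<close> of the monomial with exponents \<open>i\<close> and \<open>j\<close>.
\<close>

locale affine_rep = vector_space scl
  for scl :: "complex \<Rightarrow> 'v::ab_group_add \<Rightarrow> 'v" +
  fixes e f h :: "int \<Rightarrow> 'v \<Rightarrow> 'v" and m k :: complex and v :: 'v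
    and P :: "int \<Rightarrow> int \<Rightarrow> int \<Rightarrow> int \<Rightarrow> 'v \<Rightarrow> complex"
  assumes op_add: "e n (x + y) = e n x + e n y" "f n (x + y) = f n x + f n y" "h n (x + y) = h n x
      + h n y"
    and op_scale: "e n (scl c x) = scl c (e n x)" "f n (scl c x) = scl c (f n x)" "h n (scl c x)
        = scl c (h n x)"
    and ee: "e i (e j x) = e j (e i x)"
    and ff: "f i (f j x) = f j (f i x)"
    and ef: "e i (f j x) = f j (e i x) + h (i + j) x + (if i + j
        = 0 then scl (of_int i * k) x else 0)"
    and he: "h i (e j x) = e j (h i x) + scl 2 (e (i + j) x)"
    and hf: "h i (f j x) = f j (h i x) + scl (-2) (f (i + j) x)"
    and hh: "h i (h j x) = h j (h i x) + (if i + j = 0 then scl (2 * of_int i * k) x else 0)"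
    and vacuum: "n \<ge> 0 \<Longrightarrow> e n v = 0" "n \<ge> 1 \<Longrightarrow> f n v = 0" "n \<ge> 1 \<Longrightarrow> h n v = 0" "h 0 v = scl m v"
    and verma_induct [case_names v f e add scale]:
      "\<lbrakk>Q v; \<And>x. Q x \<Longrightarrow> Q (f 0 x); \<And>x. Q x \<Longrightarrow> Q (e (-1) x);
        \<And>x y. Q x \<Longrightarrow> Q y \<Longrightarrow> Q (x + y); \<And>c x. Q x \<Longrightarrow> Q (scl c x)\<rbrakk> \<Longrightarrow> Q x"
    and P_add: "P p q i j (x + y) = P p q i j x + P p q i j y"
    and P_scale: "P p q i j (scl c x) = c * P p q i j x"
    and P_v: "P p q i j v = (if p = 0 \<and> q = 0 \<and> i = 0 \<and> j = 0 then 1 else 0)"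
    and P_f: "n \<ge> 0 \<Longrightarrow> P p q i j (f (- n) x) = P (p - 1) q (i - n) j x + P p (q - 1) i (j - n) x"
    and P_h: "n \<ge> 1 \<Longrightarrow> P p q i j (h (- n) x) =
      - 2 * (of_int p * P p q (i - n) j x + of_int q * P p q i (j - n) x)"
    and P_e: "n \<ge> 1 \<Longrightarrow> P p q i j (e (- n) x) =
      - (of_int ((p + 1) * p) * P (p + 1) q (i - n) j x + of_int ((q + 1) * q) * P p (q + 1) i (j
          - n) x)"
begin

lemma P_diff: "P p q i j (x - y) = P p q i j x - P p q i j y"
  using P_add[of p q i j "x - y" y] by simp

lemma P_f0: "P p q i j (f 0 x) = P (p - 1) q i j x + P p (q - 1) i j x"
  using P_f[of 0 p q i j x] by simp

lemma P_e1: "P p q i j (e (-1) x) =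
    - (of_int ((p + 1) * p) * P (p + 1) q (i - 1) j x + of_int ((q + 1) * q) * P p (q + 1) i (j
        - 1) x)"
  using P_e[of 1 p q i j x] by simp

text \<open>The vacuum sits at index 0 and f only raises. The factor (p + 1) p of e vanishes at p =
  -1, the one place where e could leave the nonnegative range.\<close>

lemma P_neg: "p < 0 \<or> q < 0 \<or> i < 0 \<or> j < 0 \<Longrightarrow> P p q i j x = 0"
proof (induction x arbitrary: p q i j rule: verma_induct)
  case (e x)
  have "of_int ((p + 1) * p) * P (p + 1) q (i - 1) j x = 0"
    using e by (cases "p = -1") auto
  moreover have "of_int ((q + 1) * q) * P p (q + 1) i (j - 1) x = 0"
    using e by (cases "q = -1") auto
  ultimately show ?case by (simp only: P_e1) simp
qed (auto simp: P_v P_f0 P_add P_scale)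

text \<open>Since h lies in b, its value is not read off the evaluation modules, where
  \<open>u\<^sub>p\<close> has weight -2p. The summand m enters through v and is carried along by
  the brackets with f and e/T.\<close>

lemma P_h0: "P p q i j (h 0 x) = (m - 2 * of_int (p + q)) * P p q i j x"
proof (induction x arbitrary: p q i j rule: verma_induct)
  case v
  show ?case by (auto simp: vacuum P_scale P_v)
next
  case (f x)
  show ?case
    by (simp add: hf P_add P_diff P_scale P_f0 f algebra_simps)
next
  case (e x)
  show ?case
    by (simp add: he P_add P_scale P_e1 e algebra_simps)
qed (simp_all add: op_add op_scale P_add P_scale distrib_left)

section \<open>The functionals \<psi> and their Casimir identity\<close>

definition psi :: "int \<Rightarrow> int \<Rightarrow> 'v \<Rightarrow> complex" where
  "psi d n x = P d 0 n 0 x"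

lemma psi_linear:
  "psi d n (x + y) = psi d n x + psi d n y" "psi d n (x - y) = psi d n x - psi d n y"
  "psi d n (scl c x) = c * psi d n x"
  by (simp_all add: psi_def P_add P_diff P_scale)

lemma psi_zero [simp]: "psi d n 0 = 0"
  using psi_linear(3)[of d n 0 0] by simp

lemma psi_neg: "n < 0 \<Longrightarrow> psi d n x = 0"
  by (simp add: psi_def P_neg)

lemma psi_h0: "psi d n (h 0 x) = (m - 2 * of_int d) * psi d n x"
  by (simp add: psi_def P_h0)

lemma psi_f0: "psi d n (f 0 x) = psi (d - 1) n x"
  by (simp add: psi_def P_f0 P_neg)

lemma psi_e1: "psi d n (e (-1) x) = - of_int (d * (d + 1)) * psi (d + 1) (n - 1) x"
  by (simp add: psi_def P_e1 algebra_simps)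

text \<open>Index 0 is reached from v alone: f would have to come from index -1, and the factor d (d
  + 1) of e/T is 0 at d = 0. At v only exponent 0 occurs.\<close>

lemma psi_0: "psi 0 n x = 0" if "n > 0"
  using that
proof (induction x rule: verma_induct)
  case (f x)
  then show ?case by (simp add: psi_def P_f0 P_neg)
qed (auto simp: psi_e1 psi_linear, simp add: psi_def P_v)

text \<open>
  For \<open>d = 1\<close> only the term \<open>l = n\<close> of the first sum survives. The general family is closed under
  the induction over the generators \<open>f/T\<^sup>0\<close> and \<open>e/T\<close>: for \<open>f\<close> it passes from \<open>d - 1\<close> to \<open>d\<close> and
  for \<open>e/T\<close> from \<open>(d + 1, n - 1)\<close> to \<open>(d, n)\<close>.
\<close>

lemma psi_family_identity:
  fixes n :: nat
  shows "(\<Sum>l\<le>n. psi (d - 1) (int n - int l) (e (int l) x)) -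
      of_int d * (\<Sum>l<n. psi d (int n - int (Suc l)) (h (int (Suc l)) x)) -
      of_int (d * (d + 1)) * (\<Sum>l<n. psi (d + 1) (int n - int (Suc l)) (f (int (Suc l)) x)) =
    (of_int d * m - of_int (d * (d - 1)) + of_nat n * (k + 2)) * psi d (int n) x"
proof (induction x arbitrary: d n rule: verma_induct)
  case v
  \<comment> \<open>The left side vanishes by \<open>vacuum\<close>. The right side vanishes too,
    because the scalar is 0 at d = n = 0, the only indices where \<open>psi\<close> sees v.\<close>
  have "d = 0 \<and> n = 0" if "psi d (int n) v \<noteq> 0"
    using that by (auto simp: psi_def P_v split: if_splits)
  then have "(of_int d * m - of_int (d * (d - 1)) + of_nat n * (k + 2)) * psi d (int n) v = 0"
    by (cases "psi d (int n) v = 0") auto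
  then show ?case by (simp add: vacuum)
next
  case (f x)
  define A where "A = (\<Sum>l\<le>n. psi (d - 2) (int n - int l) (e (int l) x))"
  define B where "B = (\<Sum>l<n. psi (d - 1) (int n - int (Suc l)) (h (int (Suc l)) x))"
  define C where "C = (\<Sum>l<n. psi d (int n - int (Suc l)) (f (int (Suc l)) x))"
  define D where "D = psi (d - 1) (int n) x"
  \<comment> \<open>The brackets [eT^l, f] = hT^l produce an h-sum starting at l = 0. Its first term
    has the weight m - 2(d - 1), exactly the growth of the scalar from d - 1 to d.\<close>
  have "(\<Sum>l\<le>n. psi (d - 1) (int n - int l) (h (int l) x)) = (m - 2 * of_int (d - 1)) * D + B"
    unfolding B_def D_def
    by (simp add: lessThan_Suc_atMost[symmetric] sum.lessThan_Suc_shift psi_h0 del: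
        sum.lessThan_Suc)
  moreover have "(\<Sum>l\<le>n. psi (d - 1) (int n - int l) (e (int l) (f 0 x))) =
      A + (\<Sum>l\<le>n. psi (d - 1) (int n - int l) (h (int l) x))"
    unfolding A_def sum.distrib[symmetric]
  proof (rule sum.cong[OF refl])
    fix l
    have "e (int l) (f 0 x) = f 0 (e (int l) x) + h (int l) x" using ef[of "int l" 0 x] by auto
    then show "psi (d - 1) (int n - int l) (e (int l) (f 0 x)) =
        psi (d - 2) (int n - int l) (e (int l) x) + psi (d - 1) (int n - int l) (h (int l) x)"
      by (simp add: psi_linear psi_f0)
  qed
  ultimately have e_sum: "(\<Sum>l\<le>n. psi (d - 1) (int n - int l) (e (int l) (f 0 x))) =
      A + ((m - 2 * of_int (d - 1)) * D + B)"
    by simp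
  have h_sum: "(\<Sum>l<n. psi d (int n - int (Suc l)) (h (int (Suc l)) (f 0 x))) = B - 2 * C"
    unfolding B_def C_def
    by (simp add: hf psi_linear psi_f0 sum_subtractf sum_distrib_left)
  have f_sum: "(\<Sum>l<n. psi (d + 1) (int n - int (Suc l)) (f (int (Suc l)) (f 0 x))) = C"
    unfolding C_def by (simp add: ff[of _ 0] psi_f0)
  have IH: "A = (of_int (d - 1) * m - of_int ((d - 1) * (d - 2)) + of_nat n * (k + 2)) * D +
      of_int ((d - 1) * d) * C + of_int (d - 1) * B"
    using f[of "d - 1" n] by (simp add: A_def B_def C_def D_def diff_eq_eq)
  have psi_x: "psi d (int n) (f 0 x) = D"
    by (simp add: psi_f0 D_def)
  show ?case
    unfolding e_sum h_sum f_sum IH psi_x by (simp add: algebra_simps)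
next
  case (e x)
  show ?case
  proof (cases n)
    case 0
    then show ?thesis by (simp add: ee[of 0] psi_e1 psi_neg)
  next
    case (Suc n')
    define A where "A = (\<Sum>l\<le>n'. psi d (int n' - int l) (e (int l) x))"
    define B where "B = (\<Sum>l<n'. psi (d + 1) (int n' - int (Suc l)) (h (int (Suc l)) x))"
    define C where "C = (\<Sum>l<n'. psi (d + 2) (int n' - int (Suc l)) (f (int (Suc l)) x))"
    define D where "D = psi (d + 1) (int n') x"
    have e_sum: "(\<Sum>l\<le>n. psi (d - 1) (int n - int l) (e (int l) (e (-1) x))) = - of_int (d * (d
        - 1)) * A"
      unfolding A_def Suc by (simp add: ee[of _ "-1"] psi_e1 psi_neg sum_distrib_left mult.commute)
    have h_sum: "(\<Sum>l<n. psi d (int n - int (Suc l)) (h (int (Suc l)) (e (-1) x))) =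
        2 * A - of_int (d * (d + 1)) * B"
      unfolding A_def B_def Suc
      by (simp add: he psi_linear psi_e1 sum.distrib sum_distrib_left sum_subtractf sum_negf psi_neg
          diff_diff_eq add.commute[of _ 1] flip: lessThan_Suc_atMost)
    \<comment> \<open>[fT^(l+1), e/T] is -hT^l, plus k when l = 0. At l = 0 the level and the weight
      m - 2(d + 1) combine to k - m + 2(d + 1), which is the change of the scalar from (d + 1, n -
      1) to (d, n); here k + 2 arises.\<close>
    have fe: "f (int (Suc l)) (e (-1) x) =
        e (-1) (f (int (Suc l)) x) + scl (-1) (h (int l) x) + (if l = 0 then scl k x else 0)" for l
      using ef[of "-1" "int (Suc l)" x] by (auto simp: algebra_simps)
    have "(\<Sum>l<n. psi (d + 1) (int n - int (Suc l)) (f (int (Suc l)) (e (-1) x))) =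
        (\<Sum>l<Suc n'. psi (d + 1) (int n' - int l) (e (-1) (f (int (Suc l)) x))) -
        (\<Sum>l<Suc n'. psi (d + 1) (int n' - int l) (h (int l) x)) +
        (\<Sum>l<Suc n'. if l = 0 then k * D else 0)"
      unfolding sum.distrib[symmetric] sum_subtractf[symmetric] Suc D_def
      by (intro sum.cong refl) (simp add: fe psi_linear del: of_nat_Suc, simp)
    also have "(\<Sum>l<Suc n'. psi (d + 1) (int n' - int l) (e (-1) (f (int (Suc l)) x))) =
        - of_int ((d + 1) * (d + 2)) * C"
      unfolding C_def by (simp add: psi_e1 psi_neg sum_distrib_left algebra_simps)
    also have "(\<Sum>l<Suc n'. psi (d + 1) (int n' - int l) (h (int l) x)) = (m - 2 * of_int (d
        + 1)) * D + B"
      unfolding B_def D_def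
      by (simp add: sum.lessThan_Suc_shift psi_h0 del: sum.lessThan_Suc)
    also have "(\<Sum>l<Suc n'. if l = 0 then k * D else 0) = k * D"
      by (simp add: sum.delta)
    finally have f_sum: "(\<Sum>l<n. psi (d + 1) (int n - int (Suc l)) (f (int (Suc l)) (e (-1) x))) =
        - of_int ((d + 1) * (d + 2)) * C - ((m - 2 * of_int (d + 1)) * D + B) + k * D" .
    have "d + 1 + 1 = d + 2" by simp
    then have IH: "A = (of_int (d + 1) * m - of_int ((d + 1) * d) + of_nat n' * (k + 2)) * D +
        of_int ((d + 1) * (d + 2)) * C + of_int (d + 1) * B"
      using e[of "d + 1" n'] unfolding diff_eq_eq
      by (simp only: A_def B_def C_def D_def add_diff_cancel_right')
    have psi_x: "psi d (int n) (e (-1) x) = - of_int (d * (d + 1)) * D"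
      by (simp add: psi_e1 D_def Suc)
    show ?thesis
      unfolding e_sum h_sum f_sum IH psi_x by (simp add: Suc algebra_simps)
  qed
next
  case (add x y)
  show ?case
    using add[of d n] by (simp add: op_add psi_linear sum.distrib algebra_simps)
next
  case (scale c x)
  show ?case
    using arg_cong[OF scale[of d n], of "(*) c"]
    by (simp add: op_scale psi_linear algebra_simps flip: sum_distrib_left)
qed

lemma psi_identity:
  fixes n :: nat
  shows "psi 0 0 (e (int n) x) = (m + of_nat n * (k + 2)) * psi 1 (int n) x +
    (\<Sum>l = 1..n. psi 1 (int (n - l)) (h (int l) x) + 2 * psi 2 (int (n - l)) (f (int l) x))"
proof -
  have "(\<Sum>l\<le>n. psi 0 (int n - int l) (e (int l) x)) = psi 0 0 (e (int n) x)"
    by (subst sum.remove[of _ n]) (auto intro!: sum.neutral psi_0)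
  moreover have "(\<Sum>l = 1..n. g l) = (\<Sum>l<n. g (Suc l))" for g :: "nat \<Rightarrow> complex"
    by (simp add: sum.atLeast1_atMost_eq)
  ultimately show ?thesis
    using psi_family_identity[where d = 1 and n = n and x = x]
    by (simp add: sum.distrib of_nat_diff sum_distrib_left algebra_simps)
qed

end

section \<open>Spanning by PBW monomials\<close>

text \<open>The letters are f/T^i, h/T^(i+1) and e/T^(i+1): the offset in the last two makes every
  natural number a legal index. The degrees in \<open>weight\<close> follow this convention.\<close>

datatype letter = LF nat | LH nat | LE nat

fun weight :: "letter \<Rightarrow> nat \<times> nat" where
  "weight (LF i) = (i + 1, i)"
| "weight (LH i) = (i + 1, i + 1)"
| "weight (LE i) = (i, i + 1)"

definition weights :: "letter list \<Rightarrow> nat \<times> nat" where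
  "weights w = sum_list (map weight w)"

lemma weights_simps [simp]: "weights [] = 0" "weights (x # w) = weight x + weights w"
  by (simp_all add: weights_def)

fun pbw_le :: "letter \<Rightarrow> letter \<Rightarrow> bool" where
  "pbw_le (LF i) (LF j) \<longleftrightarrow> j \<le> i"
| "pbw_le (LF i) _ \<longleftrightarrow> True"
| "pbw_le (LH i) (LH j) \<longleftrightarrow> j \<le> i"
| "pbw_le (LH i) (LE j) \<longleftrightarrow> True"
| "pbw_le (LE i) (LE j) \<longleftrightarrow> j \<le> i"
| "pbw_le _ _ \<longleftrightarrow> False"

lemma pbw_le_total: "pbw_le x y \<or> pbw_le y x"
  by (cases x; cases y) auto

lemma pbw_le_trans: "pbw_le x y \<Longrightarrow> pbw_le y z \<Longrightarrow> pbw_le x z"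
  by (cases x; cases y; cases z) auto

fun pbw_insert :: "letter \<Rightarrow> letter list \<Rightarrow> letter list" where
  "pbw_insert x [] = [x]"
| "pbw_insert x (y # w) = (if pbw_le x y then x # y # w else y # pbw_insert x w)"

lemma pbw_insert_facts:
  "set (pbw_insert x w) = insert x (set w)" "length (pbw_insert x w) = Suc (length w)"
  "weights (pbw_insert x w) = weight x + weights w"
  by (induction w) (auto simp: algebra_simps)

lemma sorted_pbw_insert: "sorted_wrt pbw_le w \<Longrightarrow> sorted_wrt pbw_le (pbw_insert x w)"
proof (induction w)
  case (Cons y w)
  then show ?case
    using pbw_le_total[of x y] pbw_le_trans[of x y] by (auto simp: pbw_insert_facts)
qed simp

lemma sorted_pbw_decompose:
  assumes "sorted_wrt pbw_le w"
  shows "\<exists>is js ls. w = map LF is @ map LH js @ map LE ls \<and>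
    sorted_wrt (\<ge>) is \<and> sorted_wrt (\<ge>) js \<and> sorted_wrt (\<ge>) ls"
  using assms
proof (induction w)
  case Nil
  show ?case by (intro exI[of _ "[]"]) simp
next
  case (Cons x w)
  then obtain "is" js ls where w: "w = map LF is @ map LH js @ map LE ls"
    "sorted_wrt (\<ge>) is" "sorted_wrt (\<ge>) js" "sorted_wrt (\<ge>) ls"
    by auto
  show ?case
  proof (cases x)
    case (LF i)
    then have "x # w = map LF (i # is) @ map LH js @ map LE ls \<and> sorted_wrt (\<ge>) (i # is)"
      using w Cons.prems by (auto simp: ball_Un)
    with w show ?thesis by blast
  next
    case (LH j)
    then have "is = []" using w Cons.prems by (cases "is") auto
    then have "x # w = map LF [] @ map LH (j # js) @ map LE ls \<and> sorted_wrt (\<ge>) (j # js)"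
      using w Cons.prems LH by (auto simp: ball_Un)
    with w show ?thesis by (metis sorted_wrt.simps(1))
  next
    case (LE l)
    then have "is = []" "js = []" using w Cons.prems by (cases "is"; cases js; auto)+
    then have "x # w = map LF [] @ map LH [] @ map LE (l # ls) \<and> sorted_wrt (\<ge>) (l # ls)"
      using w Cons.prems LE by (auto simp: ball_Un)
    then show ?thesis by (metis sorted_wrt.simps(1))
  qed
qed

context affine_rep
begin

section \<open>Straightening of words into PBW order\<close>

fun letter_act :: "letter \<Rightarrow> 'v \<Rightarrow> 'v" where
  "letter_act (LF i) = f (- int i)"
| "letter_act (LH i) = h (- int (Suc i))"
| "letter_act (LE i) = e (- int (Suc i))"

lemma op_linear: "letter_act z (x + y) = letter_act z x + letter_act z y" "letter_act z (scl c x)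
    = scl c (letter_act z x)"
  by (cases z; simp add: op_add op_scale)+

lemma op_zero [simp]: "letter_act z 0 = 0"
  using op_linear(2)[of z 0 0] by simp

lemma op_diff: "letter_act z (x - y) = letter_act z x - letter_act z y"
  using op_linear(1)[of z "x - y" y] by (simp add: algebra_simps)

text \<open>The bracket of two letters is a multiple of a single letter whose weight is the sum, and
  no central term can arise among these exponents. So each exchange of neighbours costs at most one
  shorter word of the same weight.\<close>

lemma op_swap:
  "(\<forall>u. letter_act x (letter_act y u) = letter_act y (letter_act x u)) \<or>
   (\<exists>c z. weight z = weight x + weight y \<and> (\<forall>u. letter_act x (letter_act y u)
       = letter_act y (letter_act x u) + scl c (letter_act z u)))"
proof -
  have HF: "letter_act (LH j) (letter_act (LF i) u) = letter_act (LF i) (letter_act (LH j) u)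
      + scl (-2) (letter_act (LF (i + j + 1)) u)" for i j u
    by (simp add: hf[of "- int (Suc j)" "- int i" u, simplified] algebra_simps)
  have HE: "letter_act (LH j) (letter_act (LE l) u) = letter_act (LE l) (letter_act (LH j) u)
      + scl 2 (letter_act (LE (l + j + 1)) u)" for l j u
    by (simp add: he[of "- int (Suc j)" "- int (Suc l)" u, simplified] algebra_simps)
  have EF: "letter_act (LE l) (letter_act (LF i) u) = letter_act (LF i) (letter_act (LE l) u)
      + scl 1 (letter_act (LH (i + l)) u)" for i l u
    by (simp add: ef[of "- int (Suc l)" "- int i" u, simplified] algebra_simps)
  have swap: "letter_act y (letter_act x u) = letter_act x (letter_act y u)
      + scl (- c) (letter_act z u)"
    if "letter_act x (letter_act y u) = letter_act y (letter_act x u) + scl c (letter_act z u)"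
        for x y z c u
    using that by simp
  show ?thesis
  proof (cases x; cases y)
    fix i j assume "x = LF i" "y = LH j"
    then show ?thesis
      using swap[OF HF[of j i]] by (intro disjI2 exI[of _ "- (-2)"] exI[of _ "LF (i + j + 1)"]) simp
  next
    fix i l assume "x = LF i" "y = LE l"
    then show ?thesis
      using swap[OF EF[of l i]] by (intro disjI2 exI[of _ "- 1"] exI[of _ "LH (i + l)"]) simp
  next
    fix i j assume "x = LH j" "y = LF i"
    then show ?thesis
      using HF[of j i] by (intro disjI2 exI[of _ "-2"] exI[of _ "LF (i + j + 1)"]) simp
  next
    fix l j assume "x = LH j" "y = LE l"
    then show ?thesis
      using HE[of j l] by (intro disjI2 exI[of _ "2"] exI[of _ "LE (l + j + 1)"]) simp
  next
    fix i l assume "x = LE l" "y = LF i"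
    then show ?thesis
      using EF[of l i] by (intro disjI2 exI[of _ "1"] exI[of _ "LH (i + l)"]) simp
  next
    fix l j assume "x = LE l" "y = LH j"
    then show ?thesis
      using swap[OF HE[of j l]] by (intro disjI2 exI[of _ "- 2"] exI[of _ "LE (l + j + 1)"]) simp
  next
    fix i j assume xy: "x = LF i" "y = LF j"
    show ?thesis unfolding xy letter_act.simps by (intro disjI1 allI ff)
  next
    fix i j assume xy: "x = LH i" "y = LH j"
    have "h (- int (Suc i)) (h (- int (Suc j)) u) = h (- int (Suc j)) (h (- int (Suc i)) u)" for u
      by (subst hh) simp
    then show ?thesis unfolding xy letter_act.simps by (intro disjI1 allI)
  next
    fix i j assume xy: "x = LE i" "y = LE j"
    show ?thesis unfolding xy letter_act.simps by (intro disjI1 allI ee)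
  qed
qed

definition monomial :: "letter list \<Rightarrow> 'v" where
  "monomial w = foldr letter_act w v"

lemma monomial_simps [simp]: "monomial [] = v" "monomial (x # w) = letter_act x (monomial w)"
  by (simp_all add: monomial_def)

text \<open>The bound on the length is the PBW filtration, along which the straightening induction
  runs.\<close>

definition sorted_span :: "nat \<Rightarrow> nat \<times> nat \<Rightarrow> 'v set" where
  "sorted_span n \<gamma> = span {monomial w |w. sorted_wrt pbw_le w \<and> weights w = \<gamma> \<and> length w \<le> n}"

lemma sorted_span_mono: "x \<in> sorted_span n \<gamma> \<Longrightarrow> n \<le> n' \<Longrightarrow> x \<in> sorted_span n' \<gamma>"
  unfolding sorted_span_def by (rule subsetD[OF span_mono]) auto

lemma op_sorted_span:
  assumes "x \<in> sorted_span n \<gamma>"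
    and "\<And>w. sorted_wrt pbw_le w \<Longrightarrow> weights w = \<gamma> \<Longrightarrow> length w \<le> n \<Longrightarrow>
      monomial (z # w) \<in> sorted_span n' \<delta>"
  shows "letter_act z x \<in> sorted_span n' \<delta>"
  using assms(1) unfolding sorted_span_def
proof (induction rule: span_induct_alt)
  case (step c y x)
  then obtain w where "y = monomial w" "sorted_wrt pbw_le w" "weights w = \<gamma>" "length w \<le> n"
    by auto
  then have "letter_act z y \<in> sorted_span n' \<delta>"
    using assms(2) by auto
  with step show ?case
    unfolding sorted_span_def by (simp add: op_linear span_add span_scale)
qed (simp add: span_zero)

text \<open>Induction on the length. The tail is sorted first; moving the head to its place costs
  only words in which a bracket has fused two letters, hence shorter words of the same
  weight.\<close>

lemma monomial_sorted_span: "monomial w \<in> sorted_span (length w) (weights w)"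
proof (induction w rule: length_induct)
  case (1 w)
  then have IH: "monomial u \<in> sorted_span n (weights u)" if "length u < length w" "length u \<le> n"
      for u n
    using that sorted_span_mono by blast
  show ?case
  proof (cases w)
    case Nil
    then show ?thesis unfolding sorted_span_def by (intro span_base) auto
  next
    case (Cons x w')
    have ins: "monomial (y # u) - monomial (pbw_insert y u) \<in> sorted_span (length u) (weight y
        + weights u)"
      if "sorted_wrt pbw_le u" "length u \<le> length w'" for y u
      using that
    proof (induction u)
      case Nil
      then show ?case by (simp add: sorted_span_def span_zero)
    next
      case (Cons a u)
      show ?case
      proof (cases "pbw_le y a")
        case True
        then show ?thesis by (simp add: sorted_span_def span_zero)
      next
        case False
        \<comment> \<open>Two errors arise when y passes a: the error of inserting y into u,
          prefixed by a, and the bracket of y and a in front of u. Both involve words of length at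
          most Suc (length u), within reach of \<open>IH\<close>.\<close>
        have lt: "Suc (length u) < length w" using Cons.prems \<open>w = x # w'\<close> by simp
        have 1: "letter_act a (monomial (y # u) - monomial (pbw_insert y u)) \<in>
            sorted_span (Suc (length u)) (weight y + weights (a # u))"
        proof (rule op_sorted_span)
          show "monomial (y # u) - monomial (pbw_insert y u) \<in> sorted_span (length u) (weight y
              + weights u)"
            using Cons by simp
          fix u' assume "weights u' = weight y + weights u" "length u' \<le> length u"
          then show "monomial (a # u') \<in> sorted_span (Suc (length u)) (weight y + weights (a # u))"
            using IH[of "a # u'" "Suc (length u)"] lt by (simp add: algebra_simps)
        qed
        have 2: "letter_act y (letter_act a (monomial u))
            - letter_act a (letter_act y (monomial u)) \<in>
            sorted_span (Suc (length u)) (weight y + weights (a # u))"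
          using op_swap[of y a]
        proof (elim disjE exE conjE)
          assume "\<forall>x. letter_act y (letter_act a x) = letter_act a (letter_act y x)"
          then show ?thesis by (simp add: sorted_span_def span_zero)
        next
          fix c z assume z: "weight z = weight y + weight a"
            "\<forall>x. letter_act y (letter_act a x) = letter_act a (letter_act y x)
                + scl c (letter_act z x)"
          have "monomial (z # u) \<in> sorted_span (Suc (length u)) (weight y + weights (a # u))"
            using IH[of "z # u" "Suc (length u)"] lt z(1) by (simp add: algebra_simps)
          then show ?thesis
            using z(2) by (simp add: sorted_span_def span_scale)
        qed
        have "monomial (y # a # u) - monomial (pbw_insert y (a # u)) =
            (letter_act y (letter_act a (monomial u)) - letter_act a (letter_act y (monomial u))) +
            letter_act a (monomial (y # u) - monomial (pbw_insert y u))"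
          using False by (simp add: op_diff)
        then show ?thesis
          using 1 2 unfolding sorted_span_def by (simp only: span_add length_Cons)
      qed
    qed
    have "letter_act x (monomial w') \<in> sorted_span (length w) (weights w)"
    proof (rule op_sorted_span)
      show "monomial w' \<in> sorted_span (length w') (weights w')"
        using IH Cons by simp
      fix u assume u: "sorted_wrt pbw_le u" "weights u = weights w'" "length u \<le> length w'"
      have "monomial (x # u) - monomial (pbw_insert x u) \<in> sorted_span (length w) (weights w)"
        by (rule sorted_span_mono[of _ "length u"]) (use ins[OF u(1,3),
            of x] u(2,3) Cons in simp_all)
      moreover have "monomial (pbw_insert x u) \<in> sorted_span (length w) (weights w)"
        unfolding sorted_span_def using u Cons
        by (intro span_base) (auto simp: pbw_insert_facts sorted_pbw_insert)
      ultimately show "monomial (x # u) \<in> sorted_span (length w) (weights w)"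
        unfolding sorted_span_def using span_add by fastforce
    qed
    then show ?thesis by (simp add: Cons)
  qed
qed

section \<open>Homogeneous components and the degrees of PBW vectors\<close>

definition pbw_vector :: "nat list \<Rightarrow> nat list \<Rightarrow> nat list \<Rightarrow> 'v" where
  "pbw_vector is js ls = foldr (\<lambda>i. f (- int i)) is 
     (foldr (\<lambda>j. h (- int j)) js (foldr (\<lambda>l. e (- int l)) ls v))"

definition node_letter :: "node \<Rightarrow> letter" where
  "node_letter i = (case i of N1 \<Rightarrow> LF 0 | N2 \<Rightarrow> LE 0)"

definition graded :: "nat \<times> nat \<Rightarrow> 'v set" where
  "graded \<gamma> = span {monomial (map node_letter is) |is. count_list is N1 = fst \<gamma> \<and> count_list is N2
      = snd \<gamma>}"

lemma weights_node_letter: "weights (map node_letter is) = (count_list is N1, count_list is N2)"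
proof (induction "is")
  case (Cons i "is")
  then show ?case by (cases i) (simp_all add: node_letter_def)
qed (simp add: zero_prod_def)

lemma monomial_pbw: "monomial (map LF is @ map LH js @ map LE ls)
    = pbw_vector is (map Suc js) (map Suc ls)"
proof -
  have "foldr letter_act (map LF is) y = foldr (\<lambda>i. f (- int i)) is y" for y by (induction
      "is") simp_all
  moreover have "foldr letter_act (map LH js) y = foldr (\<lambda>j. h (- int j)) (map Suc js) y" for y
    by (induction js) simp_all
  moreover have "foldr letter_act (map LE ls) y = foldr (\<lambda>l. e (- int l)) (map Suc ls) y" for y
    by (induction ls) simp_all
  ultimately show ?thesis
    unfolding monomial_def pbw_vector_def by simp
qed

lemma weights_append: "weights (u @ w) = weights u + weights w"
  by (simp add: weights_def)

lemma weights_pbw: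
  "weights (map LF is @ map LH js @ map LE ls) = \<gamma> \<longleftrightarrow>
     sum_list is + sum_list (map Suc js) + sum_list (map Suc ls) + length is = fst \<gamma>
         + length (map Suc ls) \<and>
     sum_list is + sum_list (map Suc js) + sum_list (map Suc ls) = snd \<gamma>"
proof -
  have F: "weights (map LF is) = (sum_list is + length is, sum_list is)"
    by (induction "is") (simp_all add: zero_prod_def)
  have H: "weights (map LH js) = (sum_list (map Suc js), sum_list (map Suc js))"
    by (induction js) (simp_all add: zero_prod_def)
  have E: "weights (map LE ls) = (sum_list ls, sum_list (map Suc ls))"
    by (induction ls) (simp_all add: zero_prod_def)
  have "sum_list (map Suc ls) = sum_list ls + length ls"
    by (induction ls) simp_all
  then show ?thesis
    unfolding weights_append F H E by (auto simp: prod_eq_iff)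
qed

lemma graded_pbw: "graded \<gamma> \<subseteq> span {pbw_vector is js ls |is js ls. (is, js, ls) \<in> pbw_indices \<gamma>}"
  unfolding graded_def
proof (rule span_minimal[OF _ subspace_span], safe)
  fix "is" assume c: "count_list is N1 = fst \<gamma>" "count_list is N2 = snd \<gamma>"
  define w where "w = map node_letter is"
  have "weights w = \<gamma>" by (simp add: w_def weights_node_letter c)
  then have "monomial w \<in> sorted_span (length w) \<gamma>" using monomial_sorted_span by blast
  moreover have "sorted_span (length w) \<gamma> \<subseteq> span {pbw_vector is js ls |is js ls. (is, js, ls)
      \<in> pbw_indices \<gamma>}"
    unfolding sorted_span_def
  proof (rule span_mono, safe)
    fix u assume u: "sorted_wrt pbw_le u" "\<gamma> = weights u"
    obtain "is" js ls where d: "u = map LF is @ map LH js @ map LE ls"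
      "sorted_wrt (\<ge>) is" "sorted_wrt (\<ge>) js" "sorted_wrt (\<ge>) ls"
      using sorted_pbw_decompose[OF u(1)] by blast
    have "(is, map Suc js, map Suc ls) \<in> pbw_indices \<gamma>"
      using d weights_pbw[of "is" js ls \<gamma>] u(2) by (auto simp: pbw_indices_def sorted_wrt_map)
    then show "\<exists>is js ls. monomial u = pbw_vector is js ls \<and> (is, js, ls) \<in> pbw_indices (weights u)"
      using monomial_pbw[of "is" js ls] u(2) d(1) by blast
  qed
  ultimately show "monomial (map node_letter is) \<in> span {pbw_vector is js ls |is js ls. (is, js, ls)
      \<in> pbw_indices \<gamma>}"
    unfolding w_def by blast
qed

lemma graded_scale_cancel: "scl c x \<in> graded \<gamma> \<Longrightarrow> c \<noteq> 0 \<Longrightarrow> x \<in> graded \<gamma>"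
  unfolding graded_def using span_scale[of "scl c x" _ "inverse c"] by simp

lemma graded_closed:
  "x \<in> graded \<gamma> \<Longrightarrow> y \<in> graded \<gamma> \<Longrightarrow> x + y \<in> graded \<gamma>"
  "x \<in> graded \<gamma> \<Longrightarrow> y \<in> graded \<gamma> \<Longrightarrow> x - y \<in> graded \<gamma>"
  "x \<in> graded \<gamma> \<Longrightarrow> scl c x \<in> graded \<gamma>"
  unfolding graded_def by (auto intro: span_add span_diff span_scale)

lemma op_graded_node:
  assumes "x \<in> graded \<gamma>"
  shows "letter_act (node_letter i) x \<in> graded (weight (node_letter i) + \<gamma>)"
  using assms unfolding graded_def
proof (induction rule: span_induct_alt)
  case (step c y x)
  then obtain "is" where "y = monomial (map node_letter is)" "count_list is N1 = fst \<gamma>"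
      "count_list is N2 = snd \<gamma>"
    by auto
  then have "letter_act (node_letter i) y \<in> graded (weight (node_letter i) + \<gamma>)"
    unfolding graded_def by (intro span_base CollectI exI[of _ "i # is"])
      (cases i; simp add: node_letter_def)
  with step show ?case
    unfolding graded_def by (simp add: op_linear span_add span_scale)
qed (simp add: span_zero)

text \<open>\<open>graded\<close> speaks only of words in the two simple letters, so homogeneity of
  any other letter has to be inherited through a bracket that produces it.\<close>

lemma bracket_graded:
  assumes "\<And>\<gamma> u. u \<in> graded \<gamma> \<Longrightarrow> letter_act x u \<in> graded (weight x + \<gamma>)"
    and "\<And>\<gamma> u. u \<in> graded \<gamma> \<Longrightarrow> letter_act y u \<in> graded (weight y + \<gamma>)"
    and "weight z = weight x + weight y" "c \<noteq> 0"
    and "\<And>u. letter_act x (letter_act y u) = letter_act y (letter_act x u) + scl c (letter_act z u)"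
        "u \<in> graded \<gamma>"
  shows "letter_act z u \<in> graded (weight z + \<gamma>)"
proof -
  have "letter_act x (letter_act y u) \<in> graded (weight z + \<gamma>)"
    using assms(1)[OF assms(2)[OF assms(6)]] assms(3) by (simp add: add.assoc)
  moreover have "letter_act y (letter_act x u) \<in> graded (weight z + \<gamma>)"
    using assms(2)[OF assms(1)[OF assms(6)]] assms(3) by (simp add: ac_simps)
  ultimately have "letter_act x (letter_act y u) - letter_act y (letter_act x u) \<in> graded (weight z
      + \<gamma>)"
    by (rule graded_closed)
  then have "scl c (letter_act z u) \<in> graded (weight z + \<gamma>)"
    by (simp add: assms(5))
  then show ?thesis
    using assms(4) by (rule graded_scale_cancel)
qed

text \<open>f and e/T generate n: h/T = [e/T, f], bracketing with h/T raises the exponents of f and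
  e one at a time, and h/T^(n+1) = [e/T^(n+1), f].\<close>

lemma op_graded:
  assumes "x \<in> graded \<gamma>"
  shows "letter_act z x \<in> graded (weight z + \<gamma>)"
proof -
  have F0: "letter_act (LF 0) x \<in> graded (weight (LF 0) + \<gamma>)" if "x \<in> graded \<gamma>" for \<gamma> x
    using op_graded_node[OF that, of N1] by (simp add: node_letter_def)
  have E0: "letter_act (LE 0) x \<in> graded (weight (LE 0) + \<gamma>)" if "x \<in> graded \<gamma>" for \<gamma> x
    using op_graded_node[OF that, of N2] by (simp add: node_letter_def)
  have H0: "letter_act (LH 0) x \<in> graded (weight (LH 0) + \<gamma>)" if "x \<in> graded \<gamma>" for \<gamma> x
    by (rule bracket_graded[OF E0 F0, of _ 1]) (use ef[of "-1" 0] that in simp_all)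
  have F: "letter_act (LF n) x \<in> graded (weight (LF n) + \<gamma>)" if "x \<in> graded \<gamma>" for n \<gamma> x
    using that
  proof (induction n arbitrary: \<gamma> x)
    case (Suc n)
    show ?case
      by (rule bracket_graded[OF H0 Suc.IH, of _ "-2"]) (use hf[of "-1"
          "- int n"] Suc.prems in simp_all)
  qed (rule F0)
  have E: "letter_act (LE n) x \<in> graded (weight (LE n) + \<gamma>)" if "x \<in> graded \<gamma>" for n \<gamma> x
    using that
  proof (induction n arbitrary: \<gamma> x)
    case (Suc n)
    show ?case
      by (rule bracket_graded[OF H0 Suc.IH, of _ 2]) (use he[of "-1"
          "- int (Suc n)"] Suc.prems in simp_all)
  qed (rule E0)
  have H: "letter_act (LH n) x \<in> graded (weight (LH n) + \<gamma>)" if "x \<in> graded \<gamma>" for n \<gamma> x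
    by (rule bracket_graded[OF E[of _ _ n] F0, of _ 1]) (use ef[of "- int (Suc n)"
        0] that in simp_all)
  show ?thesis using F E H assms by (cases z) auto
qed

lemma monomial_graded: "monomial w \<in> graded (weights w)"
proof (induction w)
  case Nil
  show ?case unfolding graded_def by (intro span_base CollectI exI[of _
      "[]"]) (simp add: zero_prod_def)
qed (simp add: op_graded)

lemma pbw_vector_graded:
  assumes "(is, js, ls) \<in> pbw_indices \<gamma>"
  shows "pbw_vector is js ls \<in> graded \<gamma>"
proof -
  have js: "js = map Suc (map (\<lambda>j. j - 1) js)" and ls: "ls = map Suc (map (\<lambda>j. j - 1) ls)"
    using assms by (auto simp: pbw_indices_def intro!: map_idI[symmetric])
  have "weights (map LF is @ map LH (map (\<lambda>j. j - 1) js) @ map LE (map (\<lambda>j. j - 1) ls)) = \<gamma>"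
    unfolding weights_pbw js[symmetric] ls[symmetric] using assms by (simp add: pbw_indices_def)
  then show ?thesis
    using monomial_graded monomial_pbw js ls by metis
qed

lemma graded_induct [case_names graded add]:
  assumes "\<And>\<gamma> x. x \<in> graded \<gamma> \<Longrightarrow> Q x" "\<And>x y. Q x \<Longrightarrow> Q y \<Longrightarrow> Q (x + y)"
  shows "Q x"
proof -
  define S where "S = {monomial (map node_letter is) |is. True}"
  have S: "x \<in> span S" for x
  proof (induction x rule: verma_induct)
    case v
    show ?case unfolding S_def by (intro span_base CollectI exI[of _ "[]"]) simp
  next
    case (f x)
    then show ?case
    proof (induction rule: span_induct_alt)
      case base
      show ?case using op_zero[of "LF 0"] by (simp add: span_zero)
    next
      case (step c y x)
      then obtain "is" where "y = monomial (map node_letter is)" by (auto simp: S_def)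
      then have "f 0 y \<in> S" unfolding S_def
        by (intro CollectI exI[of _ "N1 # is"]) (simp add: node_letter_def)
      with step show ?case by (simp add: op_add op_scale span_add span_scale span_base)
    qed
  next
    case (e x)
    then show ?case
    proof (induction rule: span_induct_alt)
      case base
      show ?case using op_zero[of "LE 0"] by (simp add: span_zero)
    next
      case (step c y x)
      then obtain "is" where "y = monomial (map node_letter is)" by (auto simp: S_def)
      then have "e (-1) y \<in> S" unfolding S_def
        by (intro CollectI exI[of _ "N2 # is"]) (simp add: node_letter_def)
      with step show ?case by (simp add: op_add op_scale span_add span_scale span_base)
    qed
  qed (simp_all add: span_add span_scale)
  have "x \<in> span S" by (rule S)
  then show ?thesis
  proof (induction rule: span_induct_alt)
    case base
    show ?case by (rule assms(1)[of 0 "(0, 0)"]) (simp add: graded_def span_zero)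
  next
    case (step c y x)
    then obtain "is" where "y = monomial (map node_letter is)" by (auto simp: S_def)
    then show ?case
      using step assms(1)[OF graded_closed(3)[OF monomial_graded]] by (intro assms(2)) auto
  qed
qed

end

section \<open>The dual functionals\<close>

context affine_rep
begin

lemma P_zero [simp]: "P p q i j 0 = 0"
  using P_scale[of p q i j 0 0] by simp

text \<open>On words in f and e/T a nonzero coefficient forces i + j to be the number of e/T and p +
  q the number of f minus that of e/T, and the degree determines both.\<close>

lemma P_graded:
  assumes "x \<in> graded \<gamma>" "i + j \<noteq> int (snd \<gamma>) \<or> p + q \<noteq> int (fst \<gamma>) - int (snd \<gamma>)"
  shows "P p q i j x = 0"
proof -
  have word: "P p q i j (monomial (map node_letter is)) = 0"
    if "i + j \<noteq> int (count_list is N2) \<or> p + q \<noteq> int (count_list is N1) - int (count_list is N2)"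
    for "is" p q i j
    using that
  proof (induction "is" arbitrary: p q i j)
    case Nil
    then show ?case by (auto simp: P_v)
  next
    case (Cons a "is")
    then show ?case
      by (cases a) (simp_all add: node_letter_def P_f0 P_e1 algebra_simps)
  qed
  show ?thesis
    using assms(1) unfolding graded_def
  proof (induction rule: span_induct_alt)
    case (step c y x)
    then show ?case
      using word assms(2) by (auto simp: P_add P_scale)
  qed simp
qed

text \<open>The rightmost h or e meets the vacuum and kills it: h carries the factors p and q, which
  are 0 there, and e leads from index 0 only to -1, with factor 0. The letters further left then act
  on a vector that all coefficients annihilate.\<close>

lemma P_tail:
  assumes "js \<noteq> [] \<or> ls \<noteq> []" "\<forall>j\<in>set js. 1 \<le> j" "\<forall>l\<in>set ls. 1 \<le> l"
  shows "P p q i j (pbw_vector is js ls) = 0"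
proof -
  have vac: "of_int p * P p q i j v = 0" "of_int q * P p q i j v = 0" for p q i j
    by (simp_all add: P_v)
  have v_e: "of_int ((p + 1) * p) * P (p + 1) q i j v = 0" "of_int ((q + 1) * q) * P p (q + 1) i j v
      = 0"
    for p q i j
    by (cases "p = -1"; cases "q = -1"; simp add: P_v)+
  have tail_e: "P p q i j (foldr (\<lambda>l. e (- int l)) ls v) = 0"
    if "ls \<noteq> []" "\<forall>l\<in>set ls. 1 \<le> l" for ls p q i j
    using that
  proof (induction ls arbitrary: p q i j)
    case (Cons l ls)
    then have l: "1 \<le> int l" by simp
    show ?case
      unfolding foldr.simps comp_apply P_e[OF l]
    proof (cases "ls = []")
      case True
      show "- (of_int ((p + 1) * p) * P (p + 1) q (i - int l) j (foldr (\<lambda>l. e (- int l)) ls v) +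
          of_int ((q + 1) * q) * P p (q + 1) i (j - int l) (foldr (\<lambda>l. e (- int l)) ls v)) = 0"
        unfolding True foldr.simps id_apply v_e by simp
    qed (use Cons in simp)
  qed simp
  have tail_h: "P p q i j (foldr (\<lambda>j. h (- int j)) js (foldr (\<lambda>l. e (- int l)) ls v)) = 0"
    if "js \<noteq> [] \<or> ls \<noteq> []" "\<forall>j\<in>set js. 1 \<le> j" for js p q i j
    using that
  proof (induction js arbitrary: p q i j)
    case Nil
    then show ?case using tail_e assms(3) by simp
  next
    case (Cons a js)
    then have a: "1 \<le> int a" by simp
    show ?case
      unfolding foldr.simps comp_apply P_h[OF a]
    proof (cases "js = [] \<and> ls = []")
      case True
      then have "js = []" "ls = []" by simp_all
      show "- 2 * (of_int p * P p q (i - int a) j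
            (foldr (\<lambda>j. h (- int j)) js (foldr (\<lambda>l. e (- int l)) ls v)) +
          of_int q * P p q i (j - int a)
            (foldr (\<lambda>j. h (- int j)) js (foldr (\<lambda>l. e (- int l)) ls v))) = 0"
        unfolding \<open>js = []\<close> \<open>ls = []\<close> foldr.simps id_apply vac by simp
    qed (use Cons in simp)
  qed
  show ?thesis
    unfolding pbw_vector_def using tail_h[OF assms(1,2)]
    by (induction "is" arbitrary: p q i j) (simp_all add: P_f)
qed

lemma pbw_indices_short:
  assumes "(is, js, ls) \<in> pbw_indices (n + r, n)"
  shows "(js \<noteq> [] \<or> ls \<noteq> []) \<and> (\<forall>j\<in>set js. 1 \<le> j) \<and> (\<forall>l\<in>set ls. 1 \<le> l) \<or>
    js = [] \<and> ls = [] \<and> length is = r \<and> sum_list is = n \<and> sorted_wrt (\<ge>) is"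
  using assms by (auto simp: pbw_indices_def)

lemma psi_single:
  assumes "(is, js, ls) \<in> pbw_indices (n + 1, n)"
  shows "psi 1 (int n) (pbw_vector is js ls) = (if (is, js, ls) = ([n], [], []) then 1 else 0)"
  using pbw_indices_short[OF assms]
proof (elim disjE[of "_ \<and> _"])
  assume "(js \<noteq> [] \<or> ls \<noteq> []) \<and> (\<forall>j\<in>set js. 1 \<le> j) \<and> (\<forall>l\<in>set ls. 1 \<le> l)"
  then show ?thesis using P_tail by (auto simp: psi_def)
next
  assume "js = [] \<and> ls = [] \<and> length is = 1 \<and> sum_list is = n \<and> sorted_wrt (\<ge>) is"
  then have "js = []" "ls = []" "is = [n]" by (auto simp: length_Suc_conv)
  then show ?thesis by (simp add: psi_def pbw_vector_def P_f P_v)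
qed

lemma P_ff_v: "P 1 1 i j (f (- int a) (f (- int b) v)) =
    (if i = int a \<and> j = int b then 1 else 0) + (if i = int b \<and> j = int a then 1 else 0)"
  by (simp add: P_f P_v P_neg)

text \<open>
  The factor compensates for \<open>f/T\<^sup>i f/T\<^sup>i\<close> having both of its terms at the same monomial.
\<close>

definition pair_dual :: "nat \<Rightarrow> nat \<Rightarrow> 'v \<Rightarrow> complex" where
  "pair_dual i j x = (if i = j then 1 / 2 else 1) * P 1 1 (int i) (int j) x"

lemma pbw_indices_pair:
  assumes "(is, js, ls) \<in> pbw_indices (n + 2, n)"
  shows "(js \<noteq> [] \<or> ls \<noteq> []) \<and> (\<forall>j\<in>set js. 1 \<le> j) \<and> (\<forall>l\<in>set ls. 1 \<le> l) \<or>
    (\<exists>a b. js = [] \<and> ls = [] \<and> is = [a, b] \<and> a + b = n \<and> b \<le> a)"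
  using pbw_indices_short[OF assms] by (auto simp: numeral_2_eq_2 length_Suc_conv)

lemma pair_dual_pbw:
  assumes "(is, js, ls) \<in> pbw_indices (i + j + 2, i + j)" "j \<le> i"
  shows "pair_dual i j (pbw_vector is js ls) = (if (is, js, ls) = ([i, j], [], []) then 1 else 0)"
  using pbw_indices_pair[OF assms(1)]
proof (elim disjE[of "_ \<and> _"] exE)
  assume *: "(js \<noteq> [] \<or> ls \<noteq> []) \<and> (\<forall>j\<in>set js. 1 \<le> j) \<and> (\<forall>l\<in>set ls. 1 \<le> l)"
  then have "pair_dual i j (pbw_vector is js ls) = 0"
    unfolding pair_dual_def by (subst P_tail) simp_all
  then show ?thesis using * by auto
next
  fix a b assume ab: "js = [] \<and> ls = [] \<and> is = [a, b] \<and> a + b = i + j \<and> b \<le> a"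
  then have vec: "pbw_vector is js ls = f (- int a) (f (- int b) v)"
    by (simp add: pbw_vector_def)
  have idx: "(is, js, ls) = ([i, j], [], []) \<longleftrightarrow> a = i"
    using ab by auto
  have 1: "i = a \<and> j = b \<longleftrightarrow> a = i" and 2: "i = b \<and> j = a \<longleftrightarrow> a = i \<and> i = j"
    using ab assms(2) by linarith+
  show ?thesis
    unfolding vec idx pair_dual_def P_ff_v of_nat_eq_iff 1 2 by simp
qed

lemma dual_ext:
  assumes "Vector_Spaces.linear scl (*) \<phi>" "Vector_Spaces.linear scl (*) \<phi>'"
    and "\<And>\<delta> x. \<delta> \<noteq> \<gamma> \<Longrightarrow> x \<in> graded \<delta> \<Longrightarrow> \<phi> x = \<phi>' x"
    and "\<And>is js ls. (is, js, ls) \<in> pbw_indices \<gamma> \<Longrightarrow> \<phi> (pbw_vector is js ls)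
        = \<phi>' (pbw_vector is js ls)"
  shows "\<phi> x = \<phi>' x"
proof -
  interpret f: Vector_Spaces.linear scl "(*)" \<phi> by fact
  interpret g: Vector_Spaces.linear scl "(*)" \<phi>' by fact
  show ?thesis
  proof (induction x rule: graded_induct)
    case (graded \<delta> x)
    show ?case
    proof (cases "\<delta> = \<gamma>")
      case True
      then have "x \<in> span {pbw_vector is js ls |is js ls. (is, js, ls) \<in> pbw_indices \<gamma>}"
        using graded graded_pbw by blast
      then show ?thesis
      proof (induction rule: span_induct_alt)
        case (step c y x)
        then show ?case using assms(4) by (auto simp: f.add f.scale g.add g.scale)
      qed (simp add: f.zero g.zero)
    qed (use assms(3) graded in blast)
  qed (simp add: f.add g.add)
qed

lemma linearI:
  assumes "\<And>x y. \<phi> (x + y) = \<phi> x + \<phi> y" "\<And>c x. \<phi> (scl c x) = c * \<phi> x"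
  shows "Vector_Spaces.linear scl (*) (\<phi> :: 'v \<Rightarrow> complex)"
proof -
  interpret C: vector_space "(*) :: complex \<Rightarrow> _"
    by unfold_locales (simp_all add: algebra_simps)
  show ?thesis by unfold_locales (simp_all add: assms)
qed

lemma linear_psi: "Vector_Spaces.linear scl (*) (psi d n)"
  by (rule linearI) (simp_all add: psi_linear)

lemma linear_pair_dual: "Vector_Spaces.linear scl (*) (pair_dual i j)"
  by (rule linearI) (simp_all add: pair_dual_def P_add P_scale algebra_simps)

text \<open>The left side is read off at \<open>u\<^sub>2 \<otimes> u\<^sub>0\<close> and the right
  side at \<open>u\<^sub>1 \<otimes> u\<^sub>1\<close>, so the two are compared through their
  values: both vanish outside degree (n + 2, n), and both take the value 1 on f/T^a f/T^b v and 0 on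
  PBW vectors containing h or e.\<close>

lemma psi_pair_dual:
  "psi 2 (int n) x = (\<Sum>(i, j)\<in>{(i, j). i + j = n \<and> i \<ge> j}. pair_dual i j x)"
proof (rule dual_ext[where \<gamma> = "(n + 2, n)"])
  show "Vector_Spaces.linear scl (*) (psi 2 (int n))" by (rule linear_psi)
  show "Vector_Spaces.linear scl (*) (\<lambda>x. \<Sum>(i, j)\<in>{(i, j). i + j = n \<and> i \<ge> j}. pair_dual i j x)"
    by (rule linearI)
       (simp_all add: case_prod_unfold pair_dual_def P_add P_scale sum.distrib sum_distrib_left
           algebra_simps)
  fix \<delta> x assume "\<delta> \<noteq> (n + 2, n)" "x \<in> graded \<delta>"
  then have zero: "P p q i j x = 0" if "p + q = 2" "i + j = int n" for p q i j
    using that by (intro P_graded) (auto simp: prod_eq_iff)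
  show "psi 2 (int n) x = (\<Sum>(i, j)\<in>{(i, j). i + j = n \<and> i \<ge> j}. pair_dual i j x)"
    by (subst sum.neutral) (auto simp: psi_def pair_dual_def zero simp flip: of_nat_add)
next
  have fin: "finite {(i, j). i + j = n \<and> i \<ge> j}"
    by (rule finite_subset[of _ "{..n} \<times> {..n}"]) auto
  fix "is" js ls assume ind: "(is, js, ls) \<in> pbw_indices (n + 2, n)"
  have "(\<Sum>(i, j)\<in>{(i, j). i + j = n \<and> i \<ge> j}. pair_dual i j (pbw_vector is js ls)) =
      (\<Sum>(i, j)\<in>{(i, j). i + j = n \<and> i \<ge> j}. if (is, js, ls) = ([i, j], [], []) then 1 else 0)"
    by (intro sum.cong refl) (use pair_dual_pbw[of "is" js ls] ind in auto)
  also have "\<dots> = psi 2 (int n) (pbw_vector is js ls)"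
    using pbw_indices_pair[OF ind]
  proof (elim disjE[of "_ \<and> _"] exE)
    assume "(js \<noteq> [] \<or> ls \<noteq> []) \<and> (\<forall>j\<in>set js. 1 \<le> j) \<and> (\<forall>l\<in>set ls. 1 \<le> l)"
    then show ?thesis using P_tail by (auto simp: psi_def intro!: sum.neutral)
  next
    fix a b assume ab: "js = [] \<and> ls = [] \<and> is = [a, b] \<and> a + b = n \<and> b \<le> a"
    have "(\<Sum>(i, j)\<in>{(i, j). i + j = n \<and> i \<ge> j}. if (is, js, ls) = ([i, j], [],
        []) then 1 else (0 :: complex)) =
        (\<Sum>p\<in>{(i, j). i + j = n \<and> i \<ge> j}. if p = (a, b) then 1 else 0)"
      using ab by (intro sum.cong) (auto split: if_splits)
    also have "\<dots> = 1" using ab fin by (simp add: sum.delta)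
    finally show ?thesis
      using ab by (simp add: psi_def pbw_vector_def P_f P_v P_neg flip: of_nat_add)
  qed
  finally show "psi 2 (int n) (pbw_vector is js ls) =
      (\<Sum>(i, j)\<in>{(i, j). i + j = n \<and> i \<ge> j}. pair_dual i j (pbw_vector is js ls))" ..
qed

end

section \<open>The two triangular structures\<close>

context verma_module
begin

section \<open>Relations of the loop generators on the Verma module\<close>

lemma act_zero [simp]: "act 0 x = 0"
  using act_add[of 0 0 x] by simp

lemma act_uminus: "act X (- x) = - act X x"
  using act_simps(2)[of X 0 x] by (simp add: act_simps(3))

text \<open>The span of the words in the f_i applied to v is stable under the f_i, under the e_i by
  \<open>act_e_word\<close>, and hence under everything they generate; so it contains all words
  applied to v.\<close>

lemma f_word_induct [case_names v f add scale]:
  assumes "Q v" "\<And>i x. Q x \<Longrightarrow> Q (act (chev_f i) x)"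
    and "\<And>x y. Q x \<Longrightarrow> Q y \<Longrightarrow> Q (x + y)" "\<And>c x. Q x \<Longrightarrow> Q (scl c x)"
  shows "Q x"
proof -
  define S where "S = span (range f_word)"
  have closed: "\<forall>x\<in>S. act X x \<in> S" for X
  proof (induction X rule: chev_induct)
    case (e i)
    have "act (chev_e i) (f_word w) \<in> S" for w
      using act_e_word[of i w] unfolding shifted_def S_def
      by (rule subsetD[OF span_mono, rotated]) auto
    then show ?case unfolding S_def by (auto intro: act_span)
  next
    case (f i)
    have "act (chev_f i) (f_word w) \<in> S" for w
      unfolding S_def by (intro span_base image_eqI[of _ _ "i # w"]) simp_all
    then show ?case unfolding S_def by (auto intro: act_span)
  next
    case (bracket X Y)
    then show ?case unfolding S_def by (auto simp: act_bracket intro: span_diff)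
  qed (auto simp: act_add act_scale S_def intro: span_add span_scale)
  have word: "foldr act w v \<in> S" for w
  proof (induction w)
    case Nil
    show ?case unfolding S_def by (intro span_base image_eqI[of _ _ "[]"]) simp_all
  qed (simp add: closed)
  obtain p where "word_eval scl act v p = x" using generated by blast
  then have "x \<in> S"
    using word unfolding word_eval_def S_def by (auto intro: span_sum span_scale)
  then show ?thesis
    unfolding S_def
  proof (induction rule: span_induct_alt)
    case base
    show ?case using assms(4)[OF assms(1), of 0] by simp
  next
    case (step c y x)
    have "Q (f_word w)" for w by (induction w) (simp_all add: assms(1,2))
    with step show ?case using assms(3,4) by blast
  qed
qed

text \<open>c = h_1 + h_2 has eigenvalue m + (k - m) at v and commutes with the f_i.\<close>

lemma act_central: "act (0, z) x = scl (k * z) x"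
proof -
  have one: "act affine_c x = scl k x"
  proof (induction x rule: f_word_induct)
    case v
    have "act affine_c v = act (chev_h N1 + chev_h N2) v" by simp
    also have "\<dots> = scl m v + scl (k - m) v"
      by (simp only: act_add highest_weight_vector highest_weight.simps)
    finally show ?case by (simp flip: scale_left_distrib)
  next
    case (f i x)
    have "affine_bracket affine_c (chev_f i) = 0" by (simp add: affine_c_def)
    then have "act affine_c (act (chev_f i) x) = act (chev_f i) (act affine_c x)"
      using act_bracket[of affine_c "chev_f i" x] by simp
    with f show ?case by (simp add: act_simps)
  qed (simp_all add: act_simps scale_right_distrib mult.commute)
  have "(0, z) = affine_scale z affine_c" by (simp add: affine_c_def affine_scale_c)
  then show ?thesis by (simp add: act_scale one mult.commute)
qed

lemma act_loop_scale: "act (loop (sl2_scale a x) n) u = scl a (act (loop x n) u)"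
  by (simp add: act_scale flip: affine_scale_loop)

lemma act_loop_swap:
  "act (loop x i) (act (loop y j) u) = act (loop y j) (act (loop x i) u) +
     act (loop (sl2_bracket x y) (i + j)) u + (if i + j
         = 0 then scl (of_int i * sl2_form x y * k) u else 0)"
  using act_bracket[of "loop x i" "loop y j" u]
  by (auto simp: affine_bracket_loop act_add act_central algebra_simps split: if_splits)

lemma sl2_gens:
  "sl2_bracket sl2_e sl2_e = 0" "sl2_bracket sl2_f sl2_f = 0" "sl2_bracket sl2_h sl2_h = 0"
  "sl2_bracket sl2_f sl2_e = sl2_scale (-1) sl2_h"
  "sl2_form sl2_e sl2_e = 0" "sl2_form sl2_f sl2_f = 0" "sl2_form sl2_h sl2_h = 2"
  "sl2_form sl2_e sl2_f = 1" "sl2_form sl2_f sl2_e = 1"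
  "sl2_form sl2_h sl2_e = 0" "sl2_form sl2_h sl2_f = 0"
  by (simp_all add: sl2_eq_iff sl2_coord sl2_form_coord)

text \<open>Only e and fT are known to kill v. Then hT = [e, fT] does, bracketing with hT raises the
  exponents of e and f, and finally hT^n = [e, fT^n].\<close>

lemma loop_vacuum:
  "n \<ge> 0 \<Longrightarrow> act (loop sl2_e n) v = 0" "n \<ge> 1 \<Longrightarrow> act (loop sl2_f n) v = 0"
  "n \<ge> 1 \<Longrightarrow> act (loop sl2_h n) v = 0" "act (loop sl2_h 0) v = scl m v"
proof -
  have e0: "act (loop sl2_e 0) v = 0" and f1: "act (loop sl2_f 1) v = 0"
    using highest_weight_vector(1)[of N1] highest_weight_vector(1)[of N2] by simp_all
  have h1: "act (loop sl2_h 1) v = 0"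
    using act_loop_swap[of sl2_e 0 sl2_f 1 v] by (simp add: e0 f1 sl2_brackets act_simps)
  have e: "act (loop sl2_e (int n)) v = 0" for n
  proof (induction n)
    case (Suc n)
    then show ?case
      using act_loop_swap[of sl2_h 1 sl2_e "int n" v]
      by (auto simp: h1 sl2_brackets sl2_gens act_loop_scale act_simps split: if_splits)
  qed (simp add: e0)
  have f: "act (loop sl2_f (int (Suc n))) v = 0" for n
  proof (induction n)
    case (Suc n)
    then show ?case
      using act_loop_swap[of sl2_h 1 sl2_f "int (Suc n)" v]
      by (auto simp: h1 sl2_brackets sl2_gens act_loop_scale act_simps split: if_splits)
  qed (simp add: f1)
  show e': "act (loop sl2_e n) v = 0" if "n \<ge> 0" for n
    using e[of "nat n"] that by simp
  show f': "act (loop sl2_f n) v = 0" if "n \<ge> 1" for n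
    using f[of "nat (n - 1)"] that by simp
  show "act (loop sl2_h n) v = 0" if "n \<ge> 1"
    using act_loop_swap[of sl2_e 0 sl2_f n v] that by (simp add: e0 f' sl2_brackets act_simps)
  show "act (loop sl2_h 0) v = scl m v"
    using highest_weight_vector(2)[of N1] by simp
qed

lemma functional_add_scale:
  assumes "S.env_functional \<phi>"
  shows "functional \<phi> (x + y) = functional \<phi> x + functional \<phi> y" "functional \<phi> (scl c x)
      = c * functional \<phi> x"
proof -
  interpret l: Vector_Spaces.linear scl "(*)" "functional \<phi>" by (rule functional_linear[OF assms])
  show "functional \<phi> (x + y) = functional \<phi> x + functional \<phi> y" "functional \<phi> (scl c x)
      = c * functional \<phi> x"
    by (simp_all add: l.add l.scale)
qed

lemma functional_loop:
  fixes ce cf ch s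
  assumes "coordinates ce cf ch s" "neg_part (loop x n) = loop x n"
  defines "P \<equiv> \<lambda>p q i j. functional (coordinates.fock_coeff ce cf ch s p q i j)"
  shows "P p q i j (act (loop x n) u) =
    cf x * (P (p - 1) q (i - (s - n)) j u + P p (q - 1) i (j - (s - n)) u) -
    2 * ch x * (of_int p * P p q (i + n) j u + of_int q * P p q i (j + n) u) -
    ce x * (of_int ((p + 1) * p) * P (p + 1) q (i + (s + n)) j u +
            of_int ((q + 1) * q) * P p (q + 1) i (j + (s + n)) u)"
proof -
  interpret coordinates ce cf ch s by fact
  have diff: "functional (\<lambda>w. \<phi> w - \<psi> w) u = functional \<phi> u - functional \<psi> u" for \<phi> \<psi>
    using functional_functional_linear(1)[of \<phi> "\<lambda>w. (-1) * \<psi> w" u]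
      functional_functional_linear(2)[of "-1" \<psi> u] by simp
  show ?thesis
    unfolding P_def functional_act_neg[OF env_functional_fock_coeff[OF assms(1)] assms(2)]
      fock_coeff_loop[OF assms(2)] diff functional_functional_linear ..
qed

abbreviation std_coeff :: "int \<Rightarrow> int \<Rightarrow> int \<Rightarrow> int \<Rightarrow> 'v \<Rightarrow> complex" where
  "std_coeff p q i j \<equiv> functional (coordinates.fock_coeff coord_e coord_f coord_h 0 p q i j)"

abbreviation flp_coeff :: "int \<Rightarrow> int \<Rightarrow> int \<Rightarrow> int \<Rightarrow> 'v \<Rightarrow> complex" where
  "flp_coeff p q i j \<equiv> functional (coordinates.fock_coeff coord_f coord_e (\<lambda>x.
      - coord_h x) (-1) p q i j)"

lemma coordinates_standard: "coordinates coord_e coord_f coord_h 0"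
  and coordinates_flipped: "coordinates coord_f coord_e (\<lambda>x. - coord_h x) (-1)"
  by unfold_locales

sublocale std: affine_rep scl "\<lambda>n. act (loop sl2_e n)" "\<lambda>n. act (loop sl2_f n)"
    "\<lambda>n. act (loop sl2_h n)" m k v
  std_coeff
proof unfold_locales
  fix Q :: "'v \<Rightarrow> bool" and x
  assume Q: "Q v" "\<And>x. Q x \<Longrightarrow> Q (act (loop sl2_f 0) x)" "\<And>x. Q x \<Longrightarrow> Q (act (loop sl2_e (-1)) x)"
    "\<And>x y. Q x \<Longrightarrow> Q y \<Longrightarrow> Q (x + y)" "\<And>c x. Q x \<Longrightarrow> Q (scl c x)"
  show "Q x"
  proof (induction x rule: f_word_induct)
    case (f i x)
    then show ?case using Q(2,3) by (cases i) simp_all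
  qed (simp_all add: Q)
next
  fix i j :: int and x
  show "act (loop sl2_e i) (act (loop sl2_e j) x) = act (loop sl2_e j) (act (loop sl2_e i) x)"
    "act (loop sl2_f i) (act (loop sl2_f j) x) = act (loop sl2_f j) (act (loop sl2_f i) x)"
    "act (loop sl2_e i) (act (loop sl2_f j) x) = act (loop sl2_f j) (act (loop sl2_e i) x) +
      act (loop sl2_h (i + j)) x + (if i + j = 0 then scl (of_int i * k) x else 0)"
    "act (loop sl2_h i) (act (loop sl2_e j) x) = act (loop sl2_e j) (act (loop sl2_h i) x) +
      scl 2 (act (loop sl2_e (i + j)) x)"
    "act (loop sl2_h i) (act (loop sl2_f j) x) = act (loop sl2_f j) (act (loop sl2_h i) x) +
      scl (-2) (act (loop sl2_f (i + j)) x)"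
    "act (loop sl2_h i) (act (loop sl2_h j) x) = act (loop sl2_h j) (act (loop sl2_h i) x) +
      (if i + j = 0 then scl (2 * of_int i * k) x else 0)"
    by (subst act_loop_swap; simp add: sl2_brackets sl2_gens act_loop_scale mult.commute)+
next
  fix n p q i j :: int and x
  note loop = functional_loop[OF coordinates_standard, of _ "-n"]
  show "std_coeff p q i j (act (loop sl2_f (- n)) x) =
      std_coeff (p - 1) q (i - n) j x +
      std_coeff p (q - 1) i (j - n) x" if "n \<ge> 0"
    using that by (subst loop) (auto simp: neg_part_loop neg_coeff_def)
  show "std_coeff p q i j (act (loop sl2_h (- n)) x) =
      - 2 * (of_int p * std_coeff p q (i - n) j x +
       of_int q * std_coeff p q i (j - n) x)" if "n \<ge> 1"
    using that by (subst loop) (auto simp: neg_part_loop neg_coeff_def)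
  show "std_coeff p q i j (act (loop sl2_e (- n)) x) =
      - (of_int ((p + 1) * p) * std_coeff (p + 1) q (i - n) j x +
       of_int ((q + 1) * q) * std_coeff p (q + 1) i (j - n) x)"
    if "n \<ge> 1"
    using that by (subst loop) (auto simp: neg_part_loop neg_coeff_def)
qed (simp_all add: act_simps loop_vacuum functional_add_scale functional_v env_functional_fock_coeff
    coordinates_standard
  coordinates.fock_coeff_Nil[OF coordinates_standard])

text \<open>
  The exchange of the two Chevalley nodes is the automorphism
  \<open>f T\<^sup>n \<mapsto> e T\<^sup>n\<^sup>-\<^sup>1\<close>, \<open>e T\<^sup>n \<mapsto> f T\<^sup>n\<^sup>+\<^sup>1\<close>, \<open>h T\<^sup>n \<mapsto> - h T\<^sup>n + \<delta>\<^bsub>n,0\<^esub> c\<close>, with \<open>m\<close> replaced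
  by \<open>k - m\<close>. It carries the first identity to the second.
\<close>

definition flipped_h :: "int \<Rightarrow> 'v \<Rightarrow> 'v" where
  "flipped_h n x = - act (loop sl2_h n) x + (if n = 0 then scl k x else 0)"

sublocale flp: affine_rep scl "\<lambda>n. act (loop sl2_f (n + 1))" "\<lambda>n. act (loop sl2_e (n - 1))"
  flipped_h "k - m" k v
  flp_coeff
proof (unfold_locales, unfold flipped_h_def)
  fix Q :: "'v \<Rightarrow> bool" and x
  assume Q: "Q v" "\<And>x. Q x \<Longrightarrow> Q (act (loop sl2_e (0 - 1)) x)" "\<And>x. Q x \<Longrightarrow> Q (act (loop sl2_f (- 1
      + 1)) x)"
    "\<And>x y. Q x \<Longrightarrow> Q y \<Longrightarrow> Q (x + y)" "\<And>c x. Q x \<Longrightarrow> Q (scl c x)"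
  show "Q x"
  proof (induction x rule: f_word_induct)
    case (f i x)
    then show ?case using Q(2,3) by (cases i) simp_all
  qed (simp_all add: Q)
next
  fix i j :: int and x
  show "act (loop sl2_f (i + 1)) (act (loop sl2_f (j + 1)) x) =
      act (loop sl2_f (j + 1)) (act (loop sl2_f (i + 1)) x)"
    "act (loop sl2_e (i - 1)) (act (loop sl2_e (j - 1)) x) =
      act (loop sl2_e (j - 1)) (act (loop sl2_e (i - 1)) x)"
    by (subst act_loop_swap; simp add: sl2_gens)+
  show "act (loop sl2_f (i + 1)) (act (loop sl2_e (j - 1)) x) =
      act (loop sl2_e (j - 1)) (act (loop sl2_f (i + 1)) x) +
      (- act (loop sl2_h (i + j)) x + (if i + j = 0 then scl k x else 0)) +
      (if i + j = 0 then scl (of_int i * k) x else 0)"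
    by (subst act_loop_swap) (simp add: sl2_gens act_loop_scale algebra_simps)
  show "- act (loop sl2_h i) (act (loop sl2_f (j + 1)) x) + (if i = 0 then scl k (act (loop sl2_f (j
      + 1)) x) else 0) =
      act (loop sl2_f (j + 1)) (- act (loop sl2_h i) x + (if i = 0 then scl k x else 0)) +
      scl 2 (act (loop sl2_f (i + j + 1)) x)"
    by (subst act_loop_swap)
       (simp add: sl2_gens sl2_brackets act_loop_scale act_simps act_uminus algebra_simps)
  show "- act (loop sl2_h i) (act (loop sl2_e (j - 1)) x) + (if i = 0 then scl k (act (loop sl2_e (j
      - 1)) x) else 0) =
      act (loop sl2_e (j - 1)) (- act (loop sl2_h i) x + (if i = 0 then scl k x else 0)) +
      scl (- 2) (act (loop sl2_e (i + j - 1)) x)"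
    by (subst act_loop_swap)
       (simp add: sl2_gens sl2_brackets act_loop_scale act_simps act_uminus algebra_simps)
  show "- act (loop sl2_h i) (- act (loop sl2_h j) x + (if j = 0 then scl k x else 0)) +
      (if i = 0 then scl k (- act (loop sl2_h j) x + (if j = 0 then scl k x else 0)) else 0) =
      - act (loop sl2_h j) (- act (loop sl2_h i) x + (if i = 0 then scl k x else 0)) +
      (if j = 0 then scl k (- act (loop sl2_h i) x + (if i = 0 then scl k x else 0)) else 0) +
      (if i + j = 0 then scl (2 * of_int i * k) x else 0)"
    using act_loop_swap[of sl2_h i sl2_h j x]
    by (simp add: sl2_gens act_simps act_uminus algebra_simps)
next
  fix n p q i j :: int and x
  note loop = functional_loop[OF coordinates_flipped]
  show "flp_coeff p q i j (act (loop sl2_e (- n - 1)) x) =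
      flp_coeff (p - 1) q (i - n) j x +
      flp_coeff p (q - 1) i (j - n) x" if "n \<ge> 0"
    using that by (subst loop) (auto simp: neg_part_loop neg_coeff_def)
  show "flp_coeff p q i j
        (- act (loop sl2_h (- n)) x + (if - n = 0 then scl k x else 0)) =
      - 2 * (of_int p * flp_coeff p q (i - n) j x +
       of_int q * flp_coeff p q i (j - n) x)"
    if "n \<ge> 1"
  proof -
    have "flp_coeff p q i j (- y) =
        - flp_coeff p q i j y" for y
      using functional_add_scale(2)[OF env_functional_fock_coeff[OF coordinates_flipped], of p q i j
          "-1" y] by simp
    with that show ?thesis
      by (simp add: loop[of sl2_h "- n"] neg_part_loop neg_coeff_def)
  qed
  show "flp_coeff p q i j (act (loop sl2_f (- n + 1)) x) =
      - (of_int ((p + 1) * p) * flp_coeff (p + 1) q (i - n) j x +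
       of_int ((q + 1) * q) * flp_coeff p (q + 1) i (j - n) x)"
    if "n \<ge> 1"
    using that by (subst loop) (auto simp: neg_part_loop neg_coeff_def)
qed (simp_all add: act_simps act_uminus loop_vacuum functional_add_scale functional_v
    env_functional_fock_coeff coordinates_flipped
  coordinates.fock_coeff_Nil[OF coordinates_flipped] algebra_simps)

end

section \<open>The contragradient module\<close>

context verma_module
begin

lemma std_node: "foldr act (map chev_f is) v = std.monomial (map std.node_letter is)"
proof (induction "is")
  case (Cons i "is")
  then show ?case by (cases i) (simp_all add: std.node_letter_def)
qed simp

lemma std_graded: "std.graded \<gamma> = component scl act v \<gamma>"
  by (simp add: std.graded_def component_def std_node)

section \<open>Transport of components and PBW vectors through the exchange of nodes\<close>

fun flip_node :: "node \<Rightarrow> node" where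
  "flip_node N1 = N2"
| "flip_node N2 = N1"

lemma flip_node_flip [simp]: "flip_node (flip_node i) = i"
  by (cases i) simp_all

lemma count_flip: "count_list (map flip_node is) N1 = count_list is N2"
  "count_list (map flip_node is) N2 = count_list is N1"
proof (induction "is")
  case (Cons i "is")
  { case 1 with Cons show ?case by (cases i) simp_all }
  { case 2 with Cons show ?case by (cases i) simp_all }
qed simp_all

lemma flp_node: "flp.monomial (map flp.node_letter is)
    = foldr act (map chev_f (map flip_node is)) v"
proof (induction "is")
  case (Cons i "is")
  then show ?case by (cases i) (simp_all add: flp.node_letter_def)
qed simp

lemma flp_graded: "flp.graded (prod.swap \<gamma>) = component scl act v \<gamma>"
proof -
  have "{flp.monomial (map flp.node_letter is) |is. count_list is N1 = snd \<gamma> \<and> count_list is N2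
      = fst \<gamma>} =
    {foldr act (map chev_f is) v |is. count_list is N1 = fst \<gamma> \<and> count_list is N2 = snd \<gamma>}"
  proof (intro equalityI subsetI)
    fix x assume "x \<in> {flp.monomial (map flp.node_letter is) |is. count_list is N1
        = snd \<gamma> \<and> count_list is N2 = fst \<gamma>}"
    then obtain "is" where "x = flp.monomial (map flp.node_letter is)" "count_list is N1 = snd \<gamma>"
        "count_list is N2 = fst \<gamma>"
      by auto
    then show "x \<in> {foldr act (map chev_f is) v |is. count_list is N1 = fst \<gamma> \<and> count_list is N2
        = snd \<gamma>}"
      by (intro CollectI exI[of _ "map flip_node is"]) (simp add: flp_node count_flip del: map_map)
  next
    fix x assume "x \<in> {foldr act (map chev_f is) v |is. count_list is N1 = fst \<gamma> \<and> count_list is N2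
        = snd \<gamma>}"
    then obtain "is" where "x = foldr act (map chev_f is) v" "count_list is N1 = fst \<gamma>"
        "count_list is N2 = snd \<gamma>"
      by auto
    moreover have "map flip_node (map flip_node is) = is" by (simp add: comp_def)
    ultimately show "x \<in> {flp.monomial (map flp.node_letter is) |is. count_list is N1
        = snd \<gamma> \<and> count_list is N2 = fst \<gamma>}"
      by (intro CollectI exI[of _ "map flip_node is"]) (simp only: flp_node count_flip simp_thms)
  qed
  then show ?thesis by (simp add: flp.graded_def component_def)
qed

lemma std_pbw_vector:
  "std.pbw_vector is js ls = foldr act (map (overT sl2_f) is @ map (overT sl2_h) js @ map (overT
      sl2_e) ls) v"
  by (simp add: std.pbw_vector_def foldr_map overT_def comp_def)

text \<open>Every factor h/T^j with j \<ge> 1 changes sign under the exchange, whence the power of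
  -1; the exponents of e drop by one and those of f grow by one.\<close>

lemma flp_pbw_vector:
  assumes "\<forall>j\<in>set js. 1 \<le> j" "\<forall>l\<in>set ls. 1 \<le> l"
  shows "flp.pbw_vector (map (\<lambda>l. l - 1) ls) js (map Suc is) = scl ((-1) ^ length js)
    (foldr act (map (overT sl2_e) ls @ map (overT sl2_h) js @ map (overT sl2_f) is) v)"
proof -
  have f: "foldr (\<lambda>l. act (loop sl2_f (- int l + 1))) (map Suc is) v
      = foldr act (map (overT sl2_f) is) v"
    by (induction "is") (simp_all add: overT_def)
  have h: "foldr (\<lambda>j. flipped_h (- int j)) js y =
      scl ((-1) ^ length js) (foldr act (map (overT sl2_h) js) y)" for y
    using assms(1) by (induction js) (simp_all add: overT_def act_simps flipped_h_def)
  have e: "foldr (\<lambda>l. act (loop sl2_e (- int l - 1))) (map (\<lambda>l. l - 1) ls) (scl c y) =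
      scl c (foldr act (map (overT sl2_e) ls) y)" for c y
    using assms(2) by (induction ls) (simp_all add: overT_def act_simps of_nat_diff)
  show ?thesis
    by (simp only: flp.pbw_vector_def f h e foldr_append)
qed

lemma pbw_indices_flip:
  assumes "(is, js, ls) \<in> pbw_indices \<gamma>"
  shows "(map (\<lambda>l. l - 1) ls, js, map Suc is) \<in> pbw_indices (prod.swap \<gamma>)"
proof -
  have ls: "\<forall>l\<in>set ls. 1 \<le> l" "sorted_wrt (\<ge>) ls"
    using assms by (simp_all add: pbw_indices_def)
  have "sum_list (map (\<lambda>l. l - 1) ls) + length ls = sum_list ls"
    using ls(1) by (induction ls) auto
  moreover have "sum_list (map Suc is) = sum_list is + length is"
    by (induction "is") auto
  moreover have "sorted_wrt (\<ge>) (map (\<lambda>l. l - 1) ls)"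
    using ls(2) by (auto simp: sorted_wrt_map intro: sorted_wrt_mono_rel[rotated])
  ultimately show ?thesis
    using assms by (auto simp: pbw_indices_def sorted_wrt_map)
qed

lemma pbw_indices_unflip:
  assumes "(is, js, ls) \<in> pbw_indices (prod.swap \<gamma>)"
  shows "(map (\<lambda>l. l - 1) ls, js, map Suc is) \<in> pbw_indices \<gamma>"
  using pbw_indices_flip[OF assms] by simp

lemma pbw_index_pos:
  assumes "(is, js, ls) \<in> pbw_indices \<gamma>"
  shows "\<forall>j\<in>set js. 1 \<le> j" "\<forall>l\<in>set ls. 1 \<le> l"
  using assms by (auto simp: pbw_indices_def)

definition flipped_vector :: "nat list \<Rightarrow> nat list \<Rightarrow> nat list \<Rightarrow> 'v" where
  "flipped_vector is js ls = foldr act (map (overT sl2_e) ls @ map (overT sl2_h) js @ map (overT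
      sl2_f) is) v"

lemma pbw_basis_alt:
  "pbw_basis act v \<gamma> =
    (if fst \<gamma> > snd \<gamma> \<or> \<gamma> = (0, 0) then {std.pbw_vector is js ls |is js ls. (is, js, ls)
        \<in> pbw_indices \<gamma>}
     else if fst \<gamma> < snd \<gamma> then {flipped_vector is js ls |is js ls. (is, js, ls) \<in> pbw_indices \<gamma>}
     else {})"
  by (simp add: pbw_basis_def std_pbw_vector flipped_vector_def)

lemma flp_pbw_vector':
  assumes "(is, js, ls) \<in> pbw_indices (prod.swap \<gamma>)"
  shows "flp.pbw_vector is js ls = scl ((-1) ^ length js) (flipped_vector (map (\<lambda>l. l
      - 1) ls) js (map Suc is))"
proof -
  have "map Suc (map (\<lambda>l. l - 1) ls) = ls"
    using pbw_index_pos(2)[OF assms] by (auto intro!: map_idI)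
  then show ?thesis
    using flp_pbw_vector[OF pbw_index_pos[OF pbw_indices_unflip[OF assms]], of "map (\<lambda>l. l - 1) ls"]
    by (simp add: flipped_vector_def comp_def)
qed

lemma pbw_basis_component: "pbw_basis act v \<gamma> \<subseteq> component scl act v \<gamma>"
proof
  fix b assume b: "b \<in> pbw_basis act v \<gamma>"
  consider (1) "fst \<gamma> > snd \<gamma> \<or> \<gamma> = (0, 0)" | (2) "fst \<gamma> < snd \<gamma>" "\<not> (fst \<gamma> > snd \<gamma> \<or> \<gamma> = (0, 0))"
    using b by (force simp: pbw_basis_alt split: if_splits)
  then show "b \<in> component scl act v \<gamma>"
  proof cases
    case 1
    then obtain "is" js ls where i: "(is, js, ls) \<in> pbw_indices \<gamma>" "b = std.pbw_vector is js ls"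
      using b by (auto simp: pbw_basis_alt)
    then show ?thesis
      using std.pbw_vector_graded[OF i(1)] by (simp add: std_graded)
  next
    case 2
    then obtain "is" js ls where i: "(is, js, ls) \<in> pbw_indices \<gamma>" "b = flipped_vector is js ls"
      using b by (auto simp: pbw_basis_alt)
    have "scl ((-1) ^ length js) b \<in> component scl act v \<gamma>"
      using flp.pbw_vector_graded[OF pbw_indices_flip[OF i(1)]] flp_pbw_vector[OF pbw_index_pos[OF
          i(1)]]
      by (simp add: i(2) flipped_vector_def flp_graded)
    then show ?thesis
      using flp.graded_scale_cancel[of "(-1) ^ length js" b "prod.swap \<gamma>"] by (simp add: flp_graded)
  qed
qed

lemma component_pbw_basis:
  assumes "fst \<gamma> \<noteq> snd \<gamma> \<or> \<gamma> = (0, 0)"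
  shows "component scl act v \<gamma> \<subseteq> span (pbw_basis act v \<gamma>)"
proof (cases "fst \<gamma> > snd \<gamma> \<or> \<gamma> = (0, 0)")
  case True
  then show ?thesis using std.graded_pbw[of \<gamma>] by (simp add: pbw_basis_alt std_graded)
next
  case False
  have "component scl act v \<gamma> \<subseteq> span {flp.pbw_vector is js ls |is js ls. (is, js, ls)
      \<in> pbw_indices (prod.swap \<gamma>)}"
    using flp.graded_pbw[of "prod.swap \<gamma>"] by (simp add: flp_graded)
  also have "\<dots> \<subseteq> span (pbw_basis act v \<gamma>)"
  proof (rule span_minimal[OF _ subspace_span], safe)
    fix "is" js ls assume i: "(is, js, ls) \<in> pbw_indices (prod.swap \<gamma>)"
    have "flipped_vector (map (\<lambda>l. l - 1) ls) js (map Suc is) \<in> pbw_basis act v \<gamma>"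
      using False assms pbw_indices_unflip[OF i] by (auto simp: pbw_basis_alt)
    then show "flp.pbw_vector is js ls \<in> span (pbw_basis act v \<gamma>)"
      unfolding flp_pbw_vector'[OF i] by (intro span_scale span_base)
  qed
  finally show ?thesis .
qed

text \<open>The description leaves the degree of w open. It is forced, because \<phi> is 1 at w and
  0 on all other components; after that, spanning by the PBW basis determines the
  functional.\<close>

lemma dual_vector_eqI:
  assumes "Vector_Spaces.linear scl (*) \<phi>" "fst \<gamma> \<noteq> snd \<gamma> \<or> \<gamma> = (0, 0)" "w \<in> pbw_basis act v \<gamma>"
    and "\<And>b. b \<in> pbw_basis act v \<gamma> \<Longrightarrow> \<phi> b = (if b = w then 1 else 0)"
    and "\<And>\<delta> x. \<delta> \<noteq> \<gamma> \<Longrightarrow> x \<in> component scl act v \<delta> \<Longrightarrow> \<phi> x = 0"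
  shows "dual_vector scl act v w = \<phi>"
  unfolding dual_vector_def
proof (rule the_equality)
  show "Vector_Spaces.linear scl (*) \<phi> \<and> (\<exists>\<gamma>. w \<in> pbw_basis act v \<gamma> \<and>
      (\<forall>b\<in>pbw_basis act v \<gamma>. \<phi> b = (if b = w then 1 else 0)) \<and>
      (\<forall>\<delta>. \<delta> \<noteq> \<gamma> \<longrightarrow> (\<forall>x\<in>component scl act v \<delta>. \<phi> x = 0)))"
    using assms by blast
next
  fix \<psi> assume \<psi>: "Vector_Spaces.linear scl (*) \<psi> \<and> (\<exists>\<gamma>. w \<in> pbw_basis act v \<gamma> \<and>
      (\<forall>b\<in>pbw_basis act v \<gamma>. \<psi> b = (if b = w then 1 else 0)) \<and>
      (\<forall>\<delta>. \<delta> \<noteq> \<gamma> \<longrightarrow> (\<forall>x\<in>component scl act v \<delta>. \<psi> x = 0)))"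
  then obtain \<gamma>' where \<gamma>': "w \<in> pbw_basis act v \<gamma>'"
    "\<forall>b\<in>pbw_basis act v \<gamma>'. \<psi> b = (if b = w then 1 else 0)"
    "\<forall>\<delta>. \<delta> \<noteq> \<gamma>' \<longrightarrow> (\<forall>x\<in>component scl act v \<delta>. \<psi> x = 0)"
    by blast
  have "\<phi> w = 1" using assms(3,4) by simp
  then have "\<gamma>' = \<gamma>"
    using assms(5)[of \<gamma>' w] \<gamma>'(1) pbw_basis_component by fastforce
  interpret f: Vector_Spaces.linear scl "(*)" \<phi> by fact
  interpret g: Vector_Spaces.linear scl "(*)" \<psi> using \<psi> by blast
  show "\<psi> = \<phi>"
  proof
    fix x show "\<psi> x = \<phi> x"
    proof (induction x rule: std.graded_induct)
      case (graded \<delta> x)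
      show ?case
      proof (cases "\<delta> = \<gamma>")
        case True
        then have "x \<in> span (pbw_basis act v \<gamma>)"
          using graded component_pbw_basis[OF assms(2)] by (auto simp: std_graded)
        then show ?thesis
        proof (induction rule: span_induct_alt)
          case (step c y x)
          then show ?case
            using assms(4)[of y] \<gamma>'(2) \<open>\<gamma>' = \<gamma>\<close> by (auto simp: f.add f.scale g.add g.scale)
        qed (simp add: f.zero g.zero)
      next
        case False
        then show ?thesis
          using graded assms(5)[of \<delta> x] \<gamma>'(3)[rule_format, of \<delta> x] \<open>\<gamma>' = \<gamma>\<close>
          by (simp add: std_graded)
      qed
    qed (simp add: f.add g.add)
  qed
qed

lemma std_dual_vector:
  assumes "Vector_Spaces.linear scl (*) \<phi>" "fst \<gamma> > snd \<gamma> \<or> \<gamma> = (0, 0)" "(is0, js0, ls0)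
      \<in> pbw_indices \<gamma>"
    and "\<And>is js ls. (is, js, ls) \<in> pbw_indices \<gamma> \<Longrightarrow>
      \<phi> (std.pbw_vector is js ls) = (if (is, js, ls) = (is0, js0, ls0) then 1 else 0)"
    and "\<And>\<delta> x. \<delta> \<noteq> \<gamma> \<Longrightarrow> x \<in> std.graded \<delta> \<Longrightarrow> \<phi> x = 0"
  shows "dual_vector scl act v (std.pbw_vector is0 js0 ls0) = \<phi>"
proof (rule dual_vector_eqI[where \<gamma> = \<gamma>])
  fix b assume "b \<in> pbw_basis act v \<gamma>"
  then obtain "is" js ls where b: "(is, js, ls) \<in> pbw_indices \<gamma>" "b = std.pbw_vector is js ls"
    using assms(2) by (auto simp: pbw_basis_alt)
  \<comment> \<open>The values of \<phi> themselves separate the chosen vector from those with other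
    indices.\<close>
  show "\<phi> b = (if b = std.pbw_vector is0 js0 ls0 then 1 else 0)"
    using assms(4)[OF b(1)] assms(4)[OF assms(3)] b(2) by (auto split: if_splits)
next
  show "std.pbw_vector is0 js0 ls0 \<in> pbw_basis act v \<gamma>"
    using assms(2,3) by (auto simp: pbw_basis_alt)
qed (use assms std_graded in auto)

text \<open>Flipped PBW vectors agree with basis vectors up to sign. The sign is 1 for the chosen
  vector, which contains no h, and at the other vectors \<phi> is 0 with either sign.\<close>

lemma flp_dual_vector:
  assumes "Vector_Spaces.linear scl (*) \<phi>" "fst \<gamma> > snd \<gamma>" "(is0, [], ls0) \<in> pbw_indices \<gamma>"
    and "\<And>is js ls. (is, js, ls) \<in> pbw_indices \<gamma> \<Longrightarrow>
      \<phi> (flp.pbw_vector is js ls) = (if (is, js, ls) = (is0, [], ls0) then 1 else 0)"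
    and "\<And>\<delta> x. \<delta> \<noteq> \<gamma> \<Longrightarrow> x \<in> flp.graded \<delta> \<Longrightarrow> \<phi> x = 0"
  shows "dual_vector scl act v (flp.pbw_vector is0 [] ls0) = \<phi>"
proof (rule dual_vector_eqI[where \<gamma> = "prod.swap \<gamma>"])
  interpret f: Vector_Spaces.linear scl "(*)" \<phi> by fact
  have basis: "pbw_basis act v (prod.swap \<gamma>) = {flipped_vector is js ls |is js ls. (is, js, ls)
      \<in> pbw_indices (prod.swap \<gamma>)}"
  proof -
    have "prod.swap \<gamma> \<noteq> (0, 0)" using assms(2) by (auto simp: prod_eq_iff)
    then show ?thesis using assms(2) by (simp add: pbw_basis_alt)
  qed
  have w: "flp.pbw_vector is0 [] ls0 = flipped_vector (map (\<lambda>l. l - 1) ls0) [] (map Suc is0)"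
    using flp_pbw_vector'[of is0 "[]" ls0 "prod.swap \<gamma>"] assms(3) by simp
  show "flp.pbw_vector is0 [] ls0 \<in> pbw_basis act v (prod.swap \<gamma>)"
    unfolding w basis using pbw_indices_flip[OF assms(3)] by blast
  fix b assume "b \<in> pbw_basis act v (prod.swap \<gamma>)"
  then obtain "is" js ls where b: "(is, js, ls) \<in> pbw_indices (prod.swap \<gamma>)" "b
      = flipped_vector is js ls"
    unfolding basis by blast
  define is' ls' where "is' = map (\<lambda>l. l - 1) ls" and "ls' = map Suc is"
  have i': "(is', js, ls') \<in> pbw_indices \<gamma>"
    using pbw_indices_unflip[OF b(1)] by (simp add: is'_def ls'_def)
  have b': "flp.pbw_vector is' js ls' = scl ((-1) ^ length js) b"
    using flp_pbw_vector[OF pbw_index_pos[OF b(1)], of "is"]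
        by (simp add: is'_def ls'_def b(2) flipped_vector_def)
  then have eq: "(-1) ^ length js * \<phi> b = (if (is', js, ls') = (is0, [], ls0) then 1 else 0)"
    using assms(4)[OF i'] by (simp add: f.scale)
  show "\<phi> b = (if b = flp.pbw_vector is0 [] ls0 then 1 else 0)"
  proof (cases "(is', js, ls') = (is0, [], ls0)")
    case True
    then show ?thesis using eq b' by auto
  next
    case False
    then have "\<phi> b = 0" using eq by auto
    moreover have "\<phi> (flp.pbw_vector is0 [] ls0) = 1" using assms(4)[OF assms(3)] by simp
    ultimately show ?thesis by auto
  qed
next
  fix \<delta> x assume "\<delta> \<noteq> prod.swap \<gamma>" "x \<in> component scl act v \<delta>"
  then show "\<phi> x = 0"
    using assms(5)[of "prod.swap \<delta>" x] flp_graded[of \<delta>] by (metis swap_swap)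
qed (use assms in auto)

section \<open>The dual vectors occurring in the two identities\<close>

lemma dual_v_std: "dual_vector scl act v v = std.psi 0 0"
proof -
  have v: "std.pbw_vector [] [] [] = v" by (simp add: std.pbw_vector_def)
  have zero: "(is, js, ls) \<in> pbw_indices (0, 0) \<longleftrightarrow> is = [] \<and> js = [] \<and> ls = []" for "is" js ls
    by (cases "is"; cases js; cases ls) (auto simp: pbw_indices_def)
  have "dual_vector scl act v (std.pbw_vector [] [] []) = std.psi 0 0"
    by (rule std_dual_vector[where \<gamma> = "(0, 0)"])
       (auto simp: std.linear_psi zero v std.psi_def std.P_v prod_eq_iff intro: std.P_graded)
  then show ?thesis by (simp only: v)
qed

text \<open>The exchange of nodes fixes v and the degree (0, 0), so the dual of v starts both
  identities.\<close>

lemma dual_v_flp: "dual_vector scl act v v = flp.psi 0 0"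
proof (rule dual_vector_eqI[where \<gamma> = "(0, 0)"])
  fix \<delta> :: "nat \<times> nat" and x assume "\<delta> \<noteq> (0, 0)" "x \<in> component scl act v \<delta>"
  then show "flp.psi 0 0 x = 0"
    unfolding flp.psi_def by (intro flp.P_graded[of _
        "prod.swap \<delta>"]) (auto simp: flp_graded prod_eq_iff)
qed (auto simp: pbw_basis_zero flp.linear_psi flp.psi_def flp.P_v)

lemma dual_f: "dual_vector scl act v (act (overT sl2_f n) v) = std.psi 1 (int n)"
proof -
  have "dual_vector scl act v (std.pbw_vector [n] [] []) = std.psi 1 (int n)"
  proof (rule std_dual_vector[where \<gamma> = "(n + 1, n)"])
    fix \<delta> :: "nat \<times> nat" and x assume "\<delta> \<noteq> (n + 1, n)" "x \<in> std.graded \<delta>"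
    then show "std.psi 1 (int n) x = 0"
      unfolding std.psi_def by (intro std.P_graded[of x \<delta>]) (auto simp: prod_eq_iff)
  next
    show "([n], [], []) \<in> pbw_indices (n + 1, n)"
      by (simp add: pbw_indices_def)
  qed (use std.linear_psi std.psi_single in auto)
  then show ?thesis by (simp add: std.pbw_vector_def overT_def)
qed

lemma dual_ff:
  assumes "j \<le> i"
  shows "dual_vector scl act v (act (overT sl2_f i) (act (overT sl2_f j) v)) = std.pair_dual i j"
proof -
  have "dual_vector scl act v (std.pbw_vector [i, j] [] []) = std.pair_dual i j"
  proof (rule std_dual_vector[where \<gamma> = "(i + j + 2, i + j)"])
    show "([i, j], [], []) \<in> pbw_indices (i + j + 2, i + j)"
      using assms by (simp add: pbw_indices_def)
    fix \<delta> :: "nat \<times> nat" and x assume "\<delta> \<noteq> (i + j + 2, i + j)" "x \<in> std.graded \<delta>"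
    then show "std.pair_dual i j x = 0"
      unfolding std.pair_dual_def by (subst std.P_graded[of x \<delta>]) (auto simp: prod_eq_iff)
  qed (use assms std.linear_pair_dual std.pair_dual_pbw in auto)
  then show ?thesis by (simp add: std.pbw_vector_def overT_def)
qed

lemma overT_Suc: "overT x (Suc n) = loop x (- int n - 1)"
proof -
  have "- int (Suc n) = - int n - 1" by simp
  then show ?thesis by (simp only: overT_def)
qed

text \<open>e/T^(n+1) is the flipped f/T^n, whence the offset between the two exponents.\<close>

lemma dual_e: "dual_vector scl act v (act (overT sl2_e (Suc n)) v) = flp.psi 1 (int n)"
proof -
  have "dual_vector scl act v (flp.pbw_vector [n] [] []) = flp.psi 1 (int n)"
  proof (rule flp_dual_vector[where \<gamma> = "(n + 1, n)"])
    fix \<delta> :: "nat \<times> nat" and x assume "\<delta> \<noteq> (n + 1, n)" "x \<in> flp.graded \<delta>"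
    then show "flp.psi 1 (int n) x = 0"
      unfolding flp.psi_def by (intro flp.P_graded[of x \<delta>]) (auto simp: prod_eq_iff)
  next
    show "([n], [], []) \<in> pbw_indices (n + 1, n)"
      by (simp add: pbw_indices_def)
  qed (use flp.linear_psi flp.psi_single in auto)
  then show ?thesis by (simp add: flp.pbw_vector_def overT_Suc)
qed

lemma dual_ee:
  assumes "j \<le> i"
  shows "dual_vector scl act v (act (overT sl2_e (Suc i)) (act (overT sl2_e (Suc j)) v))
      = flp.pair_dual i j"
proof -
  have "dual_vector scl act v (flp.pbw_vector [i, j] [] []) = flp.pair_dual i j"
  proof (rule flp_dual_vector[where \<gamma> = "(i + j + 2, i + j)"])
    show "([i, j], [], []) \<in> pbw_indices (i + j + 2, i + j)"
      using assms by (simp add: pbw_indices_def)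
    fix \<delta> :: "nat \<times> nat" and x assume "\<delta> \<noteq> (i + j + 2, i + j)" "x \<in> flp.graded \<delta>"
    then show "flp.pair_dual i j x = 0"
      unfolding flp.pair_dual_def by (subst flp.P_graded[of x \<delta>]) (auto simp: prod_eq_iff)
  qed (use assms flp.linear_pair_dual flp.pair_dual_pbw in auto)
  then show ?thesis by (simp add: flp.pbw_vector_def overT_Suc)
qed

section \<open>The two identities in the contragradient module\<close>

lemma contra_overT:
  "contra act (overT sl2_f n) \<phi> x = \<phi> (act (loop sl2_e (int n)) x)"
  "contra act (overT sl2_e n) \<phi> x = \<phi> (act (loop sl2_f (int n)) x)"
  "contra act (overT sl2_h n) \<phi> x = \<phi> (act (loop sl2_h (int n)) x)"
  by (simp_all add: contra_def overT_def sl2_transpose_gens)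

lemma contra_f_dual_v:
  assumes "a > 0"
  shows "contra act (overT sl2_f (a - 1)) (dual_vector scl act v v) x =
    (m + (of_nat a - 1) * (k + 2)) * dual_vector scl act v (act (overT sl2_f (a - 1)) v) x +
    (\<Sum>l = 1..a - 1.
      contra act (overT sl2_h l) (dual_vector scl act v (act (overT sl2_f (a - 1 - l)) v)) x +
      2 * contra act (overT sl2_e l)
        (\<lambda>y. \<Sum>(i, j) \<in> {(i, j). i + j = a - 1 - l \<and> i \<ge> j}.
           dual_vector scl act v (act (overT sl2_f i) (act (overT sl2_f j) v)) y) x)"
proof -
  have "(\<Sum>(i, j) \<in> {(i, j). i + j = n \<and> i \<ge> j}.
      dual_vector scl act v (act (overT sl2_f i) (act (overT sl2_f j) v)) y) = std.psi 2 (int n) y"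
          for n y
    unfolding std.psi_pair_dual by (intro sum.cong refl) (auto simp: dual_ff)
  moreover have "of_nat a - 1 = (of_nat (a - 1) :: complex)"
    using assms by (simp add: of_nat_diff)
  ultimately show ?thesis
    using std.psi_identity[where n = "a - 1" and x = x]
    by (simp only: contra_overT dual_v_std dual_f)
qed

lemma contra_e_dual_v:
  assumes "a > 0"
  shows "contra act (overT sl2_e a) (dual_vector scl act v v) x =
    (of_nat a * (k + 2) - m - 2) * dual_vector scl act v (act (overT sl2_e a) v) x +
    (\<Sum>l\<in>{l. l + 2 \<le> a}.
      - contra act (overT sl2_h (l + 1)) (dual_vector scl act v (act (overT sl2_e (a - l
          - 1)) v)) x +
      2 * contra act (overT sl2_f l)
        (\<lambda>y. \<Sum>(i, j) \<in> {(i, j). i + j = a - l \<and> i \<ge> j \<and> j \<ge> 1}.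
           dual_vector scl act v (act (overT sl2_e i) (act (overT sl2_e j) v)) y) x)"
proof -
  obtain n where a: "a = Suc n" using assms by (cases a) auto
  \<comment> \<open>Both exponents drop by one, so their total drops from a - l to a - l - 2 = n -
    Suc l; the bound on l keeps this subtraction from being truncated.\<close>
  have pairs: "(\<Sum>(i, j) \<in> {(i, j). i + j = a - l \<and> i \<ge> j \<and> j \<ge> 1}.
      dual_vector scl act v (act (overT sl2_e i) (act (overT sl2_e j) v)) y) = flp.psi 2 (int (n
          - Suc l)) y"
    if "l + 2 \<le> a" for l y
  proof -
    have "(\<Sum>(i, j) \<in> {(i, j). i + j = a - l \<and> i \<ge> j \<and> j \<ge> 1}.
        dual_vector scl act v (act (overT sl2_e i) (act (overT sl2_e j) v)) y) =
      (\<Sum>(i, j) \<in> {(i, j). i + j = n - Suc l \<and> i \<ge> j}. flp.pair_dual i j y)"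
      by (rule sum.reindex_bij_witness[where i = "\<lambda>(i, j). (Suc i, Suc j)" and j = "\<lambda>(i, j). (i - 1,
          j - 1)"])
         (use that a in \<open>auto simp: dual_ee[symmetric]\<close>)
    then show ?thesis by (simp only: flp.psi_pair_dual)
  qed
  have h: "flp.psi d i (- y) = - flp.psi d i y" for d i y
    using flp.psi_linear(3)[of d i "-1" y] by simp
  have "(\<Sum>l = 1..n. flp.psi 1 (int (n - l)) (flipped_h (int l) x) +
        2 * flp.psi 2 (int (n - l)) (act (loop sl2_e (int l - 1)) x)) =
      (\<Sum>l\<in>{l. l + 2 \<le> a}. - contra act (overT sl2_h (l
          + 1)) (dual_vector scl act v (act (overT sl2_e (a - l - 1)) v)) x +
      2 * contra act (overT sl2_f l)
        (\<lambda>y. \<Sum>(i, j) \<in> {(i, j). i + j = a - l \<and> i \<ge> j \<and> j \<ge> 1}.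
           dual_vector scl act v (act (overT sl2_e i) (act (overT sl2_e j) v)) y) x)"
  \<comment> \<open>The flipped fT^l is eT^(l-1), through which f/T^(l-1) acts on the dual; hence
    the sum over 1..n becomes one starting at 0.\<close>
  proof (rule sum.reindex_bij_witness[where i = Suc and j = "\<lambda>l. l - 1"])
    fix l assume l: "l \<in> {1..n}"
    then obtain l' where l': "l = Suc l'" by (cases l) auto
    have "a - l' - 1 = Suc (n - Suc l')" using l l' a by auto
    then have e: "dual_vector scl act v (act (overT sl2_e (a - l' - 1)) v) = flp.psi 1 (int (n
        - Suc l'))"
      by (simp only: dual_e)
    have 1: "l - 1 = l'" "int l - 1 = int l'" and 2: "l' + 2 \<le> a"
      using l l' a by simp_all
    show "- contra act (overT sl2_h (l - 1 + 1)) (dual_vector scl act v (act (overT sl2_e (a - (l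
        - 1) - 1)) v)) x +
      2 * contra act (overT sl2_f (l - 1))
        (\<lambda>y. \<Sum>(i, j) \<in> {(i, j). i + j = a - (l - 1) \<and> i \<ge> j \<and> j \<ge> 1}.
           dual_vector scl act v (act (overT sl2_e i) (act (overT sl2_e j) v)) y) x =
      flp.psi 1 (int (n - l)) (flipped_h (int l) x) +
        2 * flp.psi 2 (int (n - l)) (act (loop sl2_e (int l - 1)) x)"
      unfolding 1 contra_overT e pairs[OF 2] using l' by (simp add: h flipped_h_def)
  qed (use a in auto)
  moreover have "contra act (overT sl2_e a) (dual_vector scl act v v) x
      = flp.psi 0 0 (act (loop sl2_f (int n + 1)) x)"
    by (simp add: contra_overT dual_v_flp a add.commute)
  \<comment> \<open>The constant of the first identity with m replaced by k - m and with the
    exponent n = a - 1 of the flipped generator.\<close>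
  moreover have "of_nat a * (k + 2) - m - 2 = (k - m) + of_nat n * (k + 2)"
    by (simp add: a algebra_simps)
  moreover have "dual_vector scl act v (act (overT sl2_e a) v) = flp.psi 1 (int n)"
    by (simp only: a dual_e)
  ultimately show ?thesis
    using flp.psi_identity[where n = n and x = x] by simp
qed

end

theorem theorem3p2:
  fixes scl :: "complex \<Rightarrow> 'v::ab_group_add \<Rightarrow> 'v"
    and act :: "affine_sl2 \<Rightarrow> 'v \<Rightarrow> 'v"
    and m k :: complex and v :: 'v and a :: nat
  assumes "verma_module scl act m k v" and "a > 0"
  shows
    "(contra act (overT sl2_f (a - 1)) (dual_vector scl act v v) =
      (\<lambda>x. (m + (of_nat a - 1) * (k + 2)) *
              dual_vector scl act v (act (overT sl2_f (a - 1)) v) x +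
           (\<Sum>l = 1..a - 1.
              contra act (overT sl2_h l)
                (dual_vector scl act v (act (overT sl2_f (a - 1 - l)) v)) x +
              2 * contra act (overT sl2_e l)
                (\<lambda>y. \<Sum>(i, j) \<in> {(i, j). i + j = a - 1 - l \<and> i \<ge> j}.
                   dual_vector scl act v (act (overT sl2_f i) (act (overT sl2_f j) v)) y) x)))
     \<and>
     (contra act (overT sl2_e a) (dual_vector scl act v v) =
      (\<lambda>x. (of_nat a * (k + 2) - m - 2) *
              dual_vector scl act v (act (overT sl2_e a) v) x +
           (\<Sum>l\<in>{l. l + 2 \<le> a}.
              - contra act (overT sl2_h (l + 1))
                (dual_vector scl act v (act (overT sl2_e (a - l - 1)) v)) x +
              2 * contra act (overT sl2_f l)
                (\<lambda>y. \<Sum>(i, j) \<in> {(i, j). i + j = a - l \<and> i \<ge> j \<and> j \<ge> 1}.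
                   dual_vector scl act v (act (overT sl2_e i) (act (overT sl2_e j) v)) y) x)))"
proof -
  interpret verma_module scl act m k v by fact
  show ?thesis
    using assms(2) by (intro conjI ext contra_f_dual_v contra_e_dual_v)
qed

end
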